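(* For $k \ge 2$, $F_k(x,y)$ is decomposed into a sum of rational functions of $T_x$ and $T_y$ over the set $BG_k$ of basic graphs with Betti number $k$ as \[ F_k(x,y)=\sum_{\mathcal{B} \in BG_k} J_{\mathcal{B}}(x,y), \qquad J_{\mathcal{B}}(x,y) = \frac{ T_x^{|V_1|}T_y^{|V_2|}}{g_{\mathcal{B}}\,(1-T_xT_y)^{N_{\rm sp} + k-1-e}}, \] where $V_1 \sqcup V_2$ is the vertex set (with its bipartition) of $\mathcal{B}$, $g_{\mathcal{B}}$ is the number of automorphisms of $\mathcal{B}$, and $N_{\rm sp}$ and $e$ are the numbers of vertices of degree $\ge 3$ and of $\delta$-edges in $\mathcal{B}$, respectively.
   Context: Generating functions. For integers $r,s\ge 0$ and $k$, $N_{\rm bi}(r,s,k)$ is the number of connected bipartite simple graphs with labeled bipartition $V_1\sqcup V_2$, $|V_1|=r$, $|V_2|=s$, having exactly $r+s+k-1$ edges (connected spanning subgraphs of $K_{r,s}$ with Betti number $k$). If $rs=0$, then $N_{\rm bi}(r,s,k)=1$ if $k=0$ and $(r,s)\in\{(1,0),(0,1)\}$, and $0$ otherwise. $F_k(x,y) = \sum_{r,s\ge0} \frac{N_{\rm bi}(r,s,k)}{r!s!}x^r y^s$, $T:=F_0$, $T_x=x\partial_xT$, $T_y=y\partial_yT$. Basic graphs. All bipartite graphs carry an ordered bipartition $(V_1,V_2)$; isomorphisms and automorphisms preserve each of $V_1$ and $V_2$. Let $k\ge2$ and let $G$ be a connected bipartite simple graph with Betti number $k$. Delete leaves (with their edges)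 repeatedly until none is left; the result $G'$ is independent of the order, is connected with Betti number $k$, and has all degrees $\ge2$. A vertex of $G'$ is a special point if its degree is $\ge3$ and a normal point if its degree is $2$. A special path is a path in $G'$ joining two distinct special points with all interior vertices normal; a special cycle is a cycle containing exactly one special point. $G'$ is the union of its special paths and special cycles, which are disjoint except at special points. They are classified as follows. - $\alpha_i$-cycle ($i=1,2$): a special cycle whose special point is in $V_i$; its minimal form has $3$ normal points (length $4$). - $\beta_j$-path ($j=1,2$): a special path between two distinct special points both in $V_j$; its minimal form has $1$ normal point (length $2$). - For special points $v_1\in V_1$, $v_2\in V_2$: if exactly one special path joins $v_1$ and $v_2$, it is called a $\gamma$-path; its minimal form is a single edge (length $1$). If more than one special path joins $v_1$ and $v_2$, those of length $\ge3$ are called $\delta$-paths (minimal form: $2$ normal points, length $3$), and the one of length $1$, if present (there is at most one), is called a $\delta$-edge. The basic graph $\mathcal{B}(G)$ is the unlabeled bipartite graph (i.e. isomorphism class) obtained from $G'$ by replacing each $\alpha_i$-cycle, $\beta_j$-path, $\gamma$-path and $\delta$-path by its minimal form (keeping $\delta$-edges) and forgetting the labels. $BG_k$ is the (finite) set of all $\mathcal{B}(G)$, for $G$ ranging over connected bipartite graphs with Betti number $k$. *)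

theory Defs
  imports
    "HOL-Computational_Algebra.Formal_Power_Series"
    "HOL-Combinatorics.Permutations"
begin

section \<open>Bipartite simple graphs with an ordered bipartition\<close>

text \<open>An edge is the two-element set of its end vertices; \<open>lverts\<close> is $V_1$ and \<open>rverts\<close> is $V_2$.\<close>

record 'v bigraph =
  lverts :: "'v set"
  rverts :: "'v set"
  edges :: "'v set set"

definition bigraph :: "'v bigraph \<Rightarrow> bool" where
  "bigraph G \<longleftrightarrow> finite (lverts G) \<and> finite (rverts G) \<and> lverts G \<inter> rverts G = {} \<and>
     edges G \<subseteq> {{u, v} | u v. u \<in> lverts G \<and> v \<in> rverts G}"

definition verts :: "'v bigraph \<Rightarrow> 'v set" where
  "verts G = lverts G \<union> rverts G"

definition deg :: "'v bigraph \<Rightarrow> 'v \<Rightarrow> nat" where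
  "deg G v = card {e \<in> edges G. v \<in> e}"

definition connected_bigraph :: "'v bigraph \<Rightarrow> bool" where
  "connected_bigraph G \<longleftrightarrow> verts G \<noteq> {} \<and>
     (\<forall>u\<in>verts G. \<forall>v\<in>verts G. (\<lambda>a b. {a, b} \<in> edges G)\<^sup>*\<^sup>* u v)"

text \<open>Used for connected graphs only, hence the summand 1 for the number of components.\<close>

definition betti :: "'v bigraph \<Rightarrow> int" where
  "betti G = int (card (edges G)) - int (card (verts G)) + 1"

definition bigraph_iso :: "('v \<Rightarrow> 'w) \<Rightarrow> 'v bigraph \<Rightarrow> 'w bigraph \<Rightarrow> bool" where
  "bigraph_iso f G H \<longleftrightarrow> bij_betw f (lverts G) (lverts H) \<and> bij_betw f (rverts G) (rverts H) \<and>
     bij_betw f (verts G) (verts H) \<and> edges H = (\<lambda>e. f ` e) ` edges G"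

text \<open>\<open>permutes\<close> makes an automorphism the identity outside the vertex set, so that
  counting functions counts automorphisms.\<close>

definition automorphisms :: "'v bigraph \<Rightarrow> ('v \<Rightarrow> 'v) set" where
  "automorphisms G = {f. f permutes verts G \<and> bigraph_iso f G G}"

text \<open>Unlabeled graphs are isomorphism classes of graphs on natural numbers.\<close>

definition iso_class :: "'v bigraph \<Rightarrow> nat bigraph set" where
  "iso_class G = {H. bigraph H \<and> (\<exists>f. bigraph_iso f G H)}"


section \<open>Generating functions\<close>

definition N_bi :: "nat \<Rightarrow> nat \<Rightarrow> int \<Rightarrow> nat" where
  "N_bi r s k = card {G :: (nat + nat) bigraph.
     lverts G = Inl ` {..<r} \<and> rverts G = Inr ` {..<s} \<and> bigraph G \<and> connected_bigraph G \<and>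
     int (card (edges G)) = int r + int s + k - 1}"

text \<open>The convention for $rs = 0$ agrees with this definition.\<close>

lemma N_bi_degenerate:
  assumes "r * s = 0"
  shows "N_bi r s k = (if k = 0 \<and> (r, s) \<in> {(1, 0), (0, 1)} then 1 else 0)"
proof -
  let ?S = "{G :: (nat + nat) bigraph.
     lverts G = Inl ` {..<r} \<and> rverts G = Inr ` {..<s} \<and> bigraph G \<and> connected_bigraph G \<and>
     int (card (edges G)) = int r + int s + k - 1}"
  let ?G = "\<lparr>lverts = Inl ` {..<r}, rverts = Inr ` {..<s}, edges = {}\<rparr> :: (nat + nat) bigraph"
  have empty: "edges G = {}" if "G \<in> ?S" for G
    using that assms by (auto simp: bigraph_def)
  have eq: "G = ?G" if "G \<in> ?S" for G
    using empty[OF that] that by (cases G) auto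
  have "?G \<in> ?S \<longleftrightarrow> k = 0 \<and> (r, s) \<in> {(1, 0), (0, 1)}"
  proof
    assume A: "?G \<in> ?S"
    have one: "u = v" if "u \<in> verts ?G" "v \<in> verts ?G" for u v
    proof -
      have "(\<lambda>a b. {a, b} \<in> edges ?G)\<^sup>*\<^sup>* u v"
        using A that unfolding connected_bigraph_def by blast
      thus "u = v" by (induction rule: rtranclp_induct) auto
    qed
    have "r < 2"
    proof (rule ccontr)
      assume "\<not> r < 2"
      hence "Inl 0 \<in> verts ?G" "Inl 1 \<in> verts ?G" by (auto simp: verts_def)
      from one[OF this] show False by simp
    qed
    moreover have "s < 2"
    proof (rule ccontr)
      assume "\<not> s < 2"
      hence "Inr 0 \<in> verts ?G" "Inr 1 \<in> verts ?G" by (auto simp: verts_def)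
      from one[OF this] show False by simp
    qed
    moreover have "r > 0 \<or> s > 0"
      using A by (auto simp: connected_bigraph_def verts_def)
    ultimately have "(r, s) \<in> {(1, 0), (0, 1)}" using assms by auto
    thus "k = 0 \<and> (r, s) \<in> {(1, 0), (0, 1)}" using A by auto
  next
    assume "k = 0 \<and> (r, s) \<in> {(1, 0), (0, 1)}"
    thus "?G \<in> ?S"
      by (auto simp: bigraph_def connected_bigraph_def verts_def lessThan_Suc)
  qed
  moreover have "card A = (if a \<in> A then 1 else 0)" if "\<And>x. x \<in> A \<Longrightarrow> x = a"
    for A and a :: "(nat + nat) bigraph"
  proof -
    have "A = {a} \<or> A = {}" using that by blast
    thus ?thesis by auto
  qed
  from this[of ?S ?G, OF eq] have "card ?S = (if ?G \<in> ?S then 1 else 0)" .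
  ultimately show ?thesis unfolding N_bi_def by (simp only:)
qed

text \<open>Bivariate formal power series in $x$, $y$: the outer variable is $x$, and the coefficient
  of $x^r$ is a power series in $y$.\<close>

definition F :: "int \<Rightarrow> rat fps fps" where
  "F k = Abs_fps (\<lambda>r. Abs_fps (\<lambda>s. of_nat (N_bi r s k) / (fact r * fact s)))"

definition T :: "rat fps fps" where
  "T = F 0"

definition T_x :: "rat fps fps" where
  "T_x = fps_X * fps_deriv T"

definition T_y :: "rat fps fps" where
  "T_y = Abs_fps (\<lambda>r. fps_X * fps_deriv (fps_nth T r))"


section \<open>Special points, special paths and special cycles\<close>

definition delete_vertex :: "'v bigraph \<Rightarrow> 'v \<Rightarrow> 'v bigraph" where
  "delete_vertex G v =
     \<lparr>lverts = lverts G - {v}, rverts = rverts G - {v}, edges = {e \<in> edges G. v \<notin> e}\<rparr>"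

definition leaf :: "'v bigraph \<Rightarrow> 'v \<Rightarrow> bool" where
  "leaf G v \<longleftrightarrow> v \<in> verts G \<and> deg G v = 1"

text \<open>$G'$.\<close>

definition prune :: "'v bigraph \<Rightarrow> 'v bigraph" where
  "prune G = (THE H. (\<lambda>A B. \<exists>v. leaf A v \<and> B = delete_vertex A v)\<^sup>*\<^sup>* G H \<and> (\<nexists>v. leaf H v))"

definition special :: "'v bigraph \<Rightarrow> 'v \<Rightarrow> bool" where
  "special G v \<longleftrightarrow> v \<in> verts G \<and> deg G v \<ge> 3"

definition normal :: "'v bigraph \<Rightarrow> 'v \<Rightarrow> bool" where
  "normal G v \<longleftrightarrow> v \<in> verts G \<and> deg G v = 2"

fun walk_edges :: "'v list \<Rightarrow> 'v set set" where
  "walk_edges (u # v # w) = insert {u, v} (walk_edges (v # w))"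
| "walk_edges _ = {}"

text \<open>Paths and cycles are subgraphs, represented by their edge sets \<open>P\<close>; in particular
  the two directions of traversal give the same path, and the length is \<open>card P\<close>. The
  definitions from here on are meant for graphs without leaves, such as \<open>prune G\<close>.\<close>

definition special_path :: "'v bigraph \<Rightarrow> 'v \<Rightarrow> 'v \<Rightarrow> 'v set set \<Rightarrow> bool" where
  "special_path G u v P \<longleftrightarrow> special G u \<and> special G v \<and>
     (\<exists>q. distinct (u # q @ [v]) \<and> (\<forall>x\<in>set q. normal G x) \<and>
          P = walk_edges (u # q @ [v]) \<and> P \<subseteq> edges G)"

definition special_cycle :: "'v bigraph \<Rightarrow> 'v \<Rightarrow> 'v set set \<Rightarrow> bool" where
  "special_cycle G v P \<longleftrightarrow> special G v \<and>
     (\<exists>q. length q \<ge> 2 \<and> distinct (v # q) \<and> (\<forall>x\<in>set q. normal G x) \<and>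
          P = walk_edges (v # q @ [v]) \<and> P \<subseteq> edges G)"

text \<open>An $\alpha_1$- or $\alpha_2$-cycle is a \<open>special_cycle G v P\<close> with \<open>v\<close> in \<open>lverts G\<close> or
  \<open>rverts G\<close>, respectively. In the $\gamma$ and $\delta$ cases \<open>u\<close> is the end vertex in $V_1$.\<close>

definition beta_path :: "'v bigraph \<Rightarrow> 'v \<Rightarrow> 'v \<Rightarrow> 'v set set \<Rightarrow> bool" where
  "beta_path G u v P \<longleftrightarrow> special_path G u v P \<and>
     (u \<in> lverts G \<and> v \<in> lverts G \<or> u \<in> rverts G \<and> v \<in> rverts G)"

definition gamma_path :: "'v bigraph \<Rightarrow> 'v \<Rightarrow> 'v \<Rightarrow> 'v set set \<Rightarrow> bool" where
  "gamma_path G u v P \<longleftrightarrow> u \<in> lverts G \<and> v \<in> rverts G \<and> special_path G u v P \<and>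
     card {Q. special_path G u v Q} = 1"

definition delta_path :: "'v bigraph \<Rightarrow> 'v \<Rightarrow> 'v \<Rightarrow> 'v set set \<Rightarrow> bool" where
  "delta_path G u v P \<longleftrightarrow> u \<in> lverts G \<and> v \<in> rverts G \<and> special_path G u v P \<and>
     card {Q. special_path G u v Q} > 1 \<and> card P \<ge> 3"

definition delta_edge :: "'v bigraph \<Rightarrow> 'v \<Rightarrow> 'v \<Rightarrow> 'v set set \<Rightarrow> bool" where
  "delta_edge G u v P \<longleftrightarrow> u \<in> lverts G \<and> v \<in> rverts G \<and> special_path G u v P \<and>
     card {Q. special_path G u v Q} > 1 \<and> card P = 1"


section \<open>Basic graphs\<close>

text \<open>\<open>Sp v\<close> is the special point \<open>v\<close>, and \<open>Nm P i\<close> is the \<open>i\<close>-th normal point of the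
  minimal form that replaces the special path or cycle \<open>P\<close>.\<close>

datatype 'v mvert = Sp 'v | Nm "'v set set" nat

text \<open>The minimal forms, as walks between special points. The graph \<open>minimal_form G\<close> is their
  union; its vertices alternate between the two sides along each walk, starting on the side
  of the initial special point.\<close>

inductive_set minimal_walks :: "'v bigraph \<Rightarrow> 'v mvert list set" for G where
  alpha: "special_cycle G v P \<Longrightarrow> [Sp v, Nm P 0, Nm P 1, Nm P 2, Sp v] \<in> minimal_walks G"
| beta: "beta_path G u v P \<Longrightarrow> [Sp u, Nm P 0, Sp v] \<in> minimal_walks G"
| gamma: "gamma_path G u v P \<Longrightarrow> [Sp u, Sp v] \<in> minimal_walks G"
| delta: "delta_path G u v P \<Longrightarrow> [Sp u, Nm P 0, Nm P 1, Sp v] \<in> minimal_walks G"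
| delta_edge: "delta_edge G u v P \<Longrightarrow> [Sp u, Sp v] \<in> minimal_walks G"

definition minimal_form :: "'v bigraph \<Rightarrow> 'v mvert bigraph" where
  "minimal_form G =
     \<lparr>lverts = {w ! i | w i u. w \<in> minimal_walks G \<and> i < length w \<and> hd w = Sp u \<and>
                               (even i \<longleftrightarrow> u \<in> lverts G)},
      rverts = {w ! i | w i u. w \<in> minimal_walks G \<and> i < length w \<and> hd w = Sp u \<and>
                               (even i \<longleftrightarrow> u \<in> rverts G)},
      edges = (\<Union>w\<in>minimal_walks G. walk_edges w)\<rparr>"

definition basic_graph :: "'v bigraph \<Rightarrow> nat bigraph set" where
  "basic_graph G = iso_class (minimal_form (prune G))"

definition BG :: "int \<Rightarrow> nat bigraph set set" where
  "BG k = {basic_graph G | G :: nat bigraph. bigraph G \<and> connected_bigraph G \<and> betti G = k}"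

definition N_sp :: "'v bigraph \<Rightarrow> nat" where
  "N_sp G = card {v. special G v}"

definition n_delta_edges :: "'v bigraph \<Rightarrow> nat" where
  "n_delta_edges G = card {P. \<exists>u v. delta_edge G u v P}"

text \<open>The quotient is one of formal power series: the denominator has the nonzero constant
  coefficient \<open>card (automorphisms G)\<close>.\<close>

definition J_graph :: "int \<Rightarrow> 'v bigraph \<Rightarrow> rat fps fps" where
  "J_graph k G = T_x ^ card (lverts G) * T_y ^ card (rverts G) /
     (of_nat (card (automorphisms G)) *
      (1 - T_x * T_y) powi (int (N_sp G) + k - 1 - int (n_delta_edges G)))"

text \<open>The value does not depend on the representative of the isomorphism class.\<close>

definition J :: "int \<Rightarrow> nat bigraph set \<Rightarrow> rat fps fps" where
  "J k B = J_graph k (SOME G. G \<in> B)"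

end

theory Submission
  imports Defs
begin

text \<open>
  A connected graph is its pruned core together with a forest rooted at the vertices of the core.
  Forests rooted at \<open>a\<close> and \<open>b\<close> given vertices of the two sides are products of rooted trees, so
  substituting \<open>T_x\<close> and \<open>T_y\<close> into the exponential generating function of the cores gives \<open>F k\<close>.

  The cores with a given basic graph are counted by induction on their excess, the number of pairs
  of vertices to be contracted until every special path and cycle is minimal. A step replaces an
  edge \<open>u - w\<close> by a path \<open>u - j - i - w\<close>. Weighting the subdivision of an edge of a path of
  length \<open>l\<close> and excess \<open>m\<close> by \<open>(m + 1) / l\<close>, and the inverse contraction alike, a double count
  of the subdivisions yields \<open>m c(m) = a b (m - 1 + p) c(m - 1)\<close>, where \<open>c(m)\<close> is the number of
  labelled cores of excess \<open>m\<close> with \<open>a\<close> and \<open>b\<close> vertices, and \<open>p\<close> is the number of special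
  paths and cycles that are not delta edges. Since cores of excess 0 are isomorphic to their basic
  graph \<open>B\<close>, \<open>c(0)\<close> is the product of the factorials of the side sizes divided by the number of
  automorphisms. Hence the exponential generating function of these cores is that of \<open>B\<close> divided
  by \<open>(1 - x y) ^ p\<close>.
\<close>

text \<open>Counting the cores over a basic graph directly would mean distributing lengths over its
  special paths and cycles and dividing by symmetries that permute and reverse them, in a way that
  depends on the lengths. Comparing excess m with excess m - 1 avoids this: automorphisms enter only
  at excess 0. An unweighted comparison would fail, since a path of length l has l edges to
  subdivide but only l - 2 edges to contract, numbers that depend on how the excess is distributed.
  With the weights, a path or cycle of excess m gives m + 1 for its subdivisions and m for its
  contractions, so the totals are the excess plus p and the excess. The quotients (m - 1 + p) / m
  are those of the coefficients of (1 - z) ^ (-p). Delta edges are left out of p because lengthening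
  one turns it into a delta path and changes the basic graph; for the same reason a delta path of
  length 3 must not be contracted. The exponent is N_sp + k - 1 - e because replacing each special
  path or cycle by a single edge gives a multigraph on the special points with the same Betti
  number, hence with N_sp + k - 1 edges.\<close>

lemma bigraphD:
  assumes "bigraph G"
  shows "finite (lverts G)" "finite (rverts G)" "lverts G \<inter> rverts G = {}" "finite (verts G)"
  using assms by (auto simp: bigraph_def verts_def)

lemma edgeE:
  assumes "bigraph G" "e \<in> edges G"
  obtains u v where "u \<in> lverts G" "v \<in> rverts G" "e = {u, v}" "u \<noteq> v"
proof -
  from assms obtain u v where "u \<in> lverts G" "v \<in> rverts G" "e = {u, v}"
    unfolding bigraph_def by blast
  moreover from this have "u \<noteq> v" using bigraphD(3)[OF assms(1)] by blast
  ultimately show thesis using that by blast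
qed

lemma edge_subset_verts: "bigraph G \<Longrightarrow> e \<in> edges G \<Longrightarrow> e \<subseteq> verts G"
  by (erule edgeE) (auto simp: verts_def)

lemma finite_edges: "bigraph G \<Longrightarrow> finite (edges G)"
  by (rule finite_subset[of _ "Pow (verts G)"]) (auto simp: bigraphD dest: edge_subset_verts)

lemma card_edge: "bigraph G \<Longrightarrow> e \<in> edges G \<Longrightarrow> card e = 2"
  by (erule edgeE) auto

lemma handshake:
  assumes "bigraph G"
  shows "(\<Sum>v\<in>verts G. deg G v) = 2 * card (edges G)"
proof -
  have "card {v \<in> verts G. v \<in> e} = 2" if "e \<in> edges G" for e
  proof -
    have "{v \<in> verts G. v \<in> e} = e" using edge_subset_verts[OF assms that] by auto
    thus ?thesis using card_edge[OF assms that] by simp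
  qed
  hence "(\<Sum>v\<in>verts G. deg G v) = (\<Sum>e\<in>edges G. 2)"
    unfolding deg_def using bigraphD[OF assms] finite_edges[OF assms]
    by (intro sum_multicount_gen) auto
  thus ?thesis by simp
qed

lemma normal_not_special: "normal G x \<Longrightarrow> \<not> special G x"
  by (auto simp: normal_def special_def)

lemma normal_edges_eq:
  assumes "bigraph G" "normal G x" "e \<in> edges G" "f \<in> edges G" "x \<in> e" "x \<in> f" "e \<noteq> f"
  shows "{g \<in> edges G. x \<in> g} = {e, f}"
proof -
  have "card {g \<in> edges G. x \<in> g} = 2" using assms(2) by (simp add: normal_def deg_def)
  moreover have "{e, f} \<subseteq> {g \<in> edges G. x \<in> g}" using assms by auto
  moreover have "card {e, f} = 2" using assms by auto
  ultimately show ?thesis using card_seteq[of "{g \<in> edges G. x \<in> g}" "{e, f}"] finite_edges[OF assms(1)] by auto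
qed

section \<open>Edge sets of vertex lists, and the alternation of sides along a walk\<close>

section \<open>Walks\<close>

lemma walk_edges_Cons: "w \<noteq> [] \<Longrightarrow> walk_edges (u # w) = insert {u, hd w} (walk_edges w)"
  by (cases w) auto

lemma walk_edges_append:
  "xs \<noteq> [] \<Longrightarrow> ys \<noteq> [] \<Longrightarrow>
    walk_edges (xs @ ys) = walk_edges xs \<union> insert {last xs, hd ys} (walk_edges ys)"
  by (induction xs rule: walk_edges.induct) (auto simp: walk_edges_Cons)

lemma walk_edges_snoc:
  "xs \<noteq> [] \<Longrightarrow> walk_edges (xs @ [x]) = insert {last xs, x} (walk_edges xs)"
  by (simp add: walk_edges_append)

lemma walk_edges_rev: "walk_edges (rev w) = walk_edges w"
proof (induction w)
  case (Cons a w)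
  thus ?case by (cases "w = []") (simp_all add: walk_edges_Cons walk_edges_append last_rev insert_commute)
qed auto

lemma walk_edges_subset: "e \<in> walk_edges w \<Longrightarrow> e \<subseteq> set w"
  by (induction w rule: walk_edges.induct) auto

lemma walk_edges_map: "walk_edges (map f w) = (\<lambda>e. f ` e) ` walk_edges w"
  by (induction w rule: walk_edges.induct) auto

lemma finite_walk_edges: "finite (walk_edges w)"
  by (induction w rule: walk_edges.induct) auto

lemma Union_walk_edges: "length w \<ge> 2 \<Longrightarrow> \<Union>(walk_edges w) = set w"
proof (induction w rule: walk_edges.induct)
  case (1 u v w)
  thus ?case by (cases w) auto
qed auto

lemma card_walk_edges: "distinct w \<Longrightarrow> card (walk_edges w) = length w - 1"
proof (induction w rule: walk_edges.induct)
  case (1 u v w)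
  have "{u, v} \<notin> walk_edges (v # w)" using 1 walk_edges_subset[of "{u,v}" "v#w"] by auto
  thus ?case using 1 by (simp add: finite_walk_edges)
qed auto

lemma walk_edges_interior:
  assumes "w = xs @ x # ys" "xs \<noteq> []" "ys \<noteq> []"
  shows "{last xs, x} \<in> walk_edges w" "{x, hd ys} \<in> walk_edges w"
  using assms by (auto simp: walk_edges_append walk_edges_Cons)

lemma walk_side:
  assumes "bigraph G" "walk_edges w \<subseteq> edges G" "i < length w" "length w \<ge> 2"
  shows "w ! i \<in> lverts G \<longleftrightarrow> (even i \<longleftrightarrow> hd w \<in> lverts G)"
    and "w ! i \<in> rverts G \<longleftrightarrow> (even i \<longleftrightarrow> hd w \<in> rverts G)"
proof -
  have *: "(w ! i \<in> lverts G \<longleftrightarrow> (even i \<longleftrightarrow> hd w \<in> lverts G)) \<and> (w ! i \<in> rverts G \<longleftrightarrow> (even i \<longleftrightarrow> hd w \<in> rverts G))"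
    using assms(2-4)
  proof (induction w arbitrary: i rule: walk_edges.induct)
    case (1 u v w)
    have "{u, v} \<in> edges G" using 1 by auto
    hence uv: "(u \<in> lverts G \<longleftrightarrow> v \<notin> lverts G)" "(u \<in> rverts G \<longleftrightarrow> v \<notin> rverts G)"
      using edgeE[OF assms(1), of "{u,v}"] bigraphD(3)[OF assms(1)] by (auto simp: doubleton_eq_iff)
    show ?case
    proof (cases i)
      case (Suc j)
      show ?thesis
      proof (cases w)
        case Nil thus ?thesis using 1 uv Suc by (auto simp: less_Suc_eq)
      next
        case (Cons a list)
        thus ?thesis using "1.IH"[of j] "1.prems" uv Suc by auto
      qed
    qed auto
  qed auto
  thus "w ! i \<in> lverts G \<longleftrightarrow> (even i \<longleftrightarrow> hd w \<in> lverts G)"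
    and "w ! i \<in> rverts G \<longleftrightarrow> (even i \<longleftrightarrow> hd w \<in> rverts G)" by blast+
qed

section \<open>Decomposition of a core into special paths and cycles, and the resulting
  counts\<close>

section \<open>Threads\<close>

text \<open>These are exactly the prunings of connected graphs of Betti number at least 2. The
  special point excludes single cycles, which contain no special path or special cycle.\<close>

definition core :: "'v bigraph \<Rightarrow> bool" where
  "core G \<longleftrightarrow> bigraph G \<and> connected_bigraph G \<and> (\<forall>v\<in>verts G. deg G v \<ge> 2) \<and> (\<exists>v. special G v)"

text \<open>The special paths and cycles of a core are the equivalence classes of edges under the relation
  generated by sharing a normal point; end points and lengths then suffice to describe their types.\<close>

definition link :: "'v bigraph \<Rightarrow> ('v set \<times> 'v set) set" where
  "link G = {(e, f). e \<in> edges G \<and> f \<in> edges G \<and> (\<exists>x. normal G x \<and> x \<in> e \<and> x \<in> f)}"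

definition thread :: "'v bigraph \<Rightarrow> 'v set \<Rightarrow> 'v set set" where
  "thread G e = (link G)\<^sup>* `` {e}"

definition threads :: "'v bigraph \<Rightarrow> 'v set set set" where
  "threads G = thread G ` edges G"

definition ends :: "'v bigraph \<Rightarrow> 'v set set \<Rightarrow> 'v set" where
  "ends G P = {v \<in> \<Union>P. special G v}"

text \<open>One notion for special paths (\<open>u\<close> different from \<open>v\<close>) and
  special cycles (\<open>u = v\<close>), hence two overlapping distinctness conditions in place of
  one for the whole walk. The bound on \<open>length q\<close> rules out degenerate closed walks
  such as the one along an edge and back.\<close>

definition chain :: "'v bigraph \<Rightarrow> 'v \<Rightarrow> 'v list \<Rightarrow> 'v \<Rightarrow> bool" where
  "chain G u q v \<longleftrightarrow> special G u \<and> special G v \<and> (\<forall>x\<in>set q. normal G x) \<and>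
     distinct (u # q) \<and> distinct (q @ [v]) \<and> walk_edges (u # q @ [v]) \<subseteq> edges G \<and>
     (u = v \<longrightarrow> length q \<ge> 2)"

lemma coreD:
  assumes "core G"
  shows "bigraph G" "connected_bigraph G" "v \<in> verts G \<Longrightarrow> deg G v \<ge> 2"
  using assms by (auto simp: core_def)

lemma core_cases: "core G \<Longrightarrow> v \<in> verts G \<Longrightarrow> special G v \<or> normal G v"
  using coreD(3)[of G v] by (auto simp: special_def normal_def)

lemma sym_link: "sym (link G)"
  by (auto simp: link_def sym_def)

lemma thread_refl: "e \<in> thread G e"
  by (simp add: thread_def)

lemma thread_eq: "f \<in> thread G e \<Longrightarrow> thread G f = thread G e"
  using sym_rtrancl[OF sym_link[of G]]
  by (auto simp: thread_def sym_def intro: rtrancl_trans)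

lemma thread_subset:
  assumes "e \<in> edges G"
  shows "thread G e \<subseteq> edges G"
proof
  fix f assume "f \<in> thread G e"
  hence "(e, f) \<in> (link G)\<^sup>*" by (simp add: thread_def)
  thus "f \<in> edges G" by (induction) (use assms in \<open>auto simp: link_def\<close>)
qed

lemma threads_edge: "P \<in> threads G \<Longrightarrow> e \<in> P \<Longrightarrow> e \<in> edges G \<and> P = thread G e"
  unfolding threads_def using thread_eq thread_subset by blast

lemma thread_in_threads: "e \<in> edges G \<Longrightarrow> thread G e \<in> threads G"
  by (simp add: threads_def)

lemma threads_disjoint: "P \<in> threads G \<Longrightarrow> Q \<in> threads G \<Longrightarrow> e \<in> P \<Longrightarrow> e \<in> Q \<Longrightarrow> P = Q"
  using threads_edge by metis

lemma Union_threads: "\<Union>(threads G) = edges G"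
  using thread_refl thread_subset unfolding threads_def by blast

lemma finite_threads: "bigraph G \<Longrightarrow> finite (threads G)"
  by (simp add: threads_def finite_edges)

lemma finite_thread: "bigraph G \<Longrightarrow> P \<in> threads G \<Longrightarrow> finite P"
  using Union_threads finite_edges by (metis Union_upper finite_subset)

lemma chain_rev: "chain G u q v \<Longrightarrow> chain G v (rev q) u"
  using walk_edges_rev[of "u # q @ [v]"] by (auto simp: chain_def)

text \<open>The predecessor and the successor of an interior point could coincide only for
  \<open>u = v\<close> and a single interior point, which the third premise excludes. A normal
  interior point therefore has both its edges on the walk.\<close>

lemma chain_neighbours:
  assumes "distinct (u # q)" "distinct (q @ [v])" "u = v \<longrightarrow> length q \<ge> 2" "x \<in> set q"
  obtains y z where "{y, x} \<in> walk_edges (u # q @ [v])" "{x, z} \<in> walk_edges (u # q @ [v])"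
    "y \<noteq> z" "x \<noteq> y" "x \<noteq> z" "y \<in> set (u # q)" "z \<in> set (q @ [v])"
proof -
  obtain q1 q2 where q: "q = q1 @ x # q2" using assms(4) by (auto simp: in_set_conv_decomp)
  let ?y = "last (u # q1)" and ?z = "hd (q2 @ [v])"
  have y: "?y \<in> set (u # q1)" by (rule last_in_set) simp
  have z: "?z \<in> set (q2 @ [v])" by (rule hd_in_set) simp
  have 1: "{?y, x} \<in> walk_edges (u # q @ [v])" and 2: "{x, ?z} \<in> walk_edges (u # q @ [v])"
    using walk_edges_interior[of "u # q @ [v]" "u # q1" x "q2 @ [v]"] by (auto simp: q)
  have "?y \<noteq> ?z"
  proof
    assume eq: "?y = ?z"
    have "?y \<in> set q1 \<or> q1 = [] \<and> ?y = u" by (cases q1) auto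
    moreover have "?z \<in> set q2 \<or> q2 = [] \<and> ?z = v" by (cases q2) auto
    ultimately show False using eq assms(1-3) by (auto simp: q)
  qed
  moreover have "x \<noteq> ?y" using y assms(1) by (auto simp: q)
  moreover have "x \<noteq> ?z" using z assms(2) by (auto simp: q)
  moreover have "?y \<in> set (u # q)" "?z \<in> set (q @ [v])" using y z by (auto simp: q)
  ultimately show thesis using that 1 2 by blast
qed

lemma chain_normal_edge:
  assumes G: "bigraph G" and c: "chain G u q v" and x: "x \<in> set q" and f: "f \<in> edges G" "x \<in> f"
  shows "f \<in> walk_edges (u # q @ [v])"
proof -
  have c': "distinct (u # q)" "distinct (q @ [v])" "u = v \<longrightarrow> length q \<ge> 2"
    "walk_edges (u # q @ [v]) \<subseteq> edges G" "normal G x"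
    using c x by (auto simp: chain_def)
  obtain y z where yz: "{y, x} \<in> walk_edges (u # q @ [v])" "{x, z} \<in> walk_edges (u # q @ [v])"
    "y \<noteq> z" "x \<noteq> y" "x \<noteq> z"
    using chain_neighbours[OF c'(1-3) x] by metis
  have eq: "{g \<in> edges G. x \<in> g} = {{y, x}, {x, z}}"
    by (rule normal_edges_eq[OF G c'(5)]) (use yz c' in \<open>auto simp: doubleton_eq_iff\<close>)
  have "f \<in> {g \<in> edges G. x \<in> g}" using f by simp
  hence "f \<in> {{y, x}, {x, z}}" by (simp only: eq)
  thus ?thesis using yz(1,2) by blast
qed

lemma walk_edges_linked:
  assumes "walk_edges (a # b # w) \<subseteq> edges G" "\<forall>x\<in>set (butlast (b # w)). normal G x"
    "f \<in> walk_edges (a # b # w)"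
  shows "({a, b}, f) \<in> (link G)\<^sup>*"
  using assms
proof (induction w arbitrary: a b)
  case (Cons c w)
  show ?case
  proof (cases "f = {a, b}")
    case False
    hence "({b, c}, f) \<in> (link G)\<^sup>*" using Cons by (intro Cons.IH) auto
    moreover have "({a, b}, {b, c}) \<in> link G" using Cons.prems by (auto simp: link_def)
    ultimately show ?thesis by (rule converse_rtrancl_into_rtrancl[rotated])
  qed auto
qed auto

text \<open>Consecutive edges of a chain share a normal point, so all of them are linked. No link
  leaves the chain: its end points are special, and a normal interior point already has both its
  edges on it.\<close>

lemma chain_thread:
  assumes G: "bigraph G" and c: "chain G u q v" and e: "e \<in> walk_edges (u # q @ [v])"
  shows "thread G e = walk_edges (u # q @ [v])"
proof -
  let ?P = "walk_edges (u # q @ [v])"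
  let ?f = "{u, hd (q @ [v])}"
  have f: "?f \<in> ?P" by (cases q) auto
  have sub: "?P \<subseteq> edges G" using c by (simp add: chain_def)
  have qb: "q @ [v] = hd (q @ [v]) # tl (q @ [v])" by simp
  have bl: "butlast (hd (q @ [v]) # tl (q @ [v])) = q" by (metis butlast_snoc qb)
  have 1: "?P \<subseteq> thread G ?f"
  proof
    fix g assume "g \<in> ?P"
    thus "g \<in> thread G ?f"
      unfolding thread_def using walk_edges_linked[of u "hd (q @ [v])" "tl (q @ [v])" G g] sub c bl qb
      by (auto simp: chain_def simp del: butlast.simps)
  qed
  have 2: "thread G ?f \<subseteq> ?P"
  proof
    fix g assume "g \<in> thread G ?f"
    hence "(?f, g) \<in> (link G)\<^sup>*" by (simp add: thread_def)
    thus "g \<in> ?P"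
    proof induction
      case (step g h)
      then obtain x where x: "normal G x" "x \<in> g" "x \<in> h" "h \<in> edges G" by (auto simp: link_def)
      have "x \<in> set (u # q @ [v])" using walk_edges_subset[OF step.IH] x by auto
      hence "x \<in> set q" using x(1) c by (auto simp: chain_def dest: normal_not_special)
      thus ?case using chain_normal_edge[OF G c] x by blast
    qed (rule f)
  qed
  from 1 2 have "thread G ?f = ?P" by blast
  thus ?thesis using e thread_eq by metis
qed

lemma chain_ends:
  assumes "chain G u q v"
  shows "ends G (walk_edges (u # q @ [v])) = {u, v}"
  using assms Union_walk_edges[of "u # q @ [v]"]
  by (auto simp: ends_def chain_def dest: normal_not_special)

text \<open>\<open>W\<close> would contain the whole component of \<open>x\<close>, whereas a core
  is connected and has a special point.\<close>

lemma no_special_component: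
  assumes G: "core G" and W: "x \<in> W" "x \<in> verts G" and nW: "\<forall>y\<in>W. \<not> special G y"
    and cl: "\<And>y f. y \<in> W \<Longrightarrow> f \<in> edges G \<Longrightarrow> y \<in> f \<Longrightarrow> f \<subseteq> W"
  shows False
proof -
  obtain s where s: "special G s" using G by (auto simp: core_def)
  hence "s \<in> verts G" by (simp add: special_def)
  hence "(\<lambda>a b. {a, b} \<in> edges G)\<^sup>*\<^sup>* x s"
    using coreD(2)[OF G] W by (auto simp: connected_bigraph_def)
  hence "s \<in> W" by induction (use W cl in auto)
  thus False using nW s by blast
qed

text \<open>A normal \<open>v\<close> has a second edge. It cannot lead to a new point, by
  maximality, nor to an interior point, whose two edges already lie on the path. So it returns to
  \<open>u\<close> and closes a cycle; if \<open>u\<close> were not special, this cycle would be a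
  whole component without special points.\<close>

lemma maximal_path_end:
  assumes G: "core G"
    and d: "distinct (u # q @ [v])" and w: "walk_edges (u # q @ [v]) \<subseteq> edges G"
    and n: "\<forall>x\<in>set q. normal G x"
    and mx: "\<And>z. z \<notin> set (u # q @ [v]) \<Longrightarrow> normal G v \<Longrightarrow> {v, z} \<notin> edges G"
    and v: "\<not> special G v"
  shows "chain G u (q @ [v]) u"
proof -
  note bg = coreD(1)[OF G]
  let ?p = "last (u # q)"
  have pv: "{?p, v} \<in> walk_edges (u # q @ [v])" using walk_edges_snoc[of "u # q" v] by simp
  hence pvE: "{?p, v} \<in> edges G" using w by blast
  have vV: "v \<in> verts G" using edge_subset_verts[OF bg pvE] by auto
  have nv: "normal G v" using core_cases[OF G vV] v by blast
  have ps: "?p \<in> set (u # q)" by (rule last_in_set) simp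
  hence pnv: "?p \<noteq> v" using d by auto
  have c2: "card {e \<in> edges G. v \<in> e} = 2" using nv by (simp add: normal_def deg_def)
  have "{e \<in> edges G. v \<in> e} \<noteq> {{?p, v}}"
  proof
    assume "{e \<in> edges G. v \<in> e} = {{?p, v}}"
    hence "card {e \<in> edges G. v \<in> e} = card {{?p, v}}" by (rule arg_cong)
    thus False by (simp only: c2) simp
  qed
  moreover have "{?p, v} \<in> {e \<in> edges G. v \<in> e}" using pvE by blast
  ultimately obtain g where g: "g \<in> edges G" "v \<in> g" "g \<noteq> {?p, v}" by blast
  obtain a b where "g = {a, b}" "a \<noteq> b" using edgeE[OF bg g(1)] by blast
  then obtain z where z: "g = {v, z}" "z \<noteq> v" using g(2) by blast
  have zp: "z \<noteq> ?p" using g z by (auto simp: insert_commute)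
  have zq: "z \<notin> set q"
  proof
    assume zq: "z \<in> set q"
    obtain y y' where y: "{y, z} \<in> walk_edges (u # q @ [v])" "{z, y'} \<in> walk_edges (u # q @ [v])"
       "y \<noteq> y'" "z \<noteq> y" "z \<noteq> y'" "y \<in> set (u # q)" "y' \<in> set (q @ [v])"
      using chain_neighbours[of u q v z] zq d by auto
    have eq: "{h \<in> edges G. z \<in> h} = {{y, z}, {z, y'}}"
      by (rule normal_edges_eq[OF bg]) (use n zq y w in \<open>auto simp: doubleton_eq_iff\<close>)
    have "{v, z} \<in> {h \<in> edges G. z \<in> h}" using g(1) z(1) by simp
    hence mem: "{v, z} \<in> {{y, z}, {z, y'}}" by (simp only: eq)
    have "v \<noteq> y" using y(6) d by auto
    hence "{v, z} = {z, y'}" using mem y(4) by (auto simp: doubleton_eq_iff)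
    hence "{v, z} \<in> walk_edges (u # q @ [v])" using y(2) by simp
    moreover have "walk_edges (u # q @ [v]) = insert {?p, v} (walk_edges (u # q))"
      using walk_edges_snoc[of "u # q" v] by simp
    moreover have "{v, z} \<notin> walk_edges (u # q)"
      using walk_edges_subset[of "{v,z}" "u # q"] d by auto
    ultimately show False using zp pnv by (auto simp: doubleton_eq_iff)
  qed
  have zu: "z = u" using mx[of z] nv g z zq by auto
  hence qne: "q \<noteq> []" using zp by auto
  have uvE: "{v, u} \<in> edges G" using g z zu by simp
  have wc: "walk_edges (u # (q @ [v]) @ [u]) \<subseteq> edges G"
    using w uvE walk_edges_snoc[of "u # q @ [v]" u] by simp
  have uV: "u \<in> verts G" using edge_subset_verts[OF bg uvE] by auto
  have len: "length (q @ [v]) \<ge> 2" using qne by (cases q) auto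
  have cyc_d: "distinct (u # q @ [v])" "distinct ((q @ [v]) @ [u])" "u = u \<longrightarrow> 2 \<le> length (q @ [v])"
    using d len by auto
  have cyc: "f \<subseteq> set (u # q @ [v])" if y: "y \<in> set (q @ [v])" and f: "f \<in> edges G" "y \<in> f" for y f
  proof -
    obtain a b where ab: "{a, y} \<in> walk_edges (u # (q @ [v]) @ [u])"
       "{y, b} \<in> walk_edges (u # (q @ [v]) @ [u])" "a \<noteq> b" "y \<noteq> a" "y \<noteq> b"
      using chain_neighbours[OF cyc_d y] by metis
    have ny: "normal G y" using n nv y by auto
    have eq: "{h \<in> edges G. y \<in> h} = {{a, y}, {y, b}}"
      by (rule normal_edges_eq[OF bg ny]) (use ab wc in \<open>auto simp: doubleton_eq_iff\<close>)
    have "f \<in> {h \<in> edges G. y \<in> h}" using f by simp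
    hence "f \<in> {{a, y}, {y, b}}" by (simp only: eq)
    hence "f \<in> walk_edges (u # (q @ [v]) @ [u])" using ab(1,2) by blast
    hence "f \<subseteq> set (u # (q @ [v]) @ [u])" by (rule walk_edges_subset)
    thus ?thesis by auto
  qed
  have "special G u"
  proof (rule ccontr)
    assume nu: "\<not> special G u"
    have "normal G u" using core_cases[OF G uV] nu by blast
    have hq: "hd q \<in> set q" using qne by simp
    have "{u, hd q} \<in> walk_edges (u # q @ [v])" using qne by (cases q) auto
    moreover have "v \<noteq> hd q" using hq d by auto
    ultimately have eq: "{h \<in> edges G. u \<in> h} = {{u, hd q}, {v, u}}"
      using uvE w \<open>normal G u\<close> by (intro normal_edges_eq[OF bg]) (auto simp: doubleton_eq_iff)
    have cu: "f \<subseteq> set (u # q @ [v])" if "f \<in> edges G" "u \<in> f" for f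
    proof -
      have "f \<in> {h \<in> edges G. u \<in> h}" using that by simp
      hence "f \<in> {{u, hd q}, {v, u}}" by (simp only: eq)
      thus ?thesis using hq by auto
    qed
    show False
    proof (rule no_special_component[OF G, of u "set (u # q @ [v])"])
      show "\<forall>y\<in>set (u # q @ [v]). \<not> special G y" using n nv nu by (auto dest: normal_not_special)
      show "f \<subseteq> set (u # q @ [v])" if "y \<in> set (u # q @ [v])" "f \<in> edges G" "y \<in> f" for y f
        using that cyc cu by (cases "y = u") auto
    qed (use uV in auto)
  qed
  thus ?thesis using d n nv wc len by (auto simp: chain_def)
qed

text \<open>Take a longest path through \<open>e\<close> with normal interior points. Either both
  its ends are special, or an end that is not special closes the path to a special cycle; the end
  \<open>u\<close> is treated by reversal.\<close>

lemma edge_in_chain: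
  assumes G: "core G" and e: "e \<in> edges G"
  obtains u q v where "chain G u q v" "e \<in> walk_edges (u # q @ [v])"
proof -
  note bg = coreD(1)[OF G]
  let ?P = "\<lambda>(u, q, v). distinct (u # q @ [v]) \<and> walk_edges (u # q @ [v]) \<subseteq> edges G \<and>
    (\<forall>x\<in>set q. normal G x) \<and> e \<in> walk_edges (u # q @ [v])"
  obtain a b where ab: "e = {a, b}" "a \<noteq> b" using edgeE[OF bg e] by metis
  have P0: "?P (a, [], b)" using ab e by auto
  have bound: "length (fst (snd t)) < card (verts G) + 1" if "?P t" for t
  proof -
    obtain u q v where t: "t = (u, q, v)" by (cases t)
    have "set q \<subseteq> verts G" using that by (auto simp: t normal_def)
    hence "length q \<le> card (verts G)" using that card_mono[of "verts G" "set q"] bigraphD[OF bg] t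
      by (auto simp: distinct_card)
    thus ?thesis by (simp add: t)
  qed
  obtain t where t: "?P t" and tmax: "\<And>t'. ?P t' \<Longrightarrow> length (fst (snd t')) \<le> length (fst (snd t))"
    using ex_has_greatest_nat[of ?P "(a, [], b)" "\<lambda>t. length (fst (snd t))" "card (verts G) + 1"] P0 bound by blast
  obtain u q v where tt: "t = (u, q, v)" by (cases t)
  have Pt: "distinct (u # q @ [v])" "walk_edges (u # q @ [v]) \<subseteq> edges G" "\<forall>x\<in>set q. normal G x"
    "e \<in> walk_edges (u # q @ [v])" using t tt by auto
  show thesis
  proof (cases "special G u \<and> special G v")
    case True
    hence "chain G u q v" using Pt by (auto simp: chain_def)
    thus thesis using that Pt by blast
  next
    case False
    have ext: False if "distinct (x # p @ [y])" "walk_edges (x # p @ [y]) \<subseteq> edges G"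
      "\<forall>a\<in>set p. normal G a" "e \<in> walk_edges (x # p @ [y])" "length p = length q"
      "normal G y" "z \<notin> set (x # p @ [y])" "{y, z} \<in> edges G" for x p y z
    proof -
      have "?P (x, p @ [y], z)" using that walk_edges_snoc[of "x # p @ [y]" z] by auto
      from tmax[OF this] show False using that(5) by (simp add: tt)
    qed
    show thesis
    proof (cases "special G v")
      case False
      have "chain G u (q @ [v]) u"
        using maximal_path_end[OF G Pt(1-3) _ False] ext[of u q v] Pt by blast
      moreover have "e \<in> walk_edges (u # (q @ [v]) @ [u])"
        using Pt(4) walk_edges_snoc[of "u # q @ [v]" u] by simp
      ultimately show thesis using that by blast
    next
      case True
      hence nu: "\<not> special G u" using False by blast
      have R: "walk_edges (v # rev q @ [u]) = walk_edges (u # q @ [v])"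
        using walk_edges_rev[of "u # q @ [v]"] by simp
      have Pr: "distinct (v # rev q @ [u])" "walk_edges (v # rev q @ [u]) \<subseteq> edges G"
        "\<forall>x\<in>set (rev q). normal G x" "e \<in> walk_edges (v # rev q @ [u])"
        using Pt R by auto
      have "chain G v (rev q @ [u]) v"
        using maximal_path_end[OF G Pr(1-3) _ nu] ext[of v "rev q" u] Pr by auto
      moreover have "e \<in> walk_edges (v # (rev q @ [u]) @ [v])"
        using Pr(4) walk_edges_snoc[of "v # rev q @ [u]" v] by simp
      ultimately show thesis using that by blast
    qed
  qed
qed

lemma threads_chain:
  assumes "core G"
  shows "P \<in> threads G \<longleftrightarrow> (\<exists>u q v. chain G u q v \<and> P = walk_edges (u # q @ [v]))"
proof
  assume "P \<in> threads G"
  then obtain e where e: "e \<in> edges G" "P = thread G e" by (auto simp: threads_def)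
  show "\<exists>u q v. chain G u q v \<and> P = walk_edges (u # q @ [v])"
    using edge_in_chain[OF assms e(1)] chain_thread[OF coreD(1)[OF assms]] e(2) by metis
next
  assume "\<exists>u q v. chain G u q v \<and> P = walk_edges (u # q @ [v])"
  then obtain u q v where c: "chain G u q v" "P = walk_edges (u # q @ [v])" by blast
  have f: "{u, hd (q @ [v])} \<in> P" by (cases q) (auto simp: c)
  thus "P \<in> threads G"
    using chain_thread[OF coreD(1)[OF assms] c(1)] thread_in_threads c by (metis chain_def subsetD)
qed

text \<open>Translates the definition into threads, where the special paths between two points are
  just the threads with a given end set. In the converse the chain may have to be reversed, as an
  end set carries no order.\<close>

lemma special_path_thread:
  assumes "core G"
  shows "special_path G u v P \<longleftrightarrow> u \<noteq> v \<and> P \<in> threads G \<and> ends G P = {u, v}"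
proof
  assume "special_path G u v P"
  then obtain q where "chain G u q v" "P = walk_edges (u # q @ [v])" "u \<noteq> v"
    by (auto simp: special_path_def chain_def)
  thus "u \<noteq> v \<and> P \<in> threads G \<and> ends G P = {u, v}"
    using threads_chain[OF assms] chain_ends by metis
next
  assume A: "u \<noteq> v \<and> P \<in> threads G \<and> ends G P = {u, v}"
  then obtain u' q v' where c: "chain G u' q v'" "P = walk_edges (u' # q @ [v'])"
    using threads_chain[OF assms] by metis
  hence "{u', v'} = {u, v}" using A chain_ends by metis
  hence "u = u' \<and> v = v' \<or> u = v' \<and> v = u'" using A by (auto simp: doubleton_eq_iff)
  then obtain q' where "chain G u q' v" "P = walk_edges (u # q' @ [v])"
    using c chain_rev[OF c(1)] walk_edges_rev[of "u' # q @ [v']"] by auto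
  thus "special_path G u v P" using A by (auto simp: special_path_def chain_def intro!: exI[of _ q'])
qed

lemma special_cycle_thread:
  assumes "core G"
  shows "special_cycle G v P \<longleftrightarrow> P \<in> threads G \<and> ends G P = {v}"
proof
  assume "special_cycle G v P"
  then obtain q where "chain G v q v" "P = walk_edges (v # q @ [v])"
    by (auto simp: special_cycle_def chain_def)
  thus "P \<in> threads G \<and> ends G P = {v}"
    using threads_chain[OF assms] chain_ends by (metis insert_absorb2)
next
  assume A: "P \<in> threads G \<and> ends G P = {v}"
  then obtain u' q v' where c: "chain G u' q v'" "P = walk_edges (u' # q @ [v'])"
    using threads_chain[OF assms] by metis
  hence "{u', v'} = {v}" using A chain_ends by metis
  hence "u' = v" "v' = v" by auto
  thus "special_cycle G v P" using c by (auto simp: special_cycle_def chain_def)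
qed

text \<open>The walk \<open>u # q\<close> has distinct vertices, and the last edge is new because it
  contains \<open>v\<close>. Only for \<open>u = v\<close> could it agree with the edge leaving
  \<open>u\<close>, and there at least two interior points separate the two.\<close>

lemma card_chain:
  assumes "chain G u q v"
  shows "card (walk_edges (u # q @ [v])) = length q + 1"
proof (cases "q = []")
  case False
  have c: "distinct (u # q)" "distinct (q @ [v])" "u = v \<longrightarrow> length q \<ge> 2"
    using assms by (auto simp: chain_def)
  have e: "walk_edges (u # q @ [v]) = insert {last q, v} (walk_edges (u # q))"
    using walk_edges_snoc[of "u # q" v] False by simp
  have uq: "walk_edges (u # q) = insert {u, hd q} (walk_edges q)"
    using False by (simp add: walk_edges_Cons)
  have vq: "v \<notin> set q" and lq: "last q \<in> set q" using c False by auto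
  have "{last q, v} \<notin> walk_edges (u # q)"
  proof
    assume "{last q, v} \<in> walk_edges (u # q)"
    moreover have "{last q, v} \<notin> walk_edges q" using walk_edges_subset[of "{last q, v}" q] vq by auto
    ultimately have "{last q, v} = {u, hd q}" using uq by auto
    hence uv: "u = v" "last q = hd q" using vq lq c False by (auto simp: doubleton_eq_iff)
    hence "length q \<ge> 2" using c by simp
    then obtain a b r where "q = a # b # r" by (cases q rule: walk_edges.cases) auto
    thus False using uv c(1) by (auto split: if_splits)
  qed
  thus ?thesis using card_walk_edges[OF c(1)] by (simp add: e finite_walk_edges)
qed simp

lemma chain_normal_points:
  assumes "chain G u q v"
  shows "{x \<in> \<Union>(walk_edges (u # q @ [v])). normal G x} = set q"
  using assms Union_walk_edges[of "u # q @ [v]"]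
  by (auto simp: chain_def dest: normal_not_special)

lemma chain_normal_edges:
  assumes "chain G u q v"
  shows "{e \<in> walk_edges (u # q @ [v]). \<forall>x\<in>e. normal G x} = walk_edges q"
proof -
  have uv: "\<not> normal G u" "\<not> normal G v" using assms by (auto simp: chain_def dest: normal_not_special)
  have q: "\<forall>x\<in>set q. normal G x" using assms by (simp add: chain_def)
  have *: "(\<forall>x\<in>e. normal G x)" if "e \<in> walk_edges q" for e
    using walk_edges_subset[OF that] q by blast
  show ?thesis
  proof (cases "q = []")
    case False
    have "walk_edges (u # q @ [v]) = insert {u, hd q} (insert {last q, v} (walk_edges q))"
      using walk_edges_Cons[of "q @ [v]" u] walk_edges_snoc[of q v] False by auto
    thus ?thesis using uv * by auto
  qed (use uv in auto)
qed

lemma chain_parity: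
  assumes "bigraph G" "chain G u q v"
  shows "even (card (walk_edges (u # q @ [v]))) \<longleftrightarrow> (u \<in> lverts G \<longleftrightarrow> v \<in> lverts G)"
proof -
  have "(u # q @ [v]) ! (length q + 1) \<in> lverts G \<longleftrightarrow> (even (length q + 1) \<longleftrightarrow> hd (u # q @ [v]) \<in> lverts G)"
    using assms by (intro walk_side(1)) (auto simp: chain_def)
  thus ?thesis using card_chain[OF assms(2)] by (auto simp: nth_append)
qed

lemma special_side: "special G u \<Longrightarrow> bigraph G \<Longrightarrow> u \<in> rverts G \<longleftrightarrow> u \<notin> lverts G"
  using bigraphD(3)[of G] by (auto simp: special_def verts_def)

lemma threadE:
  assumes "core G" "P \<in> threads G"
  obtains u q v where "chain G u q v" "P = walk_edges (u # q @ [v])" "card P = length q + 1"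
    "ends G P = {u, v}" "{x \<in> \<Union>P. normal G x} = set q" "{e \<in> P. \<forall>x\<in>e. normal G x} = walk_edges q"
    "even (card P) \<longleftrightarrow> (u \<in> lverts G \<longleftrightarrow> v \<in> lverts G)"
proof -
  obtain u q v where c: "chain G u q v" "P = walk_edges (u # q @ [v])"
    using assms threads_chain by metis
  show thesis
    by (rule that[OF c]) (simp_all only: c(2) card_chain[OF c(1)] chain_ends[OF c(1)]
        chain_normal_points[OF c(1)] chain_normal_edges[OF c(1)]
        chain_parity[OF coreD(1)[OF assms(1)] c(1), unfolded card_chain[OF c(1)]])
qed

lemma thread_card_pos: "core G \<Longrightarrow> P \<in> threads G \<Longrightarrow> card P \<ge> 1"
  by (erule (1) threadE) simp

lemma card_thread_normal_points:
  assumes "core G" "P \<in> threads G"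
  shows "card {x \<in> \<Union>P. normal G x} = card P - 1"
proof -
  obtain u q v where c: "chain G u q v" "card P = length q + 1" "{x \<in> \<Union>P. normal G x} = set q"
    by (rule threadE[OF assms], rule that)
  moreover have "distinct q" using c by (simp add: chain_def)
  ultimately show ?thesis by (simp add: distinct_card)
qed

text \<open>Only the two extreme edges of a thread touch its ends; truncated subtraction gives the
  right value 0 for a thread of length 1. The edges counted are the candidates for
  contraction.\<close>

lemma card_thread_normal_edges:
  assumes "core G" "P \<in> threads G"
  shows "card {e \<in> P. \<forall>x\<in>e. normal G x} = card P - 2"
proof -
  obtain u q v where c: "chain G u q v" "card P = length q + 1" "{e \<in> P. \<forall>x\<in>e. normal G x} = walk_edges q"
    by (rule threadE[OF assms], rule that)
  moreover have "distinct q" using c by (simp add: chain_def)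
  ultimately show ?thesis by (simp add: card_walk_edges)
qed

lemma ends_subset_special: "x \<in> ends G P \<Longrightarrow> special G x"
  by (simp add: ends_def)

lemma card_ends:
  assumes "core G" "P \<in> threads G"
  shows "card (ends G P) = 1 \<or> card (ends G P) = 2"
proof -
  obtain u v where "ends G P = {u, v}" by (rule threadE[OF assms], rule that)
  thus ?thesis by (cases "u = v") auto
qed

lemma core_edge_at:
  assumes "core G" "x \<in> verts G"
  obtains e where "e \<in> edges G" "x \<in> e"
proof -
  have "deg G x \<noteq> 0" using coreD(3)[OF assms] by simp
  hence "card {e \<in> edges G. x \<in> e} > 0" by (simp add: deg_def)
  then obtain e where "e \<in> {e \<in> edges G. x \<in> e}" by (metis card_gt_0_iff all_not_in_conv)
  thus thesis using that by blast
qed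

lemma card_edges_threads:
  assumes "core G"
  shows "card (edges G) = (\<Sum>P\<in>threads G. card P)"
proof -
  have "card (\<Union>(threads G)) = (\<Sum>P\<in>threads G. card P)"
    using finite_thread[OF coreD(1)[OF assms]]
    by (intro card_Union_disjoint) (auto simp: disjnt_def pairwise_def dest: threads_disjoint)
  thus ?thesis by (simp add: Union_threads)
qed

lemma normal_points_disjoint:
  assumes "P \<in> threads G" "Q \<in> threads G" "x \<in> \<Union>P" "x \<in> \<Union>Q" "normal G x"
  shows "P = Q"
proof -
  obtain e f where ef: "e \<in> P" "x \<in> e" "f \<in> Q" "x \<in> f" using assms by blast
  have "e \<in> edges G" "f \<in> edges G" using ef assms threads_edge by blast+
  hence "(e, f) \<in> link G" using ef assms by (auto simp: link_def)
  hence "f \<in> thread G e" by (auto simp: thread_def)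
  hence "thread G f = thread G e" by (rule thread_eq)
  thus ?thesis using threads_edge ef assms by metis
qed

lemma card_verts_threads:
  assumes "core G"
  shows "card (verts G) = N_sp G + (\<Sum>P\<in>threads G. card P - 1)"
proof -
  note bg = coreD(1)[OF assms]
  let ?n = "\<lambda>P. {x \<in> \<Union>P. normal G x}"
  have fin: "finite (?n P)" if "P \<in> threads G" for P
    using threadE[OF assms that] by (metis List.finite_set)
  have "verts G = {v. special G v} \<union> (\<Union>P\<in>threads G. ?n P)"
  proof (intro equalityI subsetI)
    fix x assume x: "x \<in> verts G"
    obtain e where e: "e \<in> edges G" "x \<in> e" using core_edge_at[OF assms x] .
    hence "e \<in> thread G e" "thread G e \<in> threads G" using thread_refl thread_in_threads by auto
    thus "x \<in> {v. special G v} \<union> (\<Union>P\<in>threads G. ?n P)"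
      using core_cases[OF assms x] e by blast
  qed (auto simp: special_def normal_def)
  moreover have "{v. special G v} \<inter> (\<Union>P\<in>threads G. ?n P) = {}"
    by (auto dest: normal_not_special)
  moreover have "finite {v. special G v}"
    using bigraphD(4)[OF bg] by (rule rev_finite_subset) (auto simp: special_def)
  ultimately have "card (verts G) = N_sp G + card (\<Union>P\<in>threads G. ?n P)"
    using finite_threads[OF bg] fin by (simp add: card_Un_disjoint N_sp_def)
  also have "card (\<Union>P\<in>threads G. ?n P) = (\<Sum>P\<in>threads G. card (?n P))"
  proof (rule card_UN_disjoint)
    show "\<forall>P\<in>threads G. \<forall>Q\<in>threads G. P \<noteq> Q \<longrightarrow> ?n P \<inter> ?n Q = {}"
    proof (intro ballI impI)
      fix P Q assume "P \<in> threads G" "Q \<in> threads G" "P \<noteq> Q"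
      thus "?n P \<inter> ?n Q = {}" using normal_points_disjoint[of P G Q] by blast
    qed
  qed (use finite_threads[OF bg] fin in auto)
  also have "\<dots> = (\<Sum>P\<in>threads G. card P - 1)"
    using card_thread_normal_points[OF assms] by (intro sum.cong) auto
  finally show ?thesis .
qed

text \<open>A thread has one edge more than it has normal points, so edges minus vertices equals
  threads minus special points.\<close>

lemma card_threads_betti:
  assumes "core G"
  shows "int (card (threads G)) = int (N_sp G) + betti G - 1"
proof -
  have "(\<Sum>P\<in>threads G. card P) = (\<Sum>P\<in>threads G. (card P - 1) + 1)"
    by (intro sum.cong) (auto simp: Suc_le_lessD dest: thread_card_pos[OF assms])
  hence "(\<Sum>P\<in>threads G. card P) = (\<Sum>P\<in>threads G. card P - 1) + card (threads G)"
    by (simp only: sum.distrib) simp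
  thus ?thesis using card_edges_threads[OF assms] card_verts_threads[OF assms]
    by (simp add: betti_def)
qed

section \<open>Length of the minimal form, excess, and minimal walks in terms of threads\<close>

section \<open>Minimal lengths\<close>

definition parallels :: "'v bigraph \<Rightarrow> 'v set set \<Rightarrow> 'v set set set" where
  "parallels G P = {Q \<in> threads G. ends G Q = ends G P}"

text \<open>\<open>base\<close> is the length of the minimal form, and the excess of a thread is the number of
  pairs of normal points that were removed to reach it. \<open>dthread\<close> marks the delta edges.\<close>

definition base :: "'v bigraph \<Rightarrow> 'v set set \<Rightarrow> nat" where
  "base G P = (if card (ends G P) = 1 then 4 else if even (card P) then 2
     else if card (parallels G P) = 1 \<or> card P = 1 then 1 else 3)"

definition dthread :: "'v bigraph \<Rightarrow> 'v set set \<Rightarrow> bool" where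
  "dthread G P \<longleftrightarrow> card (ends G P) = 2 \<and> card P = 1 \<and> card (parallels G P) > 1"

definition excess :: "'v bigraph \<Rightarrow> 'v set set \<Rightarrow> nat" where
  "excess G P = (card P - base G P) div 2"

definition total_excess :: "'v bigraph \<Rightarrow> nat" where
  "total_excess G = (\<Sum>P\<in>threads G. excess G P)"

text \<open>The threads that a subdivision may lengthen without changing the basic graph. Their
  number is the exponent in the denominator of \<open>J\<close>.\<close>

definition slots :: "'v bigraph \<Rightarrow> 'v set set set" where
  "slots G = {P \<in> threads G. \<not> dthread G P}"

lemma card_parallels:
  assumes "bigraph G" "P \<in> threads G"
  shows "card (parallels G P) \<noteq> 0" "finite (parallels G P)"
proof -
  show f: "finite (parallels G P)" using finite_threads[OF assms(1)] by (simp add: parallels_def)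
  have "P \<in> parallels G P" using assms by (simp add: parallels_def)
  thus "card (parallels G P) \<noteq> 0" using f by auto
qed

text \<open>\<open>base\<close> has the parity of the length and does not exceed it, so the halving
  in \<open>excess\<close> is exact. A closed thread is even by the bipartition and has at least two
  interior points, hence length at least 4.\<close>

lemma card_eq_base_excess:
  assumes G: "core G" and P: "P \<in> threads G"
  shows "card P = base G P + 2 * excess G P"
proof -
  obtain u q v where c: "chain G u q v" "card P = length q + 1" "ends G P = {u, v}"
    "even (card P) \<longleftrightarrow> (u \<in> lverts G \<longleftrightarrow> v \<in> lverts G)"
    by (rule threadE[OF assms], rule that)
  have "base G P \<le> card P \<and> even (card P - base G P)"
  proof (cases "u = v")
    case True
    hence "length q \<ge> 2" "even (card P)" using c by (auto simp: chain_def)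
    moreover have "base G P = 4" using True c by (simp add: base_def)
    ultimately show ?thesis using c(2) by presburger
  next
    case False
    have "card P \<ge> 1" using c by simp
    moreover have "base G P = (if even (card P) then 2
      else if card (parallels G P) = 1 \<or> card P = 1 then 1 else 3)"
      using False c by (simp add: base_def)
    ultimately show ?thesis by (auto split: if_splits) presburger+
  qed
  thus ?thesis unfolding excess_def by presburger
qed

lemma special_path_parallels:
  assumes "core G" "P \<in> threads G" "ends G P = {u, v}" "u \<noteq> v"
  shows "{Q. special_path G u v Q} = parallels G P"
  using special_path_thread[OF assms(1)] assms by (auto simp: parallels_def)

lemma odd_thread_ends:
  assumes G: "core G" and P: "P \<in> threads G" and o: "odd (card P)"
  obtains u v where "u \<in> lverts G" "v \<in> rverts G" "ends G P = {u, v}" "u \<noteq> v"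
proof -
  obtain u q v where c: "chain G u q v" "ends G P = {u, v}"
    "even (card P) \<longleftrightarrow> (u \<in> lverts G \<longleftrightarrow> v \<in> lverts G)"
    by (rule threadE[OF G P], rule that)
  have s: "special G u" "special G v" using c by (auto simp: chain_def)
  show thesis
  proof (cases "u \<in> lverts G")
    case True
    thus thesis using that[of u v] c o special_side[OF s(2) coreD(1)[OF G]] by auto
  next
    case False
    thus thesis using that[of v u] c o special_side[OF s(1) coreD(1)[OF G]] by (auto simp: insert_commute)
  qed
qed

lemma opposite_ends_odd:
  assumes G: "core G" and P: "P \<in> threads G" and e: "ends G P = {u, v}" "u \<in> lverts G" "v \<in> rverts G"
  shows "odd (card P)" "u \<noteq> v" "card (ends G P) = 2"
proof -
  have d: "lverts G \<inter> rverts G = {}" using bigraphD coreD(1)[OF G] by blast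
  show uv: "u \<noteq> v" using d e by blast
  obtain u' q v' where c: "ends G P = {u', v'}"
    "even (card P) \<longleftrightarrow> (u' \<in> lverts G \<longleftrightarrow> v' \<in> lverts G)"
    by (rule threadE[OF G P], rule that)
  have "{u', v'} = {u, v}" using c e by simp
  moreover have "v \<notin> lverts G" using d e by blast
  ultimately show "odd (card P)" using c(2) e by (auto simp: doubleton_eq_iff)
  show "card (ends G P) = 2" using uv e by simp
qed

lemma delta_edge_thread:
  assumes G: "core G"
  shows "(\<exists>u v. delta_edge G u v P) \<longleftrightarrow> P \<in> threads G \<and> dthread G P"
proof
  assume "\<exists>u v. delta_edge G u v P"
  then obtain u v where d: "delta_edge G u v P" by blast
  hence t: "P \<in> threads G" "ends G P = {u, v}" "u \<noteq> v"
    using special_path_thread[OF G] by (auto simp: delta_edge_def)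
  thus "P \<in> threads G \<and> dthread G P"
    using d special_path_parallels[OF G t] by (auto simp: delta_edge_def dthread_def)
next
  assume A: "P \<in> threads G \<and> dthread G P"
  then obtain u v where t: "u \<in> lverts G" "v \<in> rverts G" "ends G P = {u, v}" "u \<noteq> v"
    using odd_thread_ends[OF G, of P] by (auto simp: dthread_def)
  have "delta_edge G u v P"
    using A t special_path_thread[OF G] special_path_parallels[OF G, of P u v]
    by (auto simp: delta_edge_def dthread_def)
  thus "\<exists>u v. delta_edge G u v P" by blast
qed

lemma card_slots:
  assumes G: "core G"
  shows "int (card (slots G)) = int (N_sp G) + betti G - 1 - int (n_delta_edges G)"
proof -
  have "n_delta_edges G = card {P \<in> threads G. dthread G P}"
    by (simp add: n_delta_edges_def delta_edge_thread[OF G])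
  moreover have "card (threads G) = card (slots G) + card {P \<in> threads G. dthread G P}"
    using finite_threads[OF coreD(1)[OF G]] unfolding slots_def
    by (subst card_Un_disjoint[symmetric]) (auto intro: arg_cong[of _ _ card])
  ultimately show ?thesis using card_threads_betti[OF G] by simp
qed

text \<open>Describes minimal walks by end set, sides and \<open>base\<close> alone, which is all
  that a homeomorphism has to preserve. A \<gamma>-path and a \<delta>-edge have the same minimal
  walk and fall together in the case \<open>base G P = 1\<close>.\<close>

lemma minimal_walks_threads:
  assumes G: "core G"
  shows "w \<in> minimal_walks G \<longleftrightarrow> (\<exists>P\<in>threads G.
     (\<exists>v. ends G P = {v} \<and> w = [Sp v, Nm P 0, Nm P 1, Nm P 2, Sp v]) \<or>
     (\<exists>u v. u \<noteq> v \<and> ends G P = {u, v} \<and> base G P = 2 \<and> w = [Sp u, Nm P 0, Sp v]) \<or>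
     (\<exists>u\<in>lverts G. \<exists>v\<in>rverts G. ends G P = {u, v} \<and> base G P = 1 \<and> w = [Sp u, Sp v]) \<or>
     (\<exists>u\<in>lverts G. \<exists>v\<in>rverts G. ends G P = {u, v} \<and> base G P = 3 \<and>
        w = [Sp u, Nm P 0, Nm P 1, Sp v]))" (is "_ \<longleftrightarrow> (\<exists>P\<in>threads G. ?R P)")
proof
  note bg = coreD(1)[OF G]
  have opp: "base G P = (if card (parallels G P) = 1 \<or> card P = 1 then 1 else 3)"
    if "P \<in> threads G" "ends G P = {u, v}" "u \<in> lverts G" "v \<in> rverts G" for P u v
    using opposite_ends_odd[OF G that] by (simp add: base_def)
  have base_two: "(u \<in> lverts G \<and> v \<in> lverts G \<or> u \<in> rverts G \<and> v \<in> rverts G) \<longleftrightarrow> base G P = 2"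
    if P: "P \<in> threads G" and e: "ends G P = {u, v}" "u \<noteq> v" for P u v
  proof -
    have s: "special G u" "special G v" using e ends_subset_special[of _ G P] by auto
    obtain u' q v' where c: "ends G P = {u', v'}"
      "even (card P) \<longleftrightarrow> (u' \<in> lverts G \<longleftrightarrow> v' \<in> lverts G)"
      by (rule threadE[OF G P], rule that)
    have "{u', v'} = {u, v}" using c e by simp
    hence "even (card P) \<longleftrightarrow> (u \<in> lverts G \<longleftrightarrow> v \<in> lverts G)"
      using c(2) by (auto simp: doubleton_eq_iff)
    moreover have "card (ends G P) = 2" using e by simp
    ultimately show ?thesis using special_side[OF s(1) bg] special_side[OF s(2) bg]
      by (auto simp: base_def)
  qed
  {
    assume "w \<in> minimal_walks G"
    thus "\<exists>P\<in>threads G. ?R P"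
    proof cases
      case (alpha v P)
      thus ?thesis using special_cycle_thread[OF G] by blast
    next
      case (beta u v P)
      hence t: "P \<in> threads G" "ends G P = {u, v}" "u \<noteq> v"
        using special_path_thread[OF G] by (auto simp: beta_path_def)
      have "base G P = 2" using \<open>beta_path G u v P\<close> base_two[OF t]
        by (simp add: beta_path_def)
      thus ?thesis using t beta(1) by blast
    next
      case (gamma u v P)
      hence t: "P \<in> threads G" "ends G P = {u, v}" "u \<noteq> v" "u \<in> lverts G" "v \<in> rverts G"
        using special_path_thread[OF G] by (auto simp: gamma_path_def)
      have "card (parallels G P) = 1"
        using gamma special_path_parallels[OF G t(1-3)] by (simp add: gamma_path_def)
      hence "base G P = 1" using opp[OF t(1,2,4,5)] by simp
      thus ?thesis using t gamma(1) by blast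
    next
      case (delta u v P)
      hence t: "P \<in> threads G" "ends G P = {u, v}" "u \<noteq> v" "u \<in> lverts G" "v \<in> rverts G"
        using special_path_thread[OF G] by (auto simp: delta_path_def)
      have "card (parallels G P) > 1" "card P \<ge> 3"
        using delta special_path_parallels[OF G t(1-3)] by (auto simp: delta_path_def)
      hence "base G P = 3" using opp[OF t(1,2,4,5)] by simp
      thus ?thesis using t delta(1) by blast
    next
      case (delta_edge u v P)
      hence t: "P \<in> threads G" "ends G P = {u, v}" "u \<noteq> v" "u \<in> lverts G" "v \<in> rverts G"
        using special_path_thread[OF G] by (auto simp: delta_edge_def)
      have "card P = 1" using delta_edge by (auto simp: delta_edge_def)
      hence "base G P = 1" using opp[OF t(1,2,4,5)] by simp
      thus ?thesis using t delta_edge(1) by blast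
    qed
  next
    assume "\<exists>P\<in>threads G. ?R P"
    then obtain P where P: "P \<in> threads G" and R: "?R P" by blast
    from R consider
        v where "ends G P = {v}" "w = [Sp v, Nm P 0, Nm P 1, Nm P 2, Sp v]"
      | u v where "u \<noteq> v" "ends G P = {u, v}" "base G P = 2" "w = [Sp u, Nm P 0, Sp v]"
      | u v where "u \<in> lverts G" "v \<in> rverts G" "ends G P = {u, v}" "base G P = 1" "w = [Sp u, Sp v]"
      | u v where "u \<in> lverts G" "v \<in> rverts G" "ends G P = {u, v}" "base G P = 3"
          "w = [Sp u, Nm P 0, Nm P 1, Sp v]"
      by blast
    thus "w \<in> minimal_walks G"
    proof cases
      case (1 v)
      thus ?thesis using special_cycle_thread[OF G] P minimal_walks.alpha[of G v P] by simp
    next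
      case (2 u v)
      hence "beta_path G u v P" using base_two[OF P 2(2,1)] special_path_thread[OF G] P
        by (simp add: beta_path_def)
      thus ?thesis using 2 minimal_walks.beta by simp
    next
      case (3 u v)
      have uv: "u \<noteq> v" using opposite_ends_odd(2)[OF G P 3(3,1,2)] .
      have sp: "special_path G u v P" using special_path_thread[OF G] P 3 uv by blast
      show ?thesis
      proof (cases "card (parallels G P) = 1")
        case True
        hence "gamma_path G u v P" using 3 sp special_path_parallels[OF G P 3(3) uv]
          by (simp add: gamma_path_def)
        thus ?thesis using 3 minimal_walks.gamma by simp
      next
        \<comment> \<open>In the presence of parallel threads, \<open>base\<close> can be 1 only for
          a thread of length 1, which is a delta edge.\<close>
        case False
        have c1: "card P = 1"
        proof (rule ccontr)
          assume "card P \<noteq> 1"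
          hence "base G P = 3" by (simp only: opp[OF P 3(3,1,2)] False if_False simp_thms)
          thus False using 3(4) by simp
        qed
        have c2: "card (parallels G P) > 1" using False card_parallels(1)[OF bg P] by linarith
        have "delta_edge G u v P" unfolding delta_edge_def special_path_parallels[OF G P 3(3) uv]
          using 3(1,2) sp c1 c2 by blast
        thus ?thesis using 3 minimal_walks.delta_edge by simp
      qed
    next
      case (4 u v)
      note o = opposite_ends_odd[OF G P 4(3,1,2)]
      have sp: "special_path G u v P" using special_path_thread[OF G] P 4 o by blast
      have n: "card (parallels G P) \<noteq> 1" "card P \<noteq> 1"
        using opp[OF P 4(3,1,2)] 4(4) by presburger+
      have c1: "card (parallels G P) > 1" using n(1) card_parallels(1)[OF bg P] by linarith
      have c2: "card P \<ge> 3" using n(2) o(1) by presburger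
      have "delta_path G u v P" unfolding delta_path_def special_path_parallels[OF G P 4(3) o(2)]
        using 4(1,2) sp c1 c2 by blast
      thus ?thesis using 4 minimal_walks.delta by simp
    qed
  }
qed

section \<open>Transport of graph invariants along isomorphisms\<close>

section \<open>Isomorphisms\<close>

lemma bigraph_isoI:
  assumes "inj_on f (verts G)" "lverts H = f ` lverts G" "rverts H = f ` rverts G"
    "edges H = (\<lambda>e. f ` e) ` edges G"
  shows "bigraph_iso f G H"
proof -
  have "inj_on f (lverts G)" "inj_on f (rverts G)"
    using assms(1) by (auto simp: verts_def intro: inj_on_subset)
  thus ?thesis using assms by (auto simp: bigraph_iso_def bij_betw_def verts_def image_Un)
qed

lemma bigraph_isoD:
  assumes "bigraph_iso f G H"
  shows "inj_on f (verts G)" "lverts H = f ` lverts G" "rverts H = f ` rverts G"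
    "verts H = f ` verts G" "edges H = (\<lambda>e. f ` e) ` edges G"
  using assms by (auto simp: bigraph_iso_def bij_betw_def)

text \<open>The hypothesis asks only that edges lie inside the vertex set, because this is what is
  established for minimal forms.\<close>

lemma bigraph_iso_inverse:
  assumes iso: "bigraph_iso f G H" and sub: "edges G \<subseteq> Pow (verts G)"
  shows "bigraph_iso (inv_into (verts G) f) H G"
proof -
  note I = bigraph_isoD[OF iso]
  let ?g = "inv_into (verts G) f"
  have cancel: "?g ` (f ` A) = A" if "A \<subseteq> verts G" for A
    using that by (simp add: inv_into_image_cancel I(1))
  show ?thesis
  proof (rule bigraph_isoI)
    show "inj_on ?g (verts H)" by (simp add: I(4) inj_on_inv_into)
    show "lverts G = ?g ` lverts H" "rverts G = ?g ` rverts H"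
      using cancel[of "lverts G"] cancel[of "rverts G"] I(2,3) by (auto simp: verts_def)
    have "(\<lambda>e. ?g ` e) ` edges H = (\<lambda>e. ?g ` (f ` e)) ` edges G" by (simp add: I(5) image_image)
    also have "\<dots> = (\<lambda>e. e) ` edges G" by (intro image_cong refl cancel) (use sub in auto)
    finally show "edges G = (\<lambda>e. ?g ` e) ` edges H" by simp
  qed
qed

lemma bigraph_iso_trans:
  assumes "bigraph_iso f G H" "bigraph_iso g H K"
  shows "bigraph_iso (g \<circ> f) G K"
proof (rule bigraph_isoI)
  note I = bigraph_isoD[OF assms(1)] and J = bigraph_isoD[OF assms(2)]
  show "inj_on (g \<circ> f) (verts G)" using I(1,4) J(1) by (simp add: comp_inj_on)
  show "lverts K = (g \<circ> f) ` lverts G" "rverts K = (g \<circ> f) ` rverts G"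
    by (simp_all add: I J image_comp)
  show "edges K = (\<lambda>e. (g \<circ> f) ` e) ` edges G" by (simp only: I J image_image image_comp[symmetric])
qed

lemma bigraph_edges_Pow: "bigraph G \<Longrightarrow> edges G \<subseteq> Pow (verts G)"
  using edge_subset_verts by blast

lemma bigraph_iso_bigraph:
  assumes iso: "bigraph_iso f G H" and G: "bigraph G"
  shows "bigraph H"
proof -
  note I = bigraph_isoD[OF iso]
  have "f ` lverts G \<inter> f ` rverts G = f ` (lverts G \<inter> rverts G)"
    by (rule inj_on_image_Int[symmetric, OF I(1)]) (auto simp: verts_def)
  hence d: "lverts H \<inter> rverts H = {}" using bigraphD[OF G] by (simp add: I)
  have "e \<in> {{u, v} | u v. u \<in> lverts H \<and> v \<in> rverts H}" if "e \<in> edges H" for e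
  proof -
    from that[unfolded I(5)] obtain e' where e': "e = f ` e'" "e' \<in> edges G" by (rule imageE)
    obtain u v where uv: "u \<in> lverts G" "v \<in> rverts G" "e' = {u, v}"
      by (rule edgeE[OF G e'(2)], rule that)
    have "e = {f u, f v}" by (simp add: e'(1) uv(3))
    moreover have "f u \<in> lverts H" "f v \<in> rverts H" using uv(1,2) I(2,3) by simp_all
    ultimately show ?thesis by blast
  qed
  hence "edges H \<subseteq> {{u, v} | u v. u \<in> lverts H \<and> v \<in> rverts H}" by (rule subsetI)
  moreover have "finite (lverts H)" "finite (rverts H)" using bigraphD[OF G] by (simp_all add: I)
  ultimately show ?thesis using d unfolding bigraph_def by simp
qed

lemma iso_class_eq:
  assumes "bigraph_iso f G H" "edges G \<subseteq> Pow (verts G)"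
  shows "iso_class G = iso_class H"
proof -
  have "\<exists>g. bigraph_iso g H K" if "bigraph_iso g G K" for g and K :: "nat bigraph"
    using bigraph_iso_trans[OF bigraph_iso_inverse[OF assms] that] by blast
  moreover have "\<exists>g. bigraph_iso g G K" if "bigraph_iso g H K" for g and K :: "nat bigraph"
    using bigraph_iso_trans[OF assms(1) that] by blast
  ultimately show ?thesis unfolding iso_class_def by blast
qed

lemma bigraph_iso_edge_inj:
  assumes "bigraph_iso f G H" "bigraph G"
  shows "inj_on (\<lambda>e. f ` e) (edges G)"
  by (rule inj_on_subset[OF inj_on_image_Pow[OF bigraph_isoD(1)[OF assms(1)]]])
    (rule bigraph_edges_Pow[OF assms(2)])

lemma bigraph_iso_mem:
  assumes "bigraph_iso f G H" "bigraph G" "x \<in> verts G" "e \<in> edges G"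
  shows "f x \<in> f ` e \<longleftrightarrow> x \<in> e"
  by (rule inj_on_image_mem_iff[OF bigraph_isoD(1)[OF assms(1)] assms(3) edge_subset_verts[OF assms(2,4)]])

lemma bigraph_iso_deg:
  assumes "bigraph_iso f G H" "bigraph G" "x \<in> verts G"
  shows "deg H (f x) = deg G x"
proof -
  have "{e \<in> edges H. f x \<in> e} = (\<lambda>e. f ` e) ` {e \<in> edges G. x \<in> e}"
    using bigraph_iso_mem[OF assms] by (auto simp: bigraph_isoD(5)[OF assms(1)])
  moreover have "inj_on (\<lambda>e. f ` e) {e \<in> edges G. x \<in> e}"
    by (rule inj_on_subset[OF bigraph_iso_edge_inj[OF assms(1,2)]]) auto
  ultimately show ?thesis by (simp add: deg_def card_image)
qed

lemma bigraph_iso_special: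
  assumes "bigraph_iso f G H" "bigraph G" "x \<in> verts G"
  shows "special H (f x) \<longleftrightarrow> special G x" "normal H (f x) \<longleftrightarrow> normal G x"
  using bigraph_iso_deg[OF assms] bigraph_isoD(4)[OF assms(1)] assms(3)
  by (auto simp: special_def normal_def)

lemma bigraph_iso_special_set:
  assumes "bigraph_iso f G H" "bigraph G"
  shows "{v. special H v} = f ` {v. special G v}"
proof -
  have "{v. special H v} = {v \<in> f ` verts G. special H v}"
    using bigraph_isoD(4)[OF assms(1)] by (auto simp: special_def)
  also have "\<dots> = f ` {v \<in> verts G. special H (f v)}" by auto
  also have "{v \<in> verts G. special H (f v)} = {v. special G v}"
    using bigraph_iso_special(1)[OF assms] by (auto simp: special_def[of G])
  finally show ?thesis .
qed

lemma bigraph_iso_N_sp: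
  assumes "bigraph_iso f G H" "bigraph G"
  shows "N_sp H = N_sp G"
proof -
  have "inj_on f {v. special G v}"
    by (rule inj_on_subset[OF bigraph_isoD(1)[OF assms(1)]]) (auto simp: special_def)
  thus ?thesis by (simp add: N_sp_def bigraph_iso_special_set[OF assms] card_image)
qed

lemma bigraph_iso_cards:
  assumes "bigraph_iso f G H" "bigraph G"
  shows "card (lverts H) = card (lverts G)" "card (rverts H) = card (rverts G)"
    "card (verts H) = card (verts G)" "card (edges H) = card (edges G)" "betti H = betti G"
proof -
  note I = bigraph_isoD[OF assms(1)]
  show "card (lverts H) = card (lverts G)" "card (rverts H) = card (rverts G)"
    using assms(1) by (auto simp: bigraph_iso_def bij_betw_same_card)
  show 1: "card (verts H) = card (verts G)" by (simp add: I card_image)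
  show 2: "card (edges H) = card (edges G)"
    by (simp add: I card_image bigraph_iso_edge_inj[OF assms])
  show "betti H = betti G" by (simp add: betti_def 1 2)
qed

lemma bigraph_iso_connected:
  assumes "bigraph_iso f G H" "connected_bigraph G"
  shows "connected_bigraph H"
proof -
  note I = bigraph_isoD[OF assms(1)]
  have *: "(\<lambda>a b. {a, b} \<in> edges H)\<^sup>*\<^sup>* (f u) (f v)" if "(\<lambda>a b. {a, b} \<in> edges G)\<^sup>*\<^sup>* u v" for u v
    using that
  proof induction
    case (step v w)
    have "f ` {v, w} \<in> edges H" using step(2) I(5) by blast
    hence "{f v, f w} \<in> edges H" by simp
    with step.IH show ?case by (rule rtranclp.rtrancl_into_rtrancl)
  qed auto
  show ?thesis using assms(2) * by (auto simp: connected_bigraph_def I)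
qed

lemma bigraph_iso_core:
  assumes "bigraph_iso f G H" "core G"
  shows "core H"
proof -
  note bg = coreD(1)[OF assms(2)]
  note I = bigraph_isoD[OF assms(1)]
  have "deg H v \<ge> 2" if "v \<in> verts H" for v
    using that bigraph_iso_deg[OF assms(1) bg] coreD(3)[OF assms(2)] by (auto simp: I)
  moreover have "\<exists>v. special H v"
  proof -
    obtain v where "special G v" using assms(2) by (auto simp: core_def)
    hence "f v \<in> {v. special H v}" unfolding bigraph_iso_special_set[OF assms(1) bg] by simp
    thus ?thesis by blast
  qed
  ultimately show ?thesis
    using bigraph_iso_bigraph[OF assms(1) bg] bigraph_iso_connected[OF assms(1) coreD(2)[OF assms(2)]]
    by (simp add: core_def)
qed

section \<open>Maps that preserve the minimal form\<close>

section \<open>Homeomorphisms\<close>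

text \<open>Induces an isomorphism of the minimal forms. Both isomorphisms and subdivisions of edges
  that are not delta edges are instances.\<close>

definition homeo :: "('v \<Rightarrow> 'w) \<Rightarrow> ('v set set \<Rightarrow> 'w set set) \<Rightarrow> 'v bigraph \<Rightarrow> 'w bigraph \<Rightarrow> bool" where
  "homeo s t G H \<longleftrightarrow> inj_on s {v. special G v} \<and>
     (\<forall>v. special G v \<longrightarrow> special H (s v) \<and> (s v \<in> lverts H \<longleftrightarrow> v \<in> lverts G) \<and>
        (s v \<in> rverts H \<longleftrightarrow> v \<in> rverts G)) \<and>
     bij_betw t (threads G) (threads H) \<and>
     (\<forall>P\<in>threads G. ends H (t P) = s ` ends G P \<and> base H (t P) = base G P \<and>
        (dthread H (t P) \<longleftrightarrow> dthread G P))"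

lemma Collect_image_filter: "{y \<in> f ` A. R y} = f ` {x \<in> A. R (f x)}"
  by auto

lemma ends_special: "ends G P = {u, v} \<Longrightarrow> special G u" "ends G P = {u, v} \<Longrightarrow> special G v"
  using ends_subset_special[of u G P] ends_subset_special[of v G P] by simp_all

lemma card_parallels_transfer:
  assumes inj: "inj_on s {v. special G v}" and bij: "bij_betw t (threads G) (threads H)"
    and en: "\<And>P. P \<in> threads G \<Longrightarrow> ends H (t P) = s ` ends G P" and P: "P \<in> threads G"
  shows "card (parallels H (t P)) = card (parallels G P)"
proof -
  have es: "ends G P \<subseteq> {v. special G v}" for P by (auto simp: ends_def)
  have *: "ends H (t Q) = ends H (t P) \<longleftrightarrow> ends G Q = ends G P" if "Q \<in> threads G" for Q
    unfolding en[OF P] en[OF that] by (rule inj_on_image_eq_iff[OF inj es es])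
  have im: "threads H = t ` threads G" using bij by (simp add: bij_betw_def)
  have "parallels H (t P) = t ` {Q \<in> threads G. ends H (t Q) = ends H (t P)}"
    unfolding parallels_def im by (rule Collect_image_filter)
  also have "{Q \<in> threads G. ends H (t Q) = ends H (t P)} = parallels G P"
    unfolding parallels_def by (intro Collect_cong conj_cong refl *)
  finally have "parallels H (t P) = t ` parallels G P" .
  moreover have "inj_on t (parallels G P)"
    using bij unfolding bij_betw_def parallels_def by (auto intro: inj_on_subset)
  ultimately show ?thesis by (simp add: card_image)
qed

text \<open>\<open>base\<close> and \<open>dthread\<close> depend only on the number of ends, the
  parity of the length, the number of parallel threads, and whether the length is 1. The last
  matters only when there are parallel threads, which is why \<open>one\<close> is conditional: a
  \<gamma>-path of length 1 may be lengthened.\<close>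

lemma homeoI:
  assumes inj: "inj_on s {v. special G v}"
    and sp: "\<And>v. special G v \<Longrightarrow> special H (s v)"
      "\<And>v. special G v \<Longrightarrow> s v \<in> lverts H \<longleftrightarrow> v \<in> lverts G"
      "\<And>v. special G v \<Longrightarrow> s v \<in> rverts H \<longleftrightarrow> v \<in> rverts G"
    and bij: "bij_betw t (threads G) (threads H)"
    and en: "\<And>P. P \<in> threads G \<Longrightarrow> ends H (t P) = s ` ends G P"
    and par: "\<And>P. P \<in> threads G \<Longrightarrow> even (card (t P)) \<longleftrightarrow> even (card P)"
    and one: "\<And>P. P \<in> threads G \<Longrightarrow> card (parallels G P) \<noteq> 1 \<Longrightarrow> card (t P) = 1 \<longleftrightarrow> card P = 1"
    and G: "bigraph G"
  shows "homeo s t G H"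
proof -
  have es: "ends G P \<subseteq> {v. special G v}" for P by (auto simp: ends_def)
  have ce: "card (ends H (t P)) = card (ends G P)" if "P \<in> threads G" for P
    unfolding en[OF that] by (rule card_image[OF inj_on_subset[OF inj es]])
  have cp: "card (parallels H (t P)) = card (parallels G P)" if "P \<in> threads G" for P
    by (rule card_parallels_transfer[OF inj bij en that])
  have "base H (t P) = base G P" "dthread H (t P) \<longleftrightarrow> dthread G P" if P: "P \<in> threads G" for P
    using par[OF P] one[OF P] by (auto simp: base_def dthread_def ce[OF P] cp[OF P])
  thus ?thesis using assms by (simp add: homeo_def)
qed

lemma minimal_walksI:
  assumes "core G" "P \<in> threads G"
  shows "ends G P = {v} \<Longrightarrow> [Sp v, Nm P 0, Nm P 1, Nm P 2, Sp v] \<in> minimal_walks G"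
    "u \<noteq> v \<Longrightarrow> ends G P = {u, v} \<Longrightarrow> base G P = 2 \<Longrightarrow> [Sp u, Nm P 0, Sp v] \<in> minimal_walks G"
    "u \<in> lverts G \<Longrightarrow> v \<in> rverts G \<Longrightarrow> ends G P = {u, v} \<Longrightarrow> base G P = 1 \<Longrightarrow>
      [Sp u, Sp v] \<in> minimal_walks G"
    "u \<in> lverts G \<Longrightarrow> v \<in> rverts G \<Longrightarrow> ends G P = {u, v} \<Longrightarrow> base G P = 3 \<Longrightarrow>
      [Sp u, Nm P 0, Nm P 1, Sp v] \<in> minimal_walks G"
proof -
  note P = bexI[OF _ assms(2)]
  show "[Sp v, Nm P 0, Nm P 1, Nm P 2, Sp v] \<in> minimal_walks G" if "ends G P = {v}"
    unfolding minimal_walks_threads[OF assms(1)]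
    by (rule P, rule disjI1, rule exI[of _ v]) (simp add: that)
  show "[Sp u, Nm P 0, Sp v] \<in> minimal_walks G" if "u \<noteq> v" "ends G P = {u, v}" "base G P = 2"
    unfolding minimal_walks_threads[OF assms(1)]
    by (rule P, rule disjI2, rule disjI1, rule exI[of _ u], rule exI[of _ v]) (simp add: that)
  show "[Sp u, Sp v] \<in> minimal_walks G"
    if "u \<in> lverts G" "v \<in> rverts G" "ends G P = {u, v}" "base G P = 1"
    unfolding minimal_walks_threads[OF assms(1)]
    by (rule P, rule disjI2, rule disjI2, rule disjI1, rule bexI[OF _ that(1)], rule bexI[OF _ that(2)])
      (simp add: that)
  show "[Sp u, Nm P 0, Nm P 1, Sp v] \<in> minimal_walks G"
    if "u \<in> lverts G" "v \<in> rverts G" "ends G P = {u, v}" "base G P = 3"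
    unfolding minimal_walks_threads[OF assms(1)]
    by (rule P, rule disjI2, rule disjI2, rule disjI2, rule bexI[OF _ that(1)], rule bexI[OF _ that(2)])
      (simp add: that)
qed

lemma minimal_walksE:
  assumes "core G" "w \<in> minimal_walks G"
  obtains
      (alpha) P v where "P \<in> threads G" "ends G P = {v}" "w = [Sp v, Nm P 0, Nm P 1, Nm P 2, Sp v]"
    | (beta) P u v where "P \<in> threads G" "u \<noteq> v" "ends G P = {u, v}" "base G P = 2"
        "w = [Sp u, Nm P 0, Sp v]"
    | (single) P u v where "P \<in> threads G" "u \<in> lverts G" "v \<in> rverts G" "ends G P = {u, v}"
        "base G P = 1" "w = [Sp u, Sp v]"
    | (delta) P u v where "P \<in> threads G" "u \<in> lverts G" "v \<in> rverts G" "ends G P = {u, v}"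
        "base G P = 3" "w = [Sp u, Nm P 0, Nm P 1, Sp v]"
proof -
  from assms(2) obtain P where P: "P \<in> threads G" and
    R: "(\<exists>v. ends G P = {v} \<and> w = [Sp v, Nm P 0, Nm P 1, Nm P 2, Sp v]) \<or>
     (\<exists>u v. u \<noteq> v \<and> ends G P = {u, v} \<and> base G P = 2 \<and> w = [Sp u, Nm P 0, Sp v]) \<or>
     (\<exists>u\<in>lverts G. \<exists>v\<in>rverts G. ends G P = {u, v} \<and> base G P = 1 \<and> w = [Sp u, Sp v]) \<or>
     (\<exists>u\<in>lverts G. \<exists>v\<in>rverts G. ends G P = {u, v} \<and> base G P = 3 \<and>
        w = [Sp u, Nm P 0, Nm P 1, Sp v])"
    unfolding minimal_walks_threads[OF assms(1)] by (rule bexE)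
  from R show thesis
  proof (elim disjE)
    assume "\<exists>v. ends G P = {v} \<and> w = [Sp v, Nm P 0, Nm P 1, Nm P 2, Sp v]"
    thus thesis by (elim exE conjE) (rule alpha[OF P])
  next
    assume "\<exists>u v. u \<noteq> v \<and> ends G P = {u, v} \<and> base G P = 2 \<and> w = [Sp u, Nm P 0, Sp v]"
    thus thesis by (elim exE conjE) (rule beta[OF P])
  next
    assume "\<exists>u\<in>lverts G. \<exists>v\<in>rverts G. ends G P = {u, v} \<and> base G P = 1 \<and> w = [Sp u, Sp v]"
    thus thesis by (elim bexE conjE) (rule single[OF P])
  next
    assume "\<exists>u\<in>lverts G. \<exists>v\<in>rverts G. ends G P = {u, v} \<and> base G P = 3 \<and>
        w = [Sp u, Nm P 0, Nm P 1, Sp v]"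
    thus thesis by (elim bexE conjE) (rule delta[OF P])
  qed
qed

lemma minimal_walk_verts:
  assumes G: "core G" and w: "w \<in> minimal_walks G"
  shows "set w \<subseteq> Sp ` {v. special G v} \<union> {Nm P i | P i. P \<in> threads G}"
    and "\<exists>u. special G u \<and> hd w = Sp u" "length w \<ge> 2"
proof -
  have sp: "special G u \<and> special G v" if "ends G P = {u, v}" for P u v
    using ends_special[OF that] by blast
  have "set w \<subseteq> Sp ` {v. special G v} \<union> {Nm P i | P i. P \<in> threads G} \<and>
    (\<exists>u. special G u \<and> hd w = Sp u) \<and> length w \<ge> 2"
    using G w
  proof (cases rule: minimal_walksE)
    case (alpha P v)
    thus ?thesis using sp[of P v v] by simp
  next
    case (beta P u v)
    thus ?thesis using sp[of P u v] by simp
  next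
    case (single P u v)
    thus ?thesis using sp[of P u v] by simp
  next
    case (delta P u v)
    thus ?thesis using sp[of P u v] by simp
  qed
  thus "set w \<subseteq> Sp ` {v. special G v} \<union> {Nm P i | P i. P \<in> threads G}"
    "\<exists>u. special G u \<and> hd w = Sp u" "length w \<ge> 2" by blast+
qed

lemma minimal_form_simps:
  "lverts (minimal_form G) = {w ! i | w i u. w \<in> minimal_walks G \<and> i < length w \<and> hd w = Sp u \<and>
      (even i \<longleftrightarrow> u \<in> lverts G)}"
  "rverts (minimal_form G) = {w ! i | w i u. w \<in> minimal_walks G \<and> i < length w \<and> hd w = Sp u \<and>
      (even i \<longleftrightarrow> u \<in> rverts G)}"
  "edges (minimal_form G) = (\<Union>w\<in>minimal_walks G. walk_edges w)"
  by (simp_all only: minimal_form_def bigraph.simps)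

lemma minimal_form_verts:
  assumes G: "core G"
  shows "verts (minimal_form G) = \<Union>(set ` minimal_walks G)"
proof (intro equalityI subsetI)
  fix x assume "x \<in> verts (minimal_form G)"
  thus "x \<in> \<Union>(set ` minimal_walks G)" by (auto simp: verts_def minimal_form_simps intro: nth_mem)
next
  fix x assume "x \<in> \<Union>(set ` minimal_walks G)"
  then obtain w i where w: "w \<in> minimal_walks G" "i < length w" "x = w ! i"
    by (auto simp: in_set_conv_nth)
  obtain u where u: "special G u" "hd w = Sp u" using minimal_walk_verts[OF G w(1)] by blast
  show "x \<in> verts (minimal_form G)"
    using w u special_side[OF u(1) coreD(1)[OF G]] unfolding verts_def minimal_form_simps by blast
qed

lemma minimal_form_edges_Pow:
  assumes G: "core G"
  shows "edges (minimal_form G) \<subseteq> Pow (verts (minimal_form G))"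
proof
  fix e assume "e \<in> edges (minimal_form G)"
  then obtain w where "w \<in> minimal_walks G" "e \<in> walk_edges w" by (auto simp: minimal_form_simps)
  thus "e \<in> Pow (verts (minimal_form G))"
    using walk_edges_subset[of e w] by (auto simp: minimal_form_verts[OF G])
qed

text \<open>A minimal walk is determined by a thread, its ends, their sides and \<open>base\<close>.
  All of these are preserved, so relabelling special points by \<open>s\<close> and threads by
  \<open>t\<close> carries walks to walks.\<close>

lemma homeo_minimal_walks:
  assumes G: "core G" and H: "core H" and h: "homeo s t G H"
  defines "f \<equiv> (\<lambda>x. case x of Sp v \<Rightarrow> Sp (s v) | Nm P i \<Rightarrow> Nm (t P) i)"
  shows "minimal_walks H = map f ` minimal_walks G"
proof (intro equalityI subsetI)
  note hh = h[unfolded homeo_def]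
  have en: "ends H (t P) = s ` ends G P" and ba: "base H (t P) = base G P" if "P \<in> threads G" for P
    using hh that by blast+
  have im: "threads H = t ` threads G" using hh by (simp add: bij_betw_def)
  have tP: "t P \<in> threads H" if "P \<in> threads G" for P using hh that by (auto simp: bij_betw_def)
  have spe: "v \<in> ends G P \<Longrightarrow> special G v" for v P by (simp add: ends_def)
  have sl: "(s v \<in> lverts H \<longleftrightarrow> v \<in> lverts G) \<and> (s v \<in> rverts H \<longleftrightarrow> v \<in> rverts G)"
    if "special G v" for v using hh that by blast
  have si: "s u = s v \<longleftrightarrow> u = v" if "special G u" "special G v" for u v
    using hh that by (auto simp: inj_on_def)
  have f: "f (Sp v) = Sp (s v)" "f (Nm P i) = Nm (t P) i" for v P i by (simp_all add: f_def)
  {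
    fix w assume "w \<in> map f ` minimal_walks G"
    then obtain w' where w: "w = map f w'" "w' \<in> minimal_walks G" by blast
    from G w(2) show "w \<in> minimal_walks H"
    proof (cases rule: minimal_walksE)
      case (alpha P v)
      thus ?thesis using minimal_walksI(1)[OF H tP[of P], of "s v"] en[of P] by (simp add: w f)
    next
      case (beta P u v)
      have "s u \<noteq> s v" using si[of u v] ends_special[OF beta(3)] beta(2) by simp
      thus ?thesis using beta minimal_walksI(2)[OF H tP[of P], of "s u" "s v"] en[of P] ba[of P]
        by (simp add: w f)
    next
      case (single P u v)
      have "s u \<in> lverts H" "s v \<in> rverts H" using sl[of u] sl[of v] ends_special[OF single(4)] single(2,3) by simp_all
      thus ?thesis using single minimal_walksI(3)[OF H tP[of P], of "s u" "s v"] en[of P] ba[of P]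
        by (simp add: w f)
    next
      case (delta P u v)
      have "s u \<in> lverts H" "s v \<in> rverts H" using sl[of u] sl[of v] ends_special[OF delta(4)] delta(2,3) by simp_all
      thus ?thesis using delta minimal_walksI(4)[OF H tP[of P], of "s u" "s v"] en[of P] ba[of P]
        by (simp add: w f)
    qed
  next
    fix w assume wH: "w \<in> minimal_walks H"
    \<comment> \<open>Pulls a thread of \<open>H\<close> back together with the order of its two
      ends, because the members of \<open>minimal_walks\<close> are directed.\<close>
    have pre: "\<exists>P u v. P \<in> threads G \<and> t P = Q \<and> ends G P = {u, v} \<and> s u = a \<and> s v = b \<and>
        base G P = base H Q \<and> special G u \<and> special G v"
      if Q: "Q \<in> threads H" and eQ: "ends H Q = {a, b}" for Q a b
    proof -
      obtain P where P: "P \<in> threads G" "Q = t P" using Q im by blast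
      have ab: "s ` ends G P = {a, b}" using eQ P en by simp
      then obtain u v where uv: "u \<in> ends G P" "v \<in> ends G P" "s u = a" "s v = b"
        by (metis imageE insertCI)
      have "x = u \<or> x = v" if "x \<in> ends G P" for x
      proof -
        have "s x \<in> {a, b}" using that ab by blast
        thus ?thesis using si[of x u] si[of x v] spe[of _ P] that uv by auto
      qed
      hence "ends G P = {u, v}" using uv by blast
      hence "P \<in> threads G \<and> t P = Q \<and> ends G P = {u, v} \<and> s u = a \<and> s v = b \<and>
        base G P = base H Q \<and> special G u \<and> special G v"
        using uv(3,4) P ba[OF P(1)] spe[OF uv(1)] spe[OF uv(2)] by simp
      thus ?thesis by blast
    qed
    have image: "w \<in> map f ` minimal_walks G" if "w' \<in> minimal_walks G" "w = map f w'" for w'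
      using that by blast
    from H wH show "w \<in> map f ` minimal_walks G"
    proof (cases rule: minimal_walksE)
      case (alpha Q v)
      then obtain P a b where P: "P \<in> threads G" "t P = Q" "ends G P = {a, b}" "s a = v" "s b = v"
        "special G a" "special G b" using pre[of Q v v] by auto
      have "a = b" using si[of a b] P by simp
      hence e: "ends G P = {a}" using P(3) by simp
      show ?thesis by (rule image[OF minimal_walksI(1)[OF G P(1) e]]) (use P alpha in \<open>simp add: f\<close>)
    next
      case (beta Q u v)
      then obtain P a b where P: "P \<in> threads G" "t P = Q" "ends G P = {a, b}" "s a = u" "s b = v"
        "base G P = base H Q" using pre[of Q u v] by auto
      have m: "a \<noteq> b" "base G P = 2" using P beta by auto
      show ?thesis by (rule image[OF minimal_walksI(2)[OF G P(1) m(1) P(3) m(2)]]) (use P beta in \<open>simp add: f\<close>)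
    next
      case (single Q u v)
      then obtain P a b where P: "P \<in> threads G" "t P = Q" "ends G P = {a, b}" "s a = u" "s b = v"
        "base G P = base H Q" "special G a" "special G b" using pre[of Q u v] by auto
      have m: "a \<in> lverts G" "b \<in> rverts G" "base G P = 1" using P(4-8) single(2,3,5) sl[of a] sl[of b] by simp_all
      show ?thesis by (rule image[OF minimal_walksI(3)[OF G P(1) m(1,2) P(3) m(3)]]) (use P single in \<open>simp add: f\<close>)
    next
      case (delta Q u v)
      then obtain P a b where P: "P \<in> threads G" "t P = Q" "ends G P = {a, b}" "s a = u" "s b = v"
        "base G P = base H Q" "special G a" "special G b" using pre[of Q u v] by auto
      have m: "a \<in> lverts G" "b \<in> rverts G" "base G P = 3" using P(4-8) delta(2,3,5) sl[of a] sl[of b] by simp_all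
      show ?thesis by (rule image[OF minimal_walksI(4)[OF G P(1) m(1,2) P(3) m(3)]]) (use P delta in \<open>simp add: f\<close>)
    qed
  }
qed

lemma homeo_iso_class:
  assumes G: "core G" and H: "core H" and h: "homeo s t G H"
  shows "iso_class (minimal_form G) = iso_class (minimal_form H)"
proof -
  define f where "f = (\<lambda>x. case x of Sp v \<Rightarrow> Sp (s v) | Nm P i \<Rightarrow> Nm (t P) i)"
  note mw = homeo_minimal_walks[OF assms, folded f_def]
  note hh = h[unfolded homeo_def]
  have vs: "verts (minimal_form G) \<subseteq> Sp ` {v. special G v} \<union> {Nm P i | P i. P \<in> threads G}"
    unfolding minimal_form_verts[OF G] using minimal_walk_verts(1)[OF G] by blast
  have si: "inj_on s {v. special G v}" and ti: "inj_on t (threads G)"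
    using h by (auto simp: homeo_def bij_betw_def)
  have "inj_on f (Sp ` {v. special G v} \<union> {Nm P i | P i. P \<in> threads G})"
    unfolding f_def by (intro inj_onI) (auto dest: inj_onD[OF si] inj_onD[OF ti])
  hence inj: "inj_on f (verts (minimal_form G))" by (rule inj_on_subset[OF _ vs])
  have hd: "hd (map f w) = Sp (s u)" if "w \<in> minimal_walks G" "hd w = Sp u" for w u
    using that minimal_walk_verts(3)[OF G that(1)] by (cases w) (auto simp: f_def)
  \<comment> \<open>The sides are compared at special points only. The fact \<open>side\<close>
    below is stated for arbitrary predicates on them, so that it serves for \<open>lverts\<close>
    and \<open>rverts\<close> alike.\<close>
  have sl: "(s v \<in> lverts H \<longleftrightarrow> v \<in> lverts G) \<and> (s v \<in> rverts H \<longleftrightarrow> v \<in> rverts G)"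
    if "special G v" for v using hh that by blast
  have side: "{w ! i | w i u. w \<in> minimal_walks H \<and> i < length w \<and> hd w = Sp u \<and> (even i \<longleftrightarrow> p u)}
      = f ` {w ! i | w i u. w \<in> minimal_walks G \<and> i < length w \<and> hd w = Sp u \<and> (even i \<longleftrightarrow> q u)}"
    (is "?A = f ` ?B") if pq: "\<And>u. special G u \<Longrightarrow> p (s u) \<longleftrightarrow> q u" for p q
  proof (intro equalityI subsetI)
    fix x assume "x \<in> ?A"
    then obtain w i u where w: "w \<in> minimal_walks G" "i < length w" "x = map f w ! i"
       "hd (map f w) = Sp u" "even i \<longleftrightarrow> p u"
      unfolding mw by auto
    obtain u' where u': "special G u'" "hd w = Sp u'" using minimal_walk_verts(2)[OF G w(1)] by blast
    have "even i \<longleftrightarrow> q u'" using hd[OF w(1) u'(2)] w pq[OF u'(1)] by simp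
    hence "w ! i \<in> ?B" using w u' by blast
    moreover have "x = f (w ! i)" using w by simp
    ultimately show "x \<in> f ` ?B" by blast
  next
    fix x assume "x \<in> f ` ?B"
    then obtain w i u where w: "w \<in> minimal_walks G" "i < length w" "x = f (w ! i)"
       "hd w = Sp u" "even i \<longleftrightarrow> q u" by blast
    have "special G u" using minimal_walk_verts(2)[OF G w(1)] w(4) by auto
    hence "even i \<longleftrightarrow> p (s u)" using w pq by blast
    moreover have "map f w \<in> minimal_walks H" unfolding mw using w by blast
    moreover have "x = map f w ! i" using w by simp
    moreover have "i < length (map f w)" using w by simp
    ultimately show "x \<in> ?A" using hd[OF w(1,4)] by blast
  qed
  have "bigraph_iso f (minimal_form G) (minimal_form H)"
  proof (rule bigraph_isoI[OF inj])
    show "lverts (minimal_form H) = f ` lverts (minimal_form G)"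
      unfolding minimal_form_simps by (rule side) (use sl in blast)
    show "rverts (minimal_form H) = f ` rverts (minimal_form G)"
      unfolding minimal_form_simps by (rule side) (use sl in blast)
    show "edges (minimal_form H) = (\<lambda>e. f ` e) ` edges (minimal_form G)"
      unfolding minimal_form_simps mw by (simp add: walk_edges_map image_UN)
  qed
  thus ?thesis using iso_class_eq minimal_form_edges_Pow[OF G] by blast
qed

lemma homeo_card_slots:
  assumes h: "homeo s t G H"
  shows "card (slots H) = card (slots G)" "card (threads H) = card (threads G)"
proof -
  have b: "bij_betw t (threads G) (threads H)" using h by (simp add: homeo_def)
  show "card (threads H) = card (threads G)" using bij_betw_same_card[OF b] by simp
  have im: "threads H = t ` threads G" using b by (simp add: bij_betw_def)
  have d: "dthread H (t P) \<longleftrightarrow> dthread G P" if "P \<in> threads G" for P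
    using h that by (simp add: homeo_def)
  have "slots H = t ` {P \<in> threads G. \<not> dthread H (t P)}"
    unfolding slots_def im by (rule Collect_image_filter)
  also have "{P \<in> threads G. \<not> dthread H (t P)} = slots G"
    unfolding slots_def by (intro Collect_cong conj_cong refl) (simp add: d)
  finally have "slots H = t ` slots G" .
  moreover have "inj_on t (slots G)"
    using b unfolding bij_betw_def slots_def by (auto intro: inj_on_subset)
  ultimately show "card (slots H) = card (slots G)" by (simp add: card_image)
qed

text \<open>\<open>pr\<close> need not be injective: for a subdivision it sends the three new edges
  to the old one. It is enough that its fibres are linked and that links correspond up to sequences
  of links; threads then correspond by taking preimages.\<close>

lemma threads_transfer:
  fixes pr :: "'w set \<Rightarrow> 'v set" and G :: "'v bigraph" and H :: "'w bigraph"
  assumes sur: "pr ` edges H = edges G"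
    and l1: "\<And>e f. (e, f) \<in> link H \<Longrightarrow> (pr e, pr f) \<in> (link G)\<^sup>*"
    and l2: "\<And>e f. (pr e, pr f) \<in> link G \<Longrightarrow> e \<in> edges H \<Longrightarrow> f \<in> edges H \<Longrightarrow> (e, f) \<in> (link H)\<^sup>*"
    and l3: "\<And>e f. pr e = pr f \<Longrightarrow> e \<in> edges H \<Longrightarrow> f \<in> edges H \<Longrightarrow> (e, f) \<in> (link H)\<^sup>*"
  defines "t \<equiv> (\<lambda>P. {e \<in> edges H. pr e \<in> P})"
  shows "bij_betw t (threads G) (threads H)"
    and "\<And>e. e \<in> edges H \<Longrightarrow> t (thread G (pr e)) = thread H e"
proof -
  show key: "t (thread G (pr e)) = thread H e" if e: "e \<in> edges H" for e
  proof (intro equalityI subsetI)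
    fix f assume "f \<in> t (thread G (pr e))"
    hence f: "f \<in> edges H" and r: "(pr e, pr f) \<in> (link G)\<^sup>*" by (auto simp: t_def thread_def)
    \<comment> \<open>Stated for all edges over \<open>b\<close>, so that the induction may pass
      through any lift of the intermediate edge.\<close>
    have "\<forall>f\<in>edges H. pr f = b \<longrightarrow> (e, f) \<in> (link H)\<^sup>*" if "(pr e, b) \<in> (link G)\<^sup>*" for b
      using that
    proof induction
      case base
      show ?case using l3 e by auto
    next
      case (step b c)
      show ?case
      proof (intro ballI impI)
        fix f assume f: "f \<in> edges H" "pr f = c"
        have "b \<in> edges G" using step(2) by (auto simp: link_def)
        then obtain g where g: "g \<in> edges H" "pr g = b" unfolding sur[symmetric] by blast
        have "(e, g) \<in> (link H)\<^sup>*" using step.IH g by blast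
        moreover have "(g, f) \<in> (link H)\<^sup>*" by (rule l2) (use g f step(2) in auto)
        ultimately show "(e, f) \<in> (link H)\<^sup>*" by (rule rtrancl_trans)
      qed
    qed
    from this[OF r] f show "f \<in> thread H e" by (simp add: thread_def)
  next
    fix f assume "f \<in> thread H e"
    hence r: "(e, f) \<in> (link H)\<^sup>*" by (simp add: thread_def)
    have "(pr e, pr f) \<in> (link G)\<^sup>*" using r
    proof induction
      case (step g h)
      thus ?case using l1[OF step(2)] by (meson rtrancl_trans)
    qed auto
    moreover have "f \<in> edges H" using r e by induction (auto simp: link_def)
    ultimately show "f \<in> t (thread G (pr e))" by (simp add: t_def thread_def)
  qed
  have "threads H = (\<lambda>e. t (thread G (pr e))) ` edges H"
    unfolding threads_def by (rule image_cong[OF refl]) (simp add: key)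
  also have "\<dots> = t ` threads G" unfolding threads_def sur[symmetric] image_image ..
  finally have im: "threads H = t ` threads G" .
  have "pr ` t P = P" if "P \<in> threads G" for P
  proof -
    have "P \<subseteq> pr ` edges H" unfolding sur using that threads_edge by blast
    thus ?thesis unfolding t_def by blast
  qed
  hence "inj_on t (threads G)" by (metis inj_onI)
  thus "bij_betw t (threads G) (threads H)" by (simp add: bij_betw_def im)
qed

lemma bigraph_iso_link:
  assumes iso: "bigraph_iso f G H" and G: "bigraph G" and l: "(a, b) \<in> link G"
  shows "(f ` a, f ` b) \<in> link H"
proof -
  obtain x where x: "a \<in> edges G" "b \<in> edges G" "normal G x" "x \<in> a" "x \<in> b"
    using l by (auto simp: link_def)
  have "x \<in> verts G" using x by (simp add: normal_def)
  hence "normal H (f x)" using bigraph_iso_special(2)[OF iso G] x by simp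
  moreover have "f ` a \<in> edges H" "f ` b \<in> edges H" using x bigraph_isoD(5)[OF iso] by auto
  moreover have "f x \<in> f ` a" "f x \<in> f ` b" using x by auto
  ultimately show ?thesis unfolding link_def by blast
qed

lemma bigraph_iso_homeo:
  assumes iso: "bigraph_iso f G H" and G: "bigraph G"
  shows "homeo f (\<lambda>P. (\<lambda>e. f ` e) ` P) G H"
proof -
  note I = bigraph_isoD[OF iso]
  note E = bigraph_edges_Pow[OF G]
  define g where "g = inv_into (verts G) f"
  have H: "bigraph H" by (rule bigraph_iso_bigraph[OF iso G])
  have inv: "bigraph_iso g H G" unfolding g_def by (rule bigraph_iso_inverse[OF iso E])
  have gf: "g ` (f ` e) = e" if "e \<in> edges G" for e
    unfolding g_def using that E by (intro inv_into_image_cancel[OF I(1)]) auto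
  have fg: "f ` (g ` e) = e" if "e \<in> edges H" for e
  proof -
    from that[unfolded I(5)] obtain e' where "e = f ` e'" "e' \<in> edges G" by (rule imageE)
    thus ?thesis using gf by simp
  qed
  let ?t = "\<lambda>P. {e \<in> edges H. g ` e \<in> P}"
  have tim: "?t P = (\<lambda>e. f ` e) ` P" if "P \<in> threads G" for P
  proof (intro equalityI subsetI)
    fix e assume "e \<in> ?t P"
    thus "e \<in> (\<lambda>e. f ` e) ` P" using fg[of e] by (intro image_eqI[of _ _ "g ` e"]) auto
  next
    fix e assume "e \<in> (\<lambda>e. f ` e) ` P"
    then obtain e' where e': "e = f ` e'" "e' \<in> P" by (rule imageE)
    hence "e' \<in> edges G" using threads_edge[OF that] by blast
    thus "e \<in> ?t P" using e' gf I(5) by auto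
  qed
  have "bij_betw ?t (threads G) (threads H)"
  proof (rule threads_transfer)
    show "(\<lambda>e. g ` e) ` edges H = edges G" using bigraph_isoD(5)[OF inv] by simp
    show "(g ` e, g ` h) \<in> (link G)\<^sup>*" if "(e, h) \<in> link H" for e h
      using bigraph_iso_link[OF inv H that] by blast
    show "(e, h) \<in> (link H)\<^sup>*" if "(g ` e, g ` h) \<in> link G" "e \<in> edges H" "h \<in> edges H" for e h
      using bigraph_iso_link[OF iso G that(1)] by (simp add: fg that(2,3) r_into_rtrancl)
    show "(e, h) \<in> (link H)\<^sup>*" if "g ` e = g ` h" "e \<in> edges H" "h \<in> edges H" for e h
    proof -
      have "e = f ` (g ` h)" using fg[OF that(2)] by (simp only: that(1))
      also have "\<dots> = h" by (rule fg[OF that(3)])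
      finally show ?thesis by simp
    qed
  qed
  hence bij: "bij_betw (\<lambda>P. (\<lambda>e. f ` e) ` P) (threads G) (threads H)"
    by (rule bij_betw_cong[THEN iffD1, rotated]) (rule tim)
  have cardt: "card ((\<lambda>e. f ` e) ` P) = card P" if "P \<in> threads G" for P
    using threads_edge[OF that] by (intro card_image inj_on_subset[OF bigraph_iso_edge_inj[OF iso G]]) blast
  show ?thesis
  proof (rule homeoI[OF _ _ _ _ bij _ _ _ G])
    have sv: "v \<in> verts G" if "special G v" for v using that by (simp add: special_def)
    show "inj_on f {v. special G v}" by (rule inj_on_subset[OF I(1)]) (use sv in blast)
    show "special H (f v)" if "special G v" for v
      using bigraph_iso_special(1)[OF iso G sv[OF that]] that by simp
    show "f v \<in> lverts H \<longleftrightarrow> v \<in> lverts G" "f v \<in> rverts H \<longleftrightarrow> v \<in> rverts G" if "special G v" for v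
      unfolding I(2,3) using inj_on_image_mem_iff[OF I(1) sv[OF that]] by (auto simp: verts_def)
    show "ends H ((\<lambda>e. f ` e) ` P) = f ` ends G P" if P: "P \<in> threads G" for P
    proof -
      have V: "x \<in> verts G" if "x \<in> \<Union>P" for x using that threads_edge[OF P] E by blast
      have "ends H ((\<lambda>e. f ` e) ` P) = {y \<in> f ` \<Union>P. special H y}" unfolding ends_def by auto
      also have "\<dots> = f ` {x \<in> \<Union>P. special H (f x)}" by (rule Collect_image_filter)
      also have "{x \<in> \<Union>P. special H (f x)} = ends G P"
        unfolding ends_def by (intro Collect_cong conj_cong refl bigraph_iso_special(1)[OF iso G V])
      finally show ?thesis .
    qed
  qed (simp_all add: cardt)
qed

lemma bigraph_iso_minimal_form:
  assumes iso: "bigraph_iso f G H" and G: "core G"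
  shows "iso_class (minimal_form G) = iso_class (minimal_form H)"
    and "card (slots G) = card (slots H)" "n_delta_edges G = n_delta_edges H"
proof -
  note bg = coreD(1)[OF G]
  note H = bigraph_iso_core[OF iso G]
  note h = bigraph_iso_homeo[OF iso bg]
  show "iso_class (minimal_form G) = iso_class (minimal_form H)"
    by (rule homeo_iso_class[OF G H h])
  show s: "card (slots G) = card (slots H)" using homeo_card_slots(1)[OF h] by simp
  show "n_delta_edges G = n_delta_edges H"
    using card_slots[OF G] card_slots[OF H] bigraph_iso_N_sp[OF iso bg] bigraph_iso_cards(5)[OF iso bg] s
    by simp
qed

section \<open>A core of excess 0 is isomorphic to its minimal form\<close>

section \<open>Graphs in minimal form\<close>

text \<open>Odd threads are traversed from the left side, like the \<gamma>- and \<delta>-walks of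
  the minimal form. Otherwise the two inner points of a \<delta>-walk could be matched in the wrong
  order.\<close>

lemma oriented_threadE:
  assumes G: "core G" and P: "P \<in> threads G"
  obtains u q v where "chain G u q v" "P = walk_edges (u # q @ [v])" "card P = length q + 1"
    "ends G P = {u, v}" "odd (card P) \<Longrightarrow> u \<in> lverts G \<and> v \<notin> lverts G"
proof -
  obtain u q v where c: "chain G u q v" "P = walk_edges (u # q @ [v])" "card P = length q + 1"
    "ends G P = {u, v}" "even (card P) \<longleftrightarrow> (u \<in> lverts G \<longleftrightarrow> v \<in> lverts G)"
    by (rule threadE[OF G P], rule that)
  show thesis
  proof (cases "odd (card P) \<and> u \<notin> lverts G")
    case False
    show thesis by (rule that[OF c(1-4)]) (use c(5) False in auto)
  next
    case True
    have r: "walk_edges (v # rev q @ [u]) = P" using walk_edges_rev[of "u # q @ [v]"] by (simp add: c(2))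
    show thesis
      by (rule that[OF chain_rev[OF c(1)]]) (use c True r in \<open>auto simp: insert_commute\<close>)
  qed
qed

lemma list_of_length:
  "length q = 1 \<Longrightarrow> \<exists>a. q = [a]" "length q = 2 \<Longrightarrow> \<exists>a b. q = [a, b]"
  "length q = 3 \<Longrightarrow> \<exists>a b c. q = [a, b, c]"
  by (auto simp: numeral_eq_Suc length_Suc_conv)

text \<open>At excess 0 every thread has the length of its minimal form, so the normal points met in
  a chosen traversal of \<open>P\<close> can take the places of \<open>Nm P 0\<close>,
  \<open>Nm P 1\<close>, and so on.\<close>

lemma zero_excess_iso:
  assumes G: "core G" and z: "total_excess G = 0"
  obtains g where "bigraph_iso g (minimal_form G) G"
proof -
  note bg = coreD(1)[OF G]
  have cb: "card P = base G P" if "P \<in> threads G" for P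
    using z that card_eq_base_excess[OF G that] finite_threads[OF bg] by (simp add: total_excess_def)
  have "\<forall>P\<in>threads G. \<exists>uqv. case uqv of (u, q, v) \<Rightarrow> chain G u q v \<and> P = walk_edges (u # q @ [v]) \<and>
     card P = length q + 1 \<and> ends G P = {u, v} \<and> (odd (card P) \<longrightarrow> u \<in> lverts G \<and> v \<notin> lverts G)"
  proof
    fix P assume P: "P \<in> threads G"
    obtain u q v where c: "chain G u q v" "P = walk_edges (u # q @ [v])" "card P = length q + 1"
      "ends G P = {u, v}" "odd (card P) \<Longrightarrow> u \<in> lverts G \<and> v \<notin> lverts G"
      by (rule oriented_threadE[OF G P], rule that)
    show "\<exists>uqv. case uqv of (u, q, v) \<Rightarrow> chain G u q v \<and> P = walk_edges (u # q @ [v]) \<and>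
      card P = length q + 1 \<and> ends G P = {u, v} \<and> (odd (card P) \<longrightarrow> u \<in> lverts G \<and> v \<notin> lverts G)"
      using c by (intro exI[of _ "(u, q, v)"]) simp
  qed
  then obtain W where W: "\<forall>P\<in>threads G. case W P of (u, q, v) \<Rightarrow> chain G u q v \<and>
      P = walk_edges (u # q @ [v]) \<and> card P = length q + 1 \<and> ends G P = {u, v} \<and>
      (odd (card P) \<longrightarrow> u \<in> lverts G \<and> v \<notin> lverts G)"
    by (rule bchoice[THEN exE])
  define U where "U P = fst (W P)" for P
  define Q where "Q P = fst (snd (W P))" for P
  define V where "V P = snd (snd (W P))" for P
  have c: "chain G (U P) (Q P) (V P)" "P = walk_edges (U P # Q P @ [V P])" "card P = length (Q P) + 1"
      "ends G P = {U P, V P}" "odd (card P) \<Longrightarrow> U P \<in> lverts G \<and> V P \<notin> lverts G"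
    if "P \<in> threads G" for P
    using W[rule_format, OF that] unfolding U_def Q_def V_def by (auto simp: case_prod_beta)
  define g where "g = (\<lambda>x. case x of Sp v \<Rightarrow> v | Nm P i \<Rightarrow> Q P ! i)"
  have g: "g (Sp v) = v" "g (Nm P i) = Q P ! i" for v P i by (simp_all add: g_def)
  have len: "length (Q P) = base G P - 1" if "P \<in> threads G" for P
    using c(3)[OF that] cb[OF that] by simp
  \<comment> \<open>Contains the vertices of the minimal form, with only those indices for which
    \<open>Q P ! i\<close> is a normal point of \<open>P\<close>.\<close>
  define D where "D = Sp ` {v. special G v} \<union> {Nm P i | P i. P \<in> threads G \<and> i < length (Q P)}"
  have walk: "\<exists>P\<in>threads G. walk_edges (map g w) = P \<and> set w \<subseteq> D" if w: "w \<in> minimal_walks G" for w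
    using G w
  proof (cases rule: minimal_walksE)
    case (alpha P v)
    have uv: "U P = v" "V P = v" using c(4)[OF alpha(1)] alpha(2) by auto
    have l: "length (Q P) = 3" using len[OF alpha(1)] alpha by (simp add: base_def)
    then obtain a b d where q: "Q P = [a, b, d]" using list_of_length(3) by blast
    have "map g w = U P # Q P @ [V P]" by (simp add: alpha g q uv)
    hence "walk_edges (map g w) = P" by (simp only: c(2)[OF alpha(1), symmetric])
    moreover have "special G v" using ends_subset_special[of v G P] alpha(2) by simp
    ultimately show ?thesis using alpha l by (intro bexI[of _ P]) (auto simp: D_def)
  next
    case (beta P u v)
    \<comment> \<open>\<open>minimal_walks\<close> contains a \<beta>-walk in both directions,
      whereas only one traversal of \<open>P\<close> was chosen. With a single inner point, the
      reversed list has the same edges.\<close>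
    have uv: "U P = u \<and> V P = v \<or> U P = v \<and> V P = u"
      using c(4)[OF beta(1)] beta(3) by (auto simp: doubleton_eq_iff)
    have l: "length (Q P) = 1" using len[OF beta(1)] beta by simp
    then obtain a where q: "Q P = [a]" using list_of_length(1) by blast
    have "map g w = U P # Q P @ [V P] \<or> map g w = rev (U P # Q P @ [V P])"
      using uv by (auto simp: beta g q)
    hence "walk_edges (map g w) = walk_edges (U P # Q P @ [V P])"
      by (elim disjE) (simp_all only: walk_edges_rev)
    hence "walk_edges (map g w) = P" by (simp only: c(2)[OF beta(1), symmetric])
    thus ?thesis using beta l ends_special[OF beta(3)] by (intro bexI[of _ P]) (auto simp: D_def)
  next
    case (single P u v)
    have l: "length (Q P) = 0" using len[OF single(1)] single by simp
    have "walk_edges (map g w) = {{u, v}}" by (simp add: single g)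
    also have "{u, v} = {U P, V P}" using c(4)[OF single(1)] single by simp
    also have "{{U P, V P}} = walk_edges (U P # Q P @ [V P])" using l by simp
    finally have "walk_edges (map g w) = P" by (simp only: c(2)[OF single(1), symmetric])
    thus ?thesis using single ends_special[OF single(4)] by (intro bexI[of _ P]) (auto simp: D_def)
  next
    case (delta P u v)
    have l: "length (Q P) = 2" using len[OF delta(1)] delta by simp
    hence o: "odd (card P)" using c(3)[OF delta(1)] by simp
    have "v \<notin> lverts G" using delta(3) bigraphD(3)[OF bg] by blast
    hence uv: "U P = u" "V P = v"
      using c(4)[OF delta(1)] c(5)[OF delta(1) o] delta(2,4) by (auto simp: doubleton_eq_iff)
    obtain a b where q: "Q P = [a, b]" using l list_of_length(2) by blast
    have "map g w = U P # Q P @ [V P]" by (simp add: delta g q uv)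
    hence "walk_edges (map g w) = P" by (simp only: c(2)[OF delta(1), symmetric])
    thus ?thesis using delta l ends_special[OF delta(4)] by (intro bexI[of _ P]) (auto simp: D_def)
  qed
  have walk': "\<exists>w\<in>minimal_walks G. walk_edges (map g w) = P" if P: "P \<in> threads G" for P
  proof -
    have u: "special G (U P)" "special G (V P)" using ends_special[OF c(4)[OF P]] .
    show ?thesis
    proof (cases "U P = V P")
      case True
      hence e: "ends G P = {U P}" using c(4)[OF P] by simp
      have l: "length (Q P) = 3" using len[OF P] e by (simp add: base_def)
      then obtain a b d where q: "Q P = [a, b, d]" using list_of_length(3) by blast
      have "map g [Sp (U P), Nm P 0, Nm P 1, Nm P 2, Sp (U P)] = U P # Q P @ [V P]"
        using True by (simp add: g q)
      hence "walk_edges (map g [Sp (U P), Nm P 0, Nm P 1, Nm P 2, Sp (U P)]) = P"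
        by (simp only: c(2)[OF P, symmetric])
      thus ?thesis using minimal_walksI(1)[OF G P e] by (rule bexI)
    next
      case ne: False
      show ?thesis
      proof (cases "even (card P)")
        case True
        have b: "base G P = 2" using True ne c(4)[OF P] by (simp add: base_def)
        have l: "length (Q P) = 1" using len[OF P] b by simp
        then obtain a where q: "Q P = [a]" using list_of_length(1) by blast
        have "map g [Sp (U P), Nm P 0, Sp (V P)] = U P # Q P @ [V P]" by (simp add: g q)
        hence "walk_edges (map g [Sp (U P), Nm P 0, Sp (V P)]) = P"
          by (simp only: c(2)[OF P, symmetric])
        thus ?thesis using minimal_walksI(2)[OF G P ne c(4)[OF P] b] by (rule bexI)
      next
        case False
        have s: "U P \<in> lverts G" "V P \<in> rverts G"
          using c(5)[OF P False] special_side[OF u(2) bg] by auto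
        have "base G P = 1 \<or> base G P = 3" using False ne c(4)[OF P] by (simp add: base_def)
        thus ?thesis
        proof
          assume b: "base G P = 1"
          have l: "Q P = []" using len[OF P] b by simp
          have "map g [Sp (U P), Sp (V P)] = U P # Q P @ [V P]" by (simp add: g l)
          hence "walk_edges (map g [Sp (U P), Sp (V P)]) = P"
            by (simp only: c(2)[OF P, symmetric])
          thus ?thesis using minimal_walksI(3)[OF G P s c(4)[OF P] b] by (rule bexI)
        next
          assume b: "base G P = 3"
          have l: "length (Q P) = 2" using len[OF P] b by simp
          then obtain a b' where q: "Q P = [a, b']" using list_of_length(2) by blast
          have "map g [Sp (U P), Nm P 0, Nm P 1, Sp (V P)] = U P # Q P @ [V P]" by (simp add: g q)
          hence "walk_edges (map g [Sp (U P), Nm P 0, Nm P 1, Sp (V P)]) = P"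
            by (simp only: c(2)[OF P, symmetric])
          thus ?thesis using minimal_walksI(4)[OF G P s c(4)[OF P] b] by (rule bexI)
        qed
      qed
    qed
  qed
  have sub: "walk_edges (map g w) \<subseteq> edges G" if "w \<in> minimal_walks G" for w
    using walk[OF that] threads_edge by blast
  have gi: "inj_on g D"
  proof (rule inj_onI)
    fix x y assume xy: "x \<in> D" "y \<in> D" "g x = g y"
    have nmem: "Q P ! i \<in> \<Union>P" "normal G (Q P ! i)" "Q P ! i \<in> set (Q P)"
      if "P \<in> threads G" "i < length (Q P)" for P i
    proof -
      show m: "Q P ! i \<in> set (Q P)" using that by simp
      have "\<Union>P = set (U P # Q P @ [V P])"
        using Union_walk_edges[of "U P # Q P @ [V P]"] c(2)[OF that(1)] by simp
      thus "Q P ! i \<in> \<Union>P" using m by auto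
      show "normal G (Q P ! i)" using c(1)[OF that(1)] m by (simp add: chain_def)
    qed
    show "x = y"
    proof (cases x)
      case (Sp u)
      show ?thesis
      proof (cases y)
        case (Sp v)
        thus ?thesis using xy \<open>x = Sp u\<close> by (simp add: g)
      next
        case (Nm P i)
        hence "P \<in> threads G" "i < length (Q P)" "special G u" using xy Sp by (auto simp: D_def)
        thus ?thesis using nmem(2)[of P i] xy(3) Sp Nm by (auto simp: g dest: normal_not_special)
      qed
    next
      case (Nm P i)
      hence P: "P \<in> threads G" "i < length (Q P)" using xy by (auto simp: D_def)
      show ?thesis
      proof (cases y)
        case (Sp v)
        hence "special G v" using xy by (auto simp: D_def)
        thus ?thesis using nmem(2)[OF P] xy(3) Sp Nm by (auto simp: g dest: normal_not_special)
      next
        case (Nm P' i')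
        hence P': "P' \<in> threads G" "i' < length (Q P')" using xy by (auto simp: D_def)
        have eq: "Q P ! i = Q P' ! i'" using xy(3) Nm \<open>x = Nm P i\<close> by (simp add: g)
        have "P = P'"
          by (rule normal_points_disjoint[OF P(1) P'(1) nmem(1)[OF P] _ nmem(2)[OF P]])
            (use nmem(1)[OF P'] eq in simp)
        moreover have "distinct (Q P)" using c(1)[OF P(1)] by (simp add: chain_def)
        ultimately show ?thesis using eq P P' Nm \<open>x = Nm P i\<close> by (simp add: nth_eq_iff_index_eq)
      qed
    qed
  qed
  have vD: "verts (minimal_form G) \<subseteq> D"
    unfolding minimal_form_verts[OF G] using walk by blast
  have side: "S G = g ` {w ! i | w i u. w \<in> minimal_walks G \<and> i < length w \<and> hd w = Sp u \<and> (even i \<longleftrightarrow> u \<in> S G)}"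
    (is "_ = g ` ?B") if S: "S G \<subseteq> verts G" and
      ws: "\<And>w i. walk_edges w \<subseteq> edges G \<Longrightarrow> i < length w \<Longrightarrow> length w \<ge> 2 \<Longrightarrow> w ! i \<in> S G \<longleftrightarrow> (even i \<longleftrightarrow> hd w \<in> S G)"
    for S
  proof (intro equalityI subsetI)
    fix x assume "x \<in> g ` ?B"
    then obtain w i u where w: "w \<in> minimal_walks G" "i < length w" "x = g (w ! i)"
       "hd w = Sp u" "even i \<longleftrightarrow> u \<in> S G" by blast
    have l: "length w \<ge> 2" by (rule minimal_walk_verts(3)[OF G w(1)])
    have "hd (map g w) = u" using l w(4) by (cases w) (auto simp: g)
    thus "x \<in> S G" using ws[OF sub[OF w(1)], of i] w l by simp
  next
    fix x assume x: "x \<in> S G"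
    hence xV: "x \<in> verts G" using S by blast
    obtain e where e: "e \<in> edges G" "x \<in> e" using core_edge_at[OF G xV] .
    obtain w where w: "w \<in> minimal_walks G" "walk_edges (map g w) = thread G e"
      using walk'[OF thread_in_threads[OF e(1)]] by blast
    have "e \<in> walk_edges (map g w)" using w(2) thread_refl by simp
    hence "x \<in> set (map g w)" using walk_edges_subset e(2) by blast
    then obtain i where i: "i < length w" "x = g (w ! i)" by (auto simp: in_set_conv_nth)
    have l: "length w \<ge> 2" by (rule minimal_walk_verts(3)[OF G w(1)])
    obtain u where u: "hd w = Sp u" using minimal_walk_verts(2)[OF G w(1)] by blast
    have "hd (map g w) = u" using l u by (cases w) (auto simp: g)
    hence "even i \<longleftrightarrow> u \<in> S G" using ws[OF sub[OF w(1)], of i] i x l by simp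
    hence "w ! i \<in> ?B" using w(1) i(1) u by blast
    thus "x \<in> g ` ?B" using i(2) by blast
  qed
  have "bigraph_iso g (minimal_form G) G"
  proof (rule bigraph_isoI)
    show "inj_on g (verts (minimal_form G))" by (rule inj_on_subset[OF gi vD])
    show "lverts G = g ` lverts (minimal_form G)"
      unfolding minimal_form_simps by (rule side[of lverts], simp add: verts_def, rule walk_side(1)[OF bg])
    show "rverts G = g ` rverts (minimal_form G)"
      unfolding minimal_form_simps by (rule side[of rverts], simp add: verts_def, rule walk_side(2)[OF bg])
    have "(\<lambda>e. g ` e) ` edges (minimal_form G) = (\<Union>w\<in>minimal_walks G. walk_edges (map g w))"
      unfolding minimal_form_simps by (simp add: image_UN walk_edges_map)
    also have "\<dots> = \<Union>(threads G)"
    proof (intro equalityI subsetI)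
      fix e assume "e \<in> (\<Union>w\<in>minimal_walks G. walk_edges (map g w))"
      then obtain w where w: "w \<in> minimal_walks G" "e \<in> walk_edges (map g w)" by (rule UN_E)
      show "e \<in> \<Union>(threads G)" using walk[OF w(1)] w(2) by blast
    next
      fix e assume "e \<in> \<Union>(threads G)"
      then obtain P where P: "P \<in> threads G" "e \<in> P" by (rule UnionE)
      obtain w where "w \<in> minimal_walks G" "walk_edges (map g w) = P" using walk'[OF P(1)] by (rule bexE)
      thus "e \<in> (\<Union>w\<in>minimal_walks G. walk_edges (map g w))" using P(2) by blast
    qed
    finally show "edges G = (\<lambda>e. g ` e) ` edges (minimal_form G)" by (simp only: Union_threads)
  qed
  thus thesis by (rule that)
qed

section \<open>Replacing an edge by a path of length 3: degrees, threads, connectedness,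
  excess\<close>

section \<open>Subdivision of an edge\<close>

definition subdivide :: "'v bigraph \<Rightarrow> 'v \<Rightarrow> 'v \<Rightarrow> 'v \<Rightarrow> 'v \<Rightarrow> 'v bigraph" where
  "subdivide G u w i j = \<lparr>lverts = insert i (lverts G), rverts = insert j (rverts G),
     edges = (edges G - {{u, w}}) \<union> {{u, j}, {i, j}, {i, w}}\<rparr>"

locale subdivision =
  fixes G :: "'v bigraph" and u w i j :: 'v
  assumes bg: "bigraph G" and uL: "u \<in> lverts G" and wR: "w \<in> rverts G" and uw: "{u, w} \<in> edges G"
    and iV: "i \<notin> verts G" and jV: "j \<notin> verts G" and ij: "i \<noteq> j"
begin

abbreviation "H \<equiv> subdivide G u w i j"
abbreviation "new \<equiv> {{u, j}, {i, j}, {i, w}}"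

text \<open>The edge map that undoes the subdivision. \<open>expand\<close> takes preimages under
  it, in the form that \<open>threads_transfer\<close> provides.\<close>

definition pr :: "'v set \<Rightarrow> 'v set" where
  "pr e = (if e \<in> new then {u, w} else e)"

definition expand :: "'v set set \<Rightarrow> 'v set set" where
  "expand P = {e \<in> edges H. pr e \<in> P}"

lemma H_simps:
  "lverts H = insert i (lverts G)" "rverts H = insert j (rverts G)"
  "edges H = (edges G - {{u, w}}) \<union> new" "verts H = insert i (insert j (verts G))"
  by (auto simp: subdivide_def verts_def)

lemma uw_verts: "u \<in> verts G" "w \<in> verts G" "u \<noteq> w" "u \<noteq> i" "u \<noteq> j" "w \<noteq> i" "w \<noteq> j"
  using uL wR iV jV bigraphD(3)[OF bg] by (auto simp: verts_def)

lemma new_not_edge: "e \<in> new \<Longrightarrow> e \<notin> edges G"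
  using edge_subset_verts[OF bg, of e] iV jV by auto

lemma card_new: "card new = 3"
  using uw_verts ij by (auto simp: doubleton_eq_iff)

lemma bigraph_H: "bigraph H"
proof -
  have 1: "e \<in> {{a, b} | a b. a \<in> lverts G \<and> b \<in> rverts G}" if "e \<in> edges G" for e
    using bg that unfolding bigraph_def by blast
  have "edges H \<subseteq> {{a, b} | a b. a \<in> lverts H \<and> b \<in> rverts H}"
  proof
    fix e assume "e \<in> edges H"
    hence "e \<in> edges G \<or> e = {u, j} \<or> e = {i, j} \<or> e = {i, w}" by (auto simp: H_simps)
    thus "e \<in> {{a, b} | a b. a \<in> lverts H \<and> b \<in> rverts H}"
    proof (elim disjE)
      assume "e \<in> edges G"
      from 1[OF this] show ?thesis unfolding H_simps by blast
    qed (use uL wR in \<open>auto simp: H_simps\<close>)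
  qed
  moreover have "lverts H \<inter> rverts H = {}"
    using bigraphD(3)[OF bg] iV jV ij by (auto simp: H_simps verts_def)
  ultimately show ?thesis using bigraphD(1,2)[OF bg] unfolding bigraph_def by (simp add: H_simps(1,2))
qed

lemma card_edges_H: "card (edges H) = card (edges G) + 2"
proof -
  have "card (edges H) = card (edges G - {{u, w}}) + card new"
    unfolding H_simps by (rule card_Un_disjoint) (use finite_edges[OF bg] new_not_edge in auto)
  moreover have "card (edges G) > 0" using uw finite_edges[OF bg] by (auto simp: card_gt_0_iff)
  ultimately show ?thesis using uw card_new by (simp add: card_Diff_singleton)
qed

lemma card_verts_H: "card (verts H) = card (verts G) + 2"
  using iV jV ij bigraphD(4)[OF bg] by (simp add: H_simps(4))

lemma betti_H: "betti H = betti G"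
  by (simp add: betti_def card_edges_H card_verts_H)

lemma deg_new: "deg H i = 2" "deg H j = 2"
proof -
  have "{e \<in> edges H. i \<in> e} = {{i, j}, {i, w}}" "{e \<in> edges H. j \<in> e} = {{u, j}, {i, j}}"
    using edge_subset_verts[OF bg] iV jV uw_verts ij by (auto simp: H_simps)
  thus "deg H i = 2" "deg H j = 2" using uw_verts ij by (auto simp: deg_def doubleton_eq_iff)
qed

text \<open>At \<open>u\<close> and at \<open>w\<close> the deleted edge is exchanged for exactly
  one new edge; every other old vertex keeps its edges.\<close>

lemma deg_old:
  assumes v: "v \<in> verts G"
  shows "deg H v = deg G v"
proof -
  have vij: "v \<noteq> i" "v \<noteq> j" using v iV jV by auto
  let ?E = "\<lambda>v. {e \<in> edges G. v \<in> e}"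
  have fin: "finite (?E v)" using finite_edges[OF bg] by simp
  have swap: "card (insert f (?E v - {{u, w}})) = card (?E v)" if "f \<in> new" "v \<in> {u, w}" for f
  proof -
    have "{u, w} \<in> ?E v" using uw that by blast
    moreover have "f \<notin> ?E v" using new_not_edge[OF that(1)] by simp
    ultimately show ?thesis using fin card_Suc_Diff1[of "?E v" "{u, w}"] by (simp del: mem_Collect_eq)
  qed
  have mem: "e \<in> edges H \<longleftrightarrow> e \<in> edges G \<and> e \<noteq> {u, w} \<or> e \<in> new" for e
    unfolding H_simps by blast
  have only: "{e \<in> edges H. v \<in> e} = insert f (?E v - {{u, w}})"
    if "f \<in> new" "v \<in> f" "\<And>g. g \<in> new \<Longrightarrow> v \<in> g \<Longrightarrow> g = f" for f
  proof (intro equalityI subsetI)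
    fix e assume "e \<in> {e \<in> edges H. v \<in> e}"
    thus "e \<in> insert f (?E v - {{u, w}})" using mem[of e] that(3)[of e] by blast
  next
    fix e assume "e \<in> insert f (?E v - {{u, w}})"
    thus "e \<in> {e \<in> edges H. v \<in> e}" using mem[of e] that(1,2) by blast
  qed
  consider "v = u" | "v = w" | "v \<notin> {u, w}" by blast
  thus ?thesis
  proof cases
    case 1
    have "{e \<in> edges H. v \<in> e} = insert {u, j} (?E v - {{u, w}})"
      by (rule only) (use 1 uw_verts vij in auto)
    moreover have "card (insert {u, j} (?E v - {{u, w}})) = card (?E v)"
      by (rule swap) (simp_all add: 1)
    ultimately show ?thesis by (simp only: deg_def)
  next
    case 2
    have "{e \<in> edges H. v \<in> e} = insert {i, w} (?E v - {{u, w}})"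
      by (rule only) (use 2 uw_verts vij in auto)
    moreover have "card (insert {i, w} (?E v - {{u, w}})) = card (?E v)"
      by (rule swap) (simp_all add: 2)
    ultimately show ?thesis by (simp only: deg_def)
  next
    case 3
    have "v \<notin> g" if "g \<in> new" for g using that 3 vij by auto
    hence "e \<in> edges H \<and> v \<in> e \<longleftrightarrow> e \<in> edges G \<and> v \<in> e" for e
      using mem[of e] 3 by blast
    thus ?thesis by (simp only: deg_def)
  qed
qed

lemma special_H: "special H v \<longleftrightarrow> special G v"
proof (cases "v \<in> verts G")
  case True
  thus ?thesis using deg_old by (auto simp: special_def H_simps(4))
next
  case False
  thus ?thesis using deg_new by (auto simp: special_def H_simps(4))
qed

lemma normal_H: "normal H v \<longleftrightarrow> normal G v \<or> v = i \<or> v = j"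
proof (cases "v \<in> verts G")
  case True
  thus ?thesis using deg_old iV jV by (auto simp: normal_def H_simps(4))
next
  case False
  thus ?thesis using deg_new by (auto simp: normal_def H_simps(4))
qed

lemma pr_incident: "e \<in> edges H \<Longrightarrow> v \<in> e \<Longrightarrow> v \<in> verts G \<Longrightarrow> v \<in> pr e"
  using iV jV by (auto simp: pr_def H_simps)

lemma pr_lift:
  assumes "e \<in> edges G" "v \<in> e"
  obtains f where "f \<in> edges H" "pr f = e" "v \<in> f"
proof (cases "e = {u, w}")
  case True
  show thesis
  proof (cases "v = u")
    case True
    thus thesis using that[of "{u, j}"] \<open>e = {u, w}\<close> by (auto simp: H_simps pr_def)
  next
    case False
    thus thesis using that[of "{i, w}"] \<open>e = {u, w}\<close> assms by (auto simp: H_simps pr_def)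
  qed
next
  case False
  have "e \<notin> new" using new_not_edge assms by blast
  thus thesis using that[of e] False assms unfolding H_simps pr_def by simp
qed

lemma pr_image: "pr ` edges H = edges G"
proof (intro equalityI subsetI)
  fix e assume "e \<in> pr ` edges H"
  thus "e \<in> edges G" using uw by (auto simp: pr_def H_simps)
next
  fix e assume e: "e \<in> edges G"
  then obtain v where "v \<in> e" using edgeE[OF bg e] by blast
  from pr_lift[OF e this] show "e \<in> pr ` edges H" by blast
qed

lemma new_linked:
  assumes "e \<in> new" "f \<in> new"
  shows "(e, f) \<in> (link H)\<^sup>*"
proof -
  have l: "({u, j}, {i, j}) \<in> link H" "({i, j}, {u, j}) \<in> link H"
    "({i, j}, {i, w}) \<in> link H" "({i, w}, {i, j}) \<in> link H"
    unfolding link_def using normal_H by (auto simp: H_simps)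
  have to: "(e, {i, j}) \<in> (link H)\<^sup>*" "({i, j}, e) \<in> (link H)\<^sup>*" if "e \<in> new" for e
    using that l by (auto intro: r_into_rtrancl)
  show ?thesis using to(1)[OF assms(1)] to(2)[OF assms(2)] by (rule rtrancl_trans)
qed

lemma pr_eq_linked:
  assumes "pr e = pr f" "e \<in> edges H" "f \<in> edges H"
  shows "(e, f) \<in> (link H)\<^sup>*"
proof -
  have "{u, w} \<notin> new" using new_not_edge uw by blast
  hence "{u, w} \<notin> edges H" unfolding H_simps by simp
  hence "e \<in> new \<and> f \<in> new \<or> e = f" using assms unfolding pr_def by metis
  thus ?thesis using new_linked by blast
qed

text \<open>A link through an old normal point projects to a link, and one through \<open>i\<close>
  or \<open>j\<close> joins two new edges, which project to the same edge. Links of \<open>G\<close>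
  lift because every edge at an old vertex has a lift at that vertex.\<close>

lemma bij_expand: "bij_betw expand (threads G) (threads H)"
  and thread_expand: "e \<in> edges H \<Longrightarrow> expand (thread G (pr e)) = thread H e"
proof -
  have l1: "(pr e, pr f) \<in> (link G)\<^sup>*" if "(e, f) \<in> link H" for e f
  proof -
    obtain x where x: "e \<in> edges H" "f \<in> edges H" "normal H x" "x \<in> e" "x \<in> f"
      using \<open>(e, f) \<in> link H\<close> by (auto simp: link_def)
    have pe: "pr e \<in> edges G" "pr f \<in> edges G" using pr_image x(1,2) by blast+
    show ?thesis
    proof (cases "x \<in> verts G")
      case True
      have "normal G x" using x(3) True normal_H iV jV by blast
      hence "(pr e, pr f) \<in> link G"
        unfolding link_def using pe pr_incident[OF x(1,4) True] pr_incident[OF x(2,5) True] by blast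
      thus ?thesis by blast
    next
      case False
      have "g \<in> new" if "g \<in> edges H" "x \<in> g" for g
        using that False edge_subset_verts[OF bg, of g] unfolding H_simps by blast
      hence "pr e = pr f" using x by (simp add: pr_def)
      thus ?thesis by simp
    qed
  qed
  have l2: "(e, f) \<in> (link H)\<^sup>*" if l: "(pr e, pr f) \<in> link G" and e: "e \<in> edges H" and f: "f \<in> edges H" for e f
  proof -
    obtain x where x: "pr e \<in> edges G" "pr f \<in> edges G" "normal G x" "x \<in> pr e" "x \<in> pr f"
      using l by (auto simp: link_def)
    obtain e' where e': "e' \<in> edges H" "pr e' = pr e" "x \<in> e'" by (rule pr_lift[OF x(1,4)])
    obtain f' where f': "f' \<in> edges H" "pr f' = pr f" "x \<in> f'" by (rule pr_lift[OF x(2,5)])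
    have "(e', f') \<in> link H" unfolding link_def using e' f' x(3) normal_H by blast
    thus ?thesis using pr_eq_linked[OF e'(2)[symmetric] e e'(1)] pr_eq_linked[OF f'(2) f'(1) f]
      by (meson r_into_rtrancl rtrancl_trans)
  qed
  have ex: "(\<lambda>P. {e \<in> edges H. pr e \<in> P}) = expand" by (simp add: expand_def fun_eq_iff)
  show "bij_betw expand (threads G) (threads H)"
    using threads_transfer(1)[OF pr_image l1 l2 pr_eq_linked] unfolding ex by blast
  show "expand (thread G (pr e)) = thread H e" if "e \<in> edges H"
    using threads_transfer(2)[OF pr_image l1 l2 pr_eq_linked that] unfolding expand_def by blast
qed

lemma expand_eq:
  assumes "P \<subseteq> edges G"
  shows "expand P = (if {u, w} \<in> P then (P - {{u, w}}) \<union> new else P)"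
proof -
  have nP: "e \<notin> new" if "e \<in> P" for e using new_not_edge that assms by blast
  show ?thesis
  proof (cases "{u, w} \<in> P")
    case True
    have "expand P = {e \<in> edges H. e \<in> new \<or> e \<in> P}"
      unfolding expand_def pr_def using True by (intro Collect_cong conj_cong refl) (simp split: if_split)
    also have "\<dots> = (P - {{u, w}}) \<union> new"
      unfolding H_simps using assms nP[OF True] by blast
    finally show ?thesis using True by simp
  next
    case False
    have "expand P = {e \<in> edges H. e \<notin> new \<and> e \<in> P}"
      unfolding expand_def pr_def using False by (intro Collect_cong conj_cong refl) (simp split: if_split)
    also have "\<dots> = P" unfolding H_simps using assms nP False by blast
    finally show ?thesis using False by simp
  qed
qed

lemma card_expand:
  assumes "P \<subseteq> edges G"
  shows "card (expand P) = card P + (if {u, w} \<in> P then 2 else 0)"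
proof (cases "{u, w} \<in> P")
  case True
  have fin: "finite P" using assms finite_edges[OF bg] finite_subset by blast
  have "card ((P - {{u, w}}) \<union> new) = card (P - {{u, w}}) + card new"
    by (rule card_Un_disjoint) (use fin assms new_not_edge in auto)
  moreover have "card P > 0" using True fin by (auto simp: card_gt_0_iff)
  ultimately show ?thesis using True card_new by (simp add: expand_eq[OF assms] card_Diff_singleton)
qed (simp add: expand_eq[OF assms])

lemma threads_subset_edges: "P \<in> threads G \<Longrightarrow> P \<subseteq> edges G"
  using threads_edge by blast

lemma ends_expand:
  assumes P: "P \<in> threads G"
  shows "ends H (expand P) = ends G P"
proof -
  have "v \<in> \<Union>(expand P) \<longleftrightarrow> v \<in> \<Union>P" if v: "v \<in> verts G" for v
  proof
    assume "v \<in> \<Union>(expand P)"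
    then obtain e where "e \<in> edges H" "pr e \<in> P" "v \<in> e" unfolding expand_def by blast
    thus "v \<in> \<Union>P" using pr_incident v by blast
  next
    assume "v \<in> \<Union>P"
    then obtain e where e: "e \<in> P" "v \<in> e" by blast
    obtain f where "f \<in> edges H" "pr f = e" "v \<in> f"
      using pr_lift e threads_subset_edges[OF P] by blast
    thus "v \<in> \<Union>(expand P)" unfolding expand_def using e by blast
  qed
  moreover have "special G v \<Longrightarrow> v \<in> verts G" for v by (simp add: special_def)
  ultimately show ?thesis unfolding ends_def special_H by blast
qed

lemma connected_iff: "connected_bigraph H \<longleftrightarrow> connected_bigraph G"
proof
  let ?R = "\<lambda>a b. {a, b} \<in> edges G" and ?S = "\<lambda>a b. {a, b} \<in> edges H"
  have nb: "?S u j" "?S j u" "?S j i" "?S i j" "?S i w" "?S w i"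
    by (auto simp: H_simps insert_commute)
  have uw': "?S\<^sup>*\<^sup>* u w" "?S\<^sup>*\<^sup>* w u"
    using nb by (meson converse_rtranclp_into_rtranclp rtranclp.rtrancl_refl)+
  assume con: "connected_bigraph G"
  have lift: "?S\<^sup>*\<^sup>* a b" if "?R\<^sup>*\<^sup>* a b" for a b
    using that
  proof induction
    case (step b c)
    have "?S\<^sup>*\<^sup>* b c"
    proof (cases "{b, c} = {u, w}")
      case True
      hence "b = u \<and> c = w \<or> b = w \<and> c = u" by (auto simp: doubleton_eq_iff)
      thus ?thesis using uw' by blast
    next
      case False
      hence "?S b c" using step(2) by (simp add: H_simps)
      thus ?thesis by blast
    qed
    with step.IH show ?case by (rule rtranclp_trans)
  qed auto
  have to_u: "?S\<^sup>*\<^sup>* a u \<and> ?S\<^sup>*\<^sup>* u a" if "a \<in> verts H" for a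
  proof -
    consider "a \<in> verts G" | "a = i" | "a = j" using \<open>a \<in> verts H\<close> by (auto simp: H_simps)
    thus ?thesis
    proof cases
      case 1
      thus ?thesis using con uw_verts lift by (auto simp: connected_bigraph_def)
    next
      case 2
      thus ?thesis using nb by (meson converse_rtranclp_into_rtranclp rtranclp.rtrancl_refl)
    next
      case 3
      thus ?thesis using nb by blast
    qed
  qed
  show "connected_bigraph H"
    unfolding connected_bigraph_def using to_u uw_verts by (auto simp: H_simps(4) intro: rtranclp_trans)
next
  let ?R = "\<lambda>a b. {a, b} \<in> edges G" and ?S = "\<lambda>a b. {a, b} \<in> edges H"
  assume con: "connected_bigraph H"
  \<comment> \<open>Each new vertex goes to its old neighbour, so that {i, w} and {u, j} collapse to
    points and {i, j} becomes the old edge.\<close>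
  define h where "h a = (if a = i then w else if a = j then u else a)" for a
  have step: "?R\<^sup>*\<^sup>* (h a) (h b)" if "?S a b" for a b
  proof -
    have uw': "?R u w" "?R w u" using uw by (auto simp: insert_commute)
    from that consider "{a, b} \<in> edges G" | "{a, b} \<in> new" unfolding H_simps by blast
    thus ?thesis
    proof cases
      case 1
      hence "a \<in> verts G" "b \<in> verts G" using edge_subset_verts[OF bg] by auto
      hence "h a = a" "h b = b" using iV jV by (auto simp: h_def)
      thus ?thesis using 1 by auto
    next
      case 2
      thus ?thesis using uw' uw_verts ij by (auto simp: h_def doubleton_eq_iff)
    qed
  qed
  have "?R\<^sup>*\<^sup>* (h a) (h b)" if "?S\<^sup>*\<^sup>* a b" for a b
    using that
  proof induction
    case (step b c)
    thus ?case using \<open>\<And>a b. ?S a b \<Longrightarrow> ?R\<^sup>*\<^sup>* (h a) (h b)\<close>[OF step(2)] by (meson rtranclp_trans)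
  qed auto
  moreover have "h a = a" if "a \<in> verts G" for a using that iV jV by (auto simp: h_def)
  ultimately have "?R\<^sup>*\<^sup>* a b" if "a \<in> verts G" "b \<in> verts G" for a b
    using con that unfolding connected_bigraph_def H_simps(4) by (metis insertI2)
  thus "connected_bigraph G" using uw_verts by (auto simp: connected_bigraph_def)
qed

lemma core_iff: "core H \<longleftrightarrow> core G"
proof -
  have "(\<forall>v\<in>verts H. deg H v \<ge> 2) \<longleftrightarrow> (\<forall>v\<in>verts G. deg G v \<ge> 2)"
    unfolding H_simps(4) using deg_new deg_old by auto
  thus ?thesis unfolding core_def special_H connected_iff using bg bigraph_H by simp
qed

lemma card_parallels_expand:
  assumes "P \<in> threads G"
  shows "card (parallels H (expand P)) = card (parallels G P)"
  by (rule card_parallels_transfer[of id, OF _ bij_expand _ assms]) (simp_all add: ends_expand)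

text \<open>Ends and parities are unchanged. Only the thread of {u, w} can cease to have length 1,
  and if it had length 1 and parallel threads, it would have been a delta edge.\<close>

lemma homeo_subdivide:
  assumes G: "core G" and nd: "\<not> dthread G (thread G {u, w})"
  shows "homeo id expand G H"
proof (rule homeoI[OF _ _ _ _ bij_expand _ _ _ bg])
  fix P assume P: "P \<in> threads G"
  show "ends H (expand P) = id ` ends G P" using ends_expand[OF P] by simp
  show "even (card (expand P)) \<longleftrightarrow> even (card P)" using card_expand[OF threads_subset_edges[OF P]] by simp
  assume par: "card (parallels G P) \<noteq> 1"
  show "card (expand P) = 1 \<longleftrightarrow> card P = 1"
  proof (cases "{u, w} \<in> P")
    case True
    hence PT: "P = thread G {u, w}" using threads_edge[OF P] by blast
    have "card P \<noteq> 1"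
    proof
      assume c: "card P = 1"
      hence "odd (card P)" by simp
      note odd = this
      obtain a b where ab: "ends G P = {a, b}" "a \<noteq> b" by (rule odd_thread_ends[OF G P odd], rule that)
      have "card (parallels G P) > 1" using par card_parallels(1)[OF bg P] by linarith
      hence "dthread G P" using c ab by (simp add: dthread_def)
      thus False using nd PT by simp
    qed
    thus ?thesis using True card_expand[OF threads_subset_edges[OF P]] by simp
  next
    case False
    thus ?thesis using card_expand[OF threads_subset_edges[OF P]] by simp
  qed
next
  fix v assume "special G v"
  hence "v \<in> verts G" by (simp add: special_def)
  thus "id v \<in> lverts H \<longleftrightarrow> v \<in> lverts G" "id v \<in> rverts H \<longleftrightarrow> v \<in> rverts G"
    using iV jV by (auto simp: H_simps)
qed (simp_all add: special_H)

lemma excess_expand: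
  assumes G: "core G" and nd: "\<not> dthread G (thread G {u, w})" and P: "P \<in> threads G"
  shows "excess H (expand P) = excess G P + (if {u, w} \<in> P then 1 else 0)"
proof -
  have E: "expand P \<in> threads H" using bij_expand P by (auto simp: bij_betw_def)
  have "base H (expand P) = base G P" using homeo_subdivide[OF G nd] P by (simp add: homeo_def)
  hence "base G P + 2 * excess H (expand P) = card P + (if {u, w} \<in> P then 2 else 0)"
    using card_eq_base_excess[OF _ E] G core_iff card_expand[OF threads_subset_edges[OF P]] by simp
  thus ?thesis using card_eq_base_excess[OF G P] by (auto split: if_splits)
qed

lemma total_excess_subdivide:
  assumes G: "core G" and nd: "\<not> dthread G (thread G {u, w})"
  shows "total_excess H = total_excess G + 1"
proof -
  let ?T = "thread G {u, w}"
  have T: "?T \<in> threads G" using uw by (rule thread_in_threads)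
  have mem: "{u, w} \<in> P \<longleftrightarrow> P = ?T" if "P \<in> threads G" for P
    using threads_edge[OF that] thread_refl by metis
  have "total_excess H = (\<Sum>P\<in>threads G. excess H (expand P))"
    unfolding total_excess_def by (rule sum.reindex_bij_betw[OF bij_expand, symmetric])
  also have "\<dots> = (\<Sum>P\<in>threads G. excess G P + (if P = ?T then 1 else 0))"
    by (intro sum.cong refl) (simp add: excess_expand[OF G nd] mem)
  also have "\<dots> = total_excess G + 1"
    using T finite_threads[OF bg] by (simp add: sum.distrib total_excess_def)
  finally show ?thesis .
qed

lemma thread_new: "thread H {i, j} = expand (thread G {u, w})"
proof -
  have "{i, j} \<in> edges H" "pr {i, j} = {u, w}" by (auto simp: H_simps pr_def)
  thus ?thesis using thread_expand[of "{i, j}"] by simp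
qed

end

section \<open>Inverting a subdivision, and reduction to excess 0\<close>

section \<open>Contraction\<close>

lemma card_two_other:
  assumes "card A = 2" "a \<in> A"
  obtains b where "b \<noteq> a" "A = {a, b}"
proof -
  obtain p q where pq: "A = {p, q}" "p \<noteq> q" using assms(1) by (meson card_2_iff)
  hence "a = p \<or> a = q" using assms(2) by simp
  thus thesis using that[of p] that[of q] pq by (auto simp: insert_commute)
qed

lemma edge_sides:
  assumes "bigraph G" "{a, b} \<in> edges G"
  shows "a \<in> lverts G \<Longrightarrow> b \<in> rverts G" "a \<in> rverts G \<Longrightarrow> b \<in> lverts G" "a \<noteq> b"
  using edgeE[OF assms] bigraphD(3)[OF assms(1)] by (auto simp: doubleton_eq_iff)

lemma normal_other_neighbour:
  assumes G: "bigraph G" and n: "normal G x" and e: "{x, y} \<in> edges G"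
  obtains z where "z \<noteq> y" "{x, z} \<in> edges G" "{f \<in> edges G. x \<in> f} = {{x, y}, {x, z}}"
proof -
  have "card {f \<in> edges G. x \<in> f} = 2" using n by (simp add: normal_def deg_def)
  moreover have "{x, y} \<in> {f \<in> edges G. x \<in> f}" using e by simp
  ultimately obtain g where g: "g \<noteq> {x, y}" "{f \<in> edges G. x \<in> f} = {{x, y}, g}"
    by (rule card_two_other)
  have gE: "g \<in> {f \<in> edges G. x \<in> f}" unfolding g(2) by simp
  hence gE': "g \<in> edges G" "x \<in> g" by simp_all
  obtain a b where ab: "g = {a, b}" by (rule edgeE[OF G gE'(1)], rule that)
  have "a = x \<or> b = x" using gE'(2) ab by auto
  then obtain z where z: "g = {x, z}" using ab by auto
  show thesis by (rule that[of z]) (use g gE' z in auto)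
qed

lemma thread_subset_closed:
  assumes "e \<in> A" "\<And>f g. f \<in> A \<Longrightarrow> (f, g) \<in> link G \<Longrightarrow> g \<in> A"
  shows "thread G e \<subseteq> A"
proof
  fix f assume "f \<in> thread G e"
  hence "(e, f) \<in> (link G)\<^sup>*" by (simp add: thread_def)
  thus "f \<in> A" by induction (use assms in auto)
qed

lemma link_thread: "(e, f) \<in> link G \<Longrightarrow> f \<in> thread G e"
  by (auto simp: thread_def)

text \<open>If the two end points of the contracted path were adjacent, the path would belong to an
  alpha cycle of length 4, or be a delta path of length 3: these have excess 0.\<close>

lemma contraction_not_adjacent:
  assumes H: "core H" and ij: "{i, j} \<in> edges H" and n: "normal H i" "normal H j"
    and ex: "excess H (thread H {i, j}) > 0"
    and inc_i: "{f \<in> edges H. i \<in> f} = {{i, j}, {i, w}}"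
    and inc_j: "{f \<in> edges H. j \<in> f} = {{j, i}, {j, u}}"
    and d: "i \<noteq> u" "j \<noteq> w"
  shows "{u, w} \<notin> edges H"
proof
  assume uw: "{u, w} \<in> edges H"
  note bg = coreD(1)[OF H]
  let ?P = "thread H {i, j}"
  have P: "?P \<in> threads H" by (rule thread_in_threads[OF ij])
  have ii: "f = {i, j} \<or> f = {i, w}" if "f \<in> edges H" "i \<in> f" for f
  proof -
    have "f \<in> {f \<in> edges H. i \<in> f}" using that by simp
    thus ?thesis unfolding inc_i by simp
  qed
  have jj: "f = {i, j} \<or> f = {j, u}" if "f \<in> edges H" "j \<in> f" for f
  proof -
    have "f \<in> {f \<in> edges H. j \<in> f}" using that by simp
    thus ?thesis unfolding inc_j by (auto simp: insert_commute)
  qed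
  have iw: "{i, w} \<in> edges H"
  proof -
    have "{i, w} \<in> {f \<in> edges H. i \<in> f}" unfolding inc_i by simp
    thus ?thesis by simp
  qed
  have ju: "{j, u} \<in> edges H"
  proof -
    have "{j, u} \<in> {f \<in> edges H. j \<in> f}" unfolding inc_j by simp
    thus ?thesis by simp
  qed
  have V: "u \<in> verts H" "w \<in> verts H" using edge_subset_verts[OF bg uw] by auto
  have ne: "i \<noteq> j" "u \<noteq> w" "i \<noteq> w" "j \<noteq> u"
    using edge_sides(3)[OF bg ij] edge_sides(3)[OF bg uw] edge_sides(3)[OF bg iw] edge_sides(3)[OF bg ju] by auto
  have cP: "card ?P = base H ?P + 2 * excess H ?P" by (rule card_eq_base_excess[OF H P])
  have bp: "base H ?P \<ge> 1" by (simp add: base_def)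
  have inP: "{i, w} \<in> ?P" "{j, u} \<in> ?P" "{i, j} \<in> ?P"
  proof -
    have "({i, j}, {i, w}) \<in> link H" "({i, j}, {j, u}) \<in> link H"
      using ij iw ju n unfolding link_def by auto
    thus "{i, w} \<in> ?P" "{j, u} \<in> ?P" by (auto intro: link_thread)
    show "{i, j} \<in> ?P" by (rule thread_refl)
  qed
  let ?S = "{{i, j}, {i, w}, {j, u}, {u, w}}"
  show False
  proof (cases "special H u \<and> special H w")
    \<comment> \<open>The thread lies in the three edges at \<open>i\<close> and \<open>j\<close>,
      so positive excess forces length 3 and \<open>base\<close> 1. But {u, w} is then a parallel
      thread, in whose presence \<open>base\<close> would be 3.\<close>
    case True
    hence nuw: "\<not> normal H u" "\<not> normal H w" by (auto dest: normal_not_special)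
    let ?S3 = "{{i, j}, {i, w}, {j, u}}"
    have "?P \<subseteq> ?S3"
    proof (rule thread_subset_closed)
      fix f g assume f: "f \<in> ?S3" and "(f, g) \<in> link H"
      then obtain x where x: "g \<in> edges H" "normal H x" "x \<in> f" "x \<in> g" by (auto simp: link_def)
      have "x = i \<or> x = j" using f x(2,3) nuw by auto
      thus "g \<in> ?S3" using ii[OF x(1)] jj[OF x(1)] x(4) by blast
    qed simp
    hence "card ?P \<le> card ?S3" by (intro card_mono) auto
    moreover have "card ?S3 \<le> 3" by (simp add: card_insert_if)
    ultimately have c3: "card ?P \<le> 3" by linarith
    hence b1: "base H ?P = 1" using cP ex bp by linarith
    hence cp3: "card ?P \<ge> 3" using cP ex by linarith
    have c1: "card (parallels H ?P) = 1"
    proof (rule ccontr)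
      assume "card (parallels H ?P) \<noteq> 1"
      hence "base H ?P \<noteq> 1" using cp3 by (simp add: base_def)
      thus False using b1 by simp
    qed
    let ?Q = "thread H {u, w}"
    have Q: "?Q \<in> threads H" by (rule thread_in_threads[OF uw])
    have "?Q \<subseteq> {{u, w}}"
      by (rule thread_subset_closed) (use nuw in \<open>auto simp: link_def\<close>)
    hence Qe: "?Q = {{u, w}}" using thread_refl[of "{u, w}" H] by blast
    have eQ: "ends H ?Q = {u, w}" unfolding Qe ends_def using True by auto
    have "\<Union>?P \<subseteq> {i, j, u, w}" using \<open>?P \<subseteq> ?S3\<close> by fastforce
    hence "ends H ?P \<subseteq> {u, w}" using n by (auto simp: ends_def dest: normal_not_special)
    moreover have "{u, w} \<subseteq> ends H ?P" unfolding ends_def using inP True by auto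
    ultimately have eP: "ends H ?P = {u, w}" by blast
    have "{?P, ?Q} \<subseteq> parallels H ?P" using P Q eP eQ by (simp add: parallels_def)
    hence "card {?P, ?Q} \<le> 1" using c1 card_mono[OF card_parallels(2)[OF bg P]] by metis
    hence "?P = ?Q" by (auto simp: card_insert_if split: if_splits)
    hence "{i, j} = {u, w}" using Qe inP(3) by auto
    thus False using d ne by (auto simp: doubleton_eq_iff)
  next
    case False
    have uu: "f = {j, u} \<or> f = {u, w}" if "normal H u" "f \<in> edges H" "u \<in> f" for f
    proof -
      have eq: "{g \<in> edges H. u \<in> g} = {{j, u}, {u, w}}"
        by (rule normal_edges_eq[OF bg that(1) ju uw]) (use d in \<open>auto simp: doubleton_eq_iff\<close>)
      have "f \<in> {g \<in> edges H. u \<in> g}" using that by simp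
      thus ?thesis unfolding eq by simp
    qed
    have ww: "f = {i, w} \<or> f = {u, w}" if "normal H w" "f \<in> edges H" "w \<in> f" for f
    proof -
      have eq: "{g \<in> edges H. w \<in> g} = {{i, w}, {u, w}}"
        by (rule normal_edges_eq[OF bg that(1) iw uw]) (use d in \<open>auto simp: doubleton_eq_iff\<close>)
      have "f \<in> {g \<in> edges H. w \<in> g}" using that by simp
      thus ?thesis unfolding eq by simp
    qed
    have PS: "?P \<subseteq> ?S"
    proof (rule thread_subset_closed)
      fix f g assume f: "f \<in> ?S" and "(f, g) \<in> link H"
      then obtain x where x: "g \<in> edges H" "normal H x" "x \<in> f" "x \<in> g" by (auto simp: link_def)
      have "x = i \<or> x = j \<or> x = u \<or> x = w" using f x(3) by auto
      hence "g = {i, j} \<or> g = {i, w} \<or> g = {j, u} \<or> g = {u, w}"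
      proof (elim disjE)
        assume "x = i" thus ?thesis using ii[OF x(1)] x(4) by auto
      next
        assume "x = j" thus ?thesis using jj[OF x(1)] x(4) by auto
      next
        assume "x = u" thus ?thesis using uu[OF _ x(1)] x(2,4) by auto
      next
        assume "x = w" thus ?thesis using ww[OF _ x(1)] x(2,4) by auto
      qed
      thus "g \<in> ?S" by simp
    qed simp
    hence "card ?P \<le> card ?S" by (intro card_mono) auto
    moreover have "card ?S \<le> 4" by (simp add: card_insert_if)
    ultimately have c4: "card ?P \<le> 4" by linarith
    show False
    proof (cases "special H u \<or> special H w")
      \<comment> \<open>The thread closes at the only special point of the 4-cycle, so
        \<open>base\<close> is 4, and at most four edges leave no excess.\<close>
      case True
      have "\<Union>?P \<subseteq> {i, j, u, w}" using PS by fastforce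
      hence "ends H ?P \<subseteq> {u, w}" using n by (auto simp: ends_def dest: normal_not_special)
      moreover have "\<not> ({u, w} \<subseteq> ends H ?P)" using False unfolding ends_def by blast
      ultimately have "ends H ?P \<subset> {u, w}" by blast
      hence "card (ends H ?P) < card {u, w}" by (intro psubset_card_mono) auto
      hence "card (ends H ?P) = 1" using card_ends[OF H P] ne(2) by auto
      hence "base H ?P = 4" by (simp add: base_def)
      thus False using cP ex c4 by linarith
    next
      \<comment> \<open>The 4-cycle would be a whole component without special points.\<close>
      case ns: False
      have nn: "normal H u" "normal H w" using core_cases[OF H] V ns by blast+
      show False
      proof (rule no_special_component[OF H, of u "{i, j, u, w}"])
        show "\<forall>y\<in>{i, j, u, w}. \<not> special H y" using n nn by (auto dest: normal_not_special)
        show "f \<subseteq> {i, j, u, w}" if "y \<in> {i, j, u, w}" "f \<in> edges H" "y \<in> f" for y f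
          using that ii[OF that(2)] jj[OF that(2)] uu[OF nn(1) that(2)] ww[OF nn(2) that(2)] by auto
      qed (use V in auto)
    qed
  qed
qed

text \<open>Positive excess is used twice: it makes \<open>u\<close> and \<open>w\<close>
  non-adjacent, so that the new edge does not duplicate an old one, and it prevents the contracted
  thread from becoming a delta edge.\<close>

lemma contraction:
  assumes H: "core H" and iL: "i \<in> lverts H" and jR: "j \<in> rverts H" and ij: "{i, j} \<in> edges H"
    and n: "normal H i" "normal H j" and ex: "excess H (thread H {i, j}) > 0"
  obtains G u w where "subdivision G u w i j" "H = subdivide G u w i j" "core G"
    "\<not> dthread G (thread G {u, w})"
proof -
  note bg = coreD(1)[OF H]
  obtain w where w: "w \<noteq> j" "{i, w} \<in> edges H" "{f \<in> edges H. i \<in> f} = {{i, j}, {i, w}}"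
    by (rule normal_other_neighbour[OF bg n(1) ij])
  have ji: "{j, i} \<in> edges H" using ij by (simp add: insert_commute)
  obtain u where u: "u \<noteq> i" "{j, u} \<in> edges H" "{f \<in> edges H. j \<in> f} = {{j, i}, {j, u}}"
    by (rule normal_other_neighbour[OF bg n(2) ji])
  have uw: "{u, w} \<notin> edges H"
    by (rule contraction_not_adjacent[OF H ij n ex w(3) u(3)]) (use u(1) w(1) in auto)
  have wR: "w \<in> rverts H" by (rule edge_sides(1)[OF bg w(2) iL])
  have uL: "u \<in> lverts H" by (rule edge_sides(2)[OF bg u(2) jR])
  have dis: "lverts H \<inter> rverts H = {}" by (rule bigraphD(3)[OF bg])
  let ?new = "{{u, j}, {i, j}, {i, w}}"
  define G where "G = \<lparr>lverts = lverts H - {i}, rverts = rverts H - {j}, edges = insert {u, w} (edges H - ?new)\<rparr>"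
  have G_simps: "lverts G = lverts H - {i}" "rverts G = rverts H - {j}"
    "edges G = insert {u, w} (edges H - ?new)" by (simp_all add: G_def)
  have new: "?new \<subseteq> edges H" using w(2) u(2) ij by (auto simp: insert_commute)
  have bgG: "bigraph G"
  proof -
    have "e \<in> {{a, b} | a b. a \<in> lverts G \<and> b \<in> rverts G}" if "e \<in> edges G" for e
    proof (cases "e = {u, w}")
      case True
      thus ?thesis using uL wR u(1) w(1) unfolding G_simps by blast
    next
      case False
      hence e: "e \<in> edges H" "e \<notin> ?new" using that unfolding G_simps by blast+
      obtain a b where ab: "a \<in> lverts H" "b \<in> rverts H" "e = {a, b}" by (rule edgeE[OF bg e(1)], rule that)
      have "i \<notin> e"
      proof
        assume "i \<in> e"
        hence "e \<in> {f \<in> edges H. i \<in> f}" using e(1) by simp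
        thus False using e(2) unfolding w(3) by blast
      qed
      moreover have "j \<notin> e"
      proof
        assume "j \<in> e"
        hence "e \<in> {f \<in> edges H. j \<in> f}" using e(1) by simp
        thus False using e(2) unfolding u(3) by (auto simp: insert_commute)
      qed
      ultimately have "a \<noteq> i" "b \<noteq> j" using ab(3) by auto
      thus ?thesis using ab unfolding G_simps by blast
    qed
    hence "edges G \<subseteq> {{a, b} | a b. a \<in> lverts G \<and> b \<in> rverts G}" by (rule subsetI)
    moreover have "finite (lverts G)" "finite (rverts G)" "lverts G \<inter> rverts G = {}"
      using bigraphD(1,2)[OF bg] dis unfolding G_simps by auto
    ultimately show ?thesis unfolding bigraph_def by simp
  qed
  have sub: "subdivision G u w i j"
  proof
    show "i \<notin> verts G" "j \<notin> verts G" "i \<noteq> j" using iL jR dis unfolding verts_def G_simps by auto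
  qed (use bgG uL wR u(1) w(1) in \<open>simp_all add: G_simps\<close>)
  have eq: "H = subdivide G u w i j"
  proof (rule bigraph.equality)
    have "edges (subdivide G u w i j) = (insert {u, w} (edges H - ?new) - {{u, w}}) \<union> ?new"
      by (simp add: subdivide_def G_simps)
    also have "\<dots> = edges H" using uw new by blast
    finally show "edges H = edges (subdivide G u w i j)" ..
  qed (use iL jR in \<open>auto simp: subdivide_def G_simps\<close>)
  interpret subdivision G u w i j by (rule sub)
  have cG: "core G" using H eq core_iff by simp
  \<comment> \<open>Otherwise the thread of {i, j} would be a delta path of length 3, whose excess
    is 0.\<close>
  have "\<not> dthread G (thread G {u, w})"
  proof
    let ?T = "thread G {u, w}"
    assume dt: "dthread G ?T"
    have uwG: "{u, w} \<in> edges G" by (simp add: G_simps)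
    have T: "?T \<in> threads G" by (rule thread_in_threads[OF uwG])
    have E: "expand ?T \<in> threads H" using bij_expand T eq by (auto simp: bij_betw_def)
    have c: "card (expand ?T) = 3"
      using card_expand[OF threads_subset_edges[OF T]] thread_refl[of "{u, w}" G] dt by (simp add: dthread_def)
    have "card (ends H (expand ?T)) = 2" using ends_expand[OF T] dt eq by (simp add: dthread_def)
    moreover have "card (parallels H (expand ?T)) > 1"
      using card_parallels_expand[OF T] dt eq by (simp add: dthread_def)
    ultimately have "base H (expand ?T) = 3" using c by (simp add: base_def)
    hence "excess H (expand ?T) = 0" using c by (simp add: excess_def)
    thus False using ex thread_new eq by simp
  qed
  thus thesis using that sub eq cG by blast
qed

lemma (in subdivision) recover:
  "G = \<lparr>lverts = lverts H - {i}, rverts = rverts H - {j}, edges = insert {u, w} (edges H - new)\<rparr>"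
  "{f \<in> edges H. i \<in> f} = {{i, j}, {i, w}}" "{f \<in> edges H. j \<in> f} = {{u, j}, {i, j}}"
proof -
  have n: "i \<notin> e" "j \<notin> e" if "e \<in> edges G" for e using edge_subset_verts[OF bg that] iV jV by auto
  show "{f \<in> edges H. i \<in> f} = {{i, j}, {i, w}}" "{f \<in> edges H. j \<in> f} = {{u, j}, {i, j}}"
    using n uw_verts ij by (auto simp: H_simps)
  show "G = \<lparr>lverts = lverts H - {i}, rverts = rverts H - {j}, edges = insert {u, w} (edges H - new)\<rparr>"
  proof (rule bigraph.equality)
    have "insert {u, w} (edges H - new) = edges G" using uw new_not_edge unfolding H_simps by blast
    thus "edges G = edges \<lparr>lverts = lverts H - {i}, rverts = rverts H - {j}, edges = insert {u, w} (edges H - new)\<rparr>"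
      by simp
  qed (use iV jV in \<open>auto simp: H_simps verts_def\<close>)
qed

text \<open>In the subdivided graph the other neighbours of \<open>i\<close> and \<open>j\<close>
  are \<open>w\<close> and \<open>u\<close>, and with these known the old graph can be
  restored.\<close>

lemma subdivision_unique:
  assumes "subdivision G u w i j" "subdivision G' u' w' i j" "subdivide G u w i j = subdivide G' u' w' i j"
  shows "G = G' \<and> u = u' \<and> w = w'"
proof -
  interpret a: subdivision G u w i j by fact
  interpret b: subdivision G' u' w' i j by fact
  have "{{i, j}, {i, w}} = {{i, j}, {i, w'}}" using a.recover(2) b.recover(2) assms(3) by simp
  hence w: "w = w'" using a.uw_verts b.uw_verts by (auto simp: doubleton_eq_iff)
  have "{{u, j}, {i, j}} = {{u', j}, {i, j}}" using a.recover(3) b.recover(3) assms(3) by simp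
  hence u: "u = u'" using a.uw_verts b.uw_verts by (auto simp: doubleton_eq_iff)
  show ?thesis using a.recover(1) b.recover(1) assms(3) u w by simp
qed

text \<open>Since \<open>base\<close> is at least 1, positive excess gives length at least 3, and
  such a thread has an edge between two normal points.\<close>

lemma excess_contractible_edge:
  assumes G: "core G" and P: "P \<in> threads G" "excess G P > 0"
  obtains i j where "i \<in> lverts G" "j \<in> rverts G" "{i, j} \<in> edges G" "normal G i" "normal G j"
    "thread G {i, j} = P"
proof -
  have "base G P \<ge> 1" by (simp add: base_def)
  hence "card P - 2 > 0" using card_eq_base_excess[OF G P(1)] P(2) by linarith
  hence "card {e \<in> P. \<forall>x\<in>e. normal G x} > 0" by (simp only: card_thread_normal_edges[OF G P(1)])
  hence "{e \<in> P. \<forall>x\<in>e. normal G x} \<noteq> {}" by (metis card.empty less_irrefl)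
  then obtain e where e: "e \<in> P" "\<forall>x\<in>e. normal G x" by blast
  have eE: "e \<in> edges G" "P = thread G e" using threads_edge[OF P(1) e(1)] by blast+
  obtain i j where ij: "i \<in> lverts G" "j \<in> rverts G" "e = {i, j}"
    by (rule edgeE[OF coreD(1)[OF G] eE(1)], rule that)
  show thesis by (rule that[OF ij(1,2)]) (use e(2) eE ij(3) in auto)
qed

text \<open>Contract as long as there is excess. Every contraction removes one vertex from each
  side, which is why the excess also appears as a difference of side sizes.\<close>

lemma reduce_to_zero_excess:
  fixes G :: "'v bigraph"
  assumes "core G"
  shows "\<exists>K :: 'v bigraph. core K \<and> total_excess K = 0 \<and>
    iso_class (minimal_form K) = iso_class (minimal_form G) \<and> card (slots K) = card (slots G) \<and>
    betti K = betti G \<and> card (lverts G) = card (lverts K) + total_excess G \<and>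
    card (rverts G) = card (rverts K) + total_excess G"
  using assms
proof (induction "total_excess G" arbitrary: G)
  case 0
  thus ?case by (intro exI[of _ G]) simp
next
  case (Suc m)
  note H = \<open>core G\<close>
  have "\<exists>P\<in>threads G. excess G P \<noteq> 0"
  proof (rule ccontr)
    assume "\<not> ?thesis"
    hence "total_excess G = 0" by (simp add: total_excess_def)
    thus False using Suc(2) by simp
  qed
  then obtain P where P: "P \<in> threads G" "excess G P > 0" by blast
  obtain i j where ij: "i \<in> lverts G" "j \<in> rverts G" "{i, j} \<in> edges G" "normal G i" "normal G j"
    "thread G {i, j} = P" by (rule excess_contractible_edge[OF H P])
  have "excess G (thread G {i, j}) > 0" using P ij by simp
  then obtain K u w where K: "subdivision K u w i j" "G = subdivide K u w i j" "core K"
    "\<not> dthread K (thread K {u, w})" by (rule contraction[OF H ij(1-5)])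
  interpret subdivision K u w i j by (rule K(1))
  note hom = homeo_subdivide[OF K(3,4), folded K(2)]
  have t: "total_excess G = total_excess K + 1" using total_excess_subdivide[OF K(3,4)] K(2) by simp
  hence m: "m = total_excess K" using Suc(2) by simp
  obtain L :: "'v bigraph" where L: "core L" "total_excess L = 0"
    "iso_class (minimal_form L) = iso_class (minimal_form K)" "card (slots L) = card (slots K)"
    "betti L = betti K" "card (lverts K) = card (lverts L) + total_excess K"
    "card (rverts K) = card (rverts L) + total_excess K"
    using Suc(1)[OF m K(3)] by blast
  have i1: "iso_class (minimal_form K) = iso_class (minimal_form G)"
    by (rule homeo_iso_class[OF K(3) H hom])
  have i2: "card (slots G) = card (slots K)" by (rule homeo_card_slots(1)[OF hom])
  have i3: "betti G = betti K" using betti_H K(2) by simp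
  have i4: "card (lverts G) = card (lverts K) + 1" "card (rverts G) = card (rverts K) + 1"
    using K(2) iV jV bigraphD[OF bg] by (auto simp: H_simps verts_def)
  show ?case
    by (rule exI[of _ L]) (simp add: L i1 i2 i3 i4 t)
qed

section \<open>Independence of the labels, and orbit counting\<close>

section \<open>Counting labelled graphs\<close>

lemma finite_bigraphs_on: "finite {G :: 'v bigraph. lverts G = R \<and> rverts G = S \<and> bigraph G}"
proof (cases "finite R \<and> finite S")
  case True
  have "{G :: 'v bigraph. lverts G = R \<and> rverts G = S \<and> bigraph G}
      \<subseteq> (\<lambda>E. \<lparr>lverts = R, rverts = S, edges = E\<rparr>) ` Pow (Pow (R \<union> S))"
  proof
    fix G :: "'v bigraph" assume "G \<in> {G. lverts G = R \<and> rverts G = S \<and> bigraph G}"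
    hence G: "lverts G = R" "rverts G = S" "bigraph G" by simp_all
    have "edges G \<in> Pow (Pow (R \<union> S))" using bigraph_edges_Pow[OF G(3)] G(1,2) by (simp add: verts_def)
    moreover have "G = \<lparr>lverts = R, rverts = S, edges = edges G\<rparr>" using G by simp
    ultimately show "G \<in> (\<lambda>E. \<lparr>lverts = R, rverts = S, edges = E\<rparr>) ` Pow (Pow (R \<union> S))" by blast
  qed
  thus ?thesis by (rule finite_subset) (simp add: True)
next
  case False
  hence e: "{G :: 'v bigraph. lverts G = R \<and> rverts G = S \<and> bigraph G} = {}" by (auto simp: bigraph_def)
  show ?thesis unfolding e by simp
qed

definition relabel :: "('v \<Rightarrow> 'w) \<Rightarrow> 'v bigraph \<Rightarrow> 'w bigraph" where
  "relabel f G = \<lparr>lverts = f ` lverts G, rverts = f ` rverts G, edges = (\<lambda>e. f ` e) ` edges G\<rparr>"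

lemma bigraph_iso_relabel: "inj_on f (verts G) \<Longrightarrow> bigraph_iso f G (relabel f G)"
  by (rule bigraph_isoI) (simp_all add: relabel_def)

lemma bigraph_iso_imp_relabel: "bigraph_iso f G H \<Longrightarrow> H = relabel f G"
  using bigraph_isoD[of f G H] by (simp add: relabel_def)

text \<open>Bijections between the sides induce an injection on labelled graphs. Only one
  implication between the predicates is assumed, so that equality follows by using the inequality in
  both directions. If \<open>R\<close> and \<open>S\<close> meet, there is nothing to count.\<close>

lemma card_relabel_le:
  fixes R S :: "'v set" and R' S' :: "'w set"
  assumes R: "finite R" "card R = card R'" and S: "finite S" "card S = card S'"
    and R': "finite R'" and S': "finite S'" and d: "R' \<inter> S' = {}"
    and Q: "\<And>f (G :: 'v bigraph) (H :: 'w bigraph). bigraph_iso f G H \<Longrightarrow> bigraph G \<Longrightarrow> Q G \<Longrightarrow> Q' H"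
  shows "card {G. lverts G = R \<and> rverts G = S \<and> bigraph G \<and> Q G}
    \<le> card {G. lverts G = R' \<and> rverts G = S' \<and> bigraph G \<and> Q' G}" (is "card ?A \<le> card ?B")
proof (cases "R \<inter> S = {}")
  case True
  obtain g h where g: "bij_betw g R R'" and h: "bij_betw h S S'"
    using finite_same_card_bij[OF R(1) R' R(2)] finite_same_card_bij[OF S(1) S' S(2)] by blast
  define f where "f x = (if x \<in> R then g x else h x)" for x
  have fR: "f ` R = R'" using g unfolding f_def bij_betw_def by auto
  have fS: "f ` S = S'"
  proof -
    have "f ` S = h ` S" by (rule image_cong[OF refl]) (use True in \<open>auto simp: f_def\<close>)
    thus ?thesis using h by (simp add: bij_betw_def)
  qed
  have mem: "f x \<in> R' \<longleftrightarrow> x \<in> R" if "x \<in> R \<union> S" for x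
  proof (cases "x \<in> R")
    case True
    thus ?thesis using fR by auto
  next
    case False
    hence "f x \<in> S'" using that fS by auto
    thus ?thesis using False d by auto
  qed
  have inj: "inj_on f (R \<union> S)"
  proof (rule inj_onI)
    fix x y assume xy: "x \<in> R \<union> S" "y \<in> R \<union> S" "f x = f y"
    have xR: "x \<in> R \<longleftrightarrow> y \<in> R" using mem[OF xy(1)] mem[OF xy(2)] xy(3) by simp
    have gi: "inj_on g R" and hi: "inj_on h S" using g h by (simp_all add: bij_betw_def)
    show "x = y"
    proof (cases "x \<in> R")
      case True
      thus ?thesis using xy(3) xR inj_onD[OF gi] by (simp add: f_def)
    next
      case False
      thus ?thesis using xy xR inj_onD[OF hi] by (simp add: f_def)
    qed
  qed
  show ?thesis
  proof (rule card_inj_on_le[of "relabel f"])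
    show "relabel f ` ?A \<subseteq> ?B"
    proof (rule image_subsetI)
      fix G assume "G \<in> ?A"
      hence G: "lverts G = R" "rverts G = S" "bigraph G" "Q G" by simp_all
      have iso: "bigraph_iso f G (relabel f G)"
        by (rule bigraph_iso_relabel) (use inj G in \<open>simp add: verts_def\<close>)
      show "relabel f G \<in> ?B"
        using bigraph_iso_bigraph[OF iso G(3)] Q[OF iso G(3,4)] G fR fS by (simp add: relabel_def)
    qed
    show "inj_on (relabel f) ?A"
    proof (rule inj_onI)
      fix G H assume GH: "G \<in> ?A" "H \<in> ?A" and eq: "relabel f G = relabel f H"
      have "(\<lambda>e. f ` e) ` edges G = (\<lambda>e. f ` e) ` edges H" using eq by (simp add: relabel_def)
      moreover have "edges G \<subseteq> Pow (R \<union> S)" "edges H \<subseteq> Pow (R \<union> S)"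
        using GH bigraph_edges_Pow[of G] bigraph_edges_Pow[of H] by (auto simp: verts_def)
      ultimately have "edges G = edges H"
        by (simp add: inj_on_image_eq_iff[OF inj_on_image_Pow[OF inj]])
      thus "G = H" using GH by (intro bigraph.equality) auto
    qed
    show "finite ?B" by (rule finite_subset[OF _ finite_bigraphs_on[of R' S']]) auto
  qed
next
  case False
  hence e: "?A = {}" using bigraphD(3) by blast
  show ?thesis unfolding e by simp
qed

lemma card_relabel:
  fixes R S :: "'v set" and R' S' :: "'w set"
  assumes "finite R" "card R = card R'" "finite S" "card S = card S'" "finite R'" "finite S'"
    "R \<inter> S = {}" "R' \<inter> S' = {}"
    and "\<And>f (G :: 'v bigraph) (H :: 'w bigraph). bigraph_iso f G H \<Longrightarrow> bigraph G \<Longrightarrow> Q G \<longleftrightarrow> Q' H"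
  shows "card {G. lverts G = R \<and> rverts G = S \<and> bigraph G \<and> Q G}
    = card {G. lverts G = R' \<and> rverts G = S' \<and> bigraph G \<and> Q' G}"
proof (rule antisym)
  have inv: "Q' H \<longleftrightarrow> Q G" if "bigraph_iso f H G" "bigraph H" for f H G
    using assms(9)[OF bigraph_iso_inverse[OF that(1) bigraph_edges_Pow[OF that(2)]]
      bigraph_iso_bigraph[OF that]] by simp
  show "card {G. lverts G = R \<and> rverts G = S \<and> bigraph G \<and> Q G}
    \<le> card {G. lverts G = R' \<and> rverts G = S' \<and> bigraph G \<and> Q' G}"
    by (rule card_relabel_le) (use assms in auto)
  show "card {G. lverts G = R' \<and> rverts G = S' \<and> bigraph G \<and> Q' G}
    \<le> card {G. lverts G = R \<and> rverts G = S \<and> bigraph G \<and> Q G}"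
    by (rule card_relabel_le) (use assms inv in auto)
qed

lemma card_extensional_bijections:
  assumes "finite A" "finite B" "card A = card B"
  shows "card {f \<in> A \<rightarrow>\<^sub>E B. inj_on f A} = fact (card A)"
  using card_inj_on_subset_funcset[OF assms(1,2) subset_refl] assms(3) by (simp add: fact_prod_rev)

text \<open>\<open>extensional\<close> fixes the values off the vertex sets, so that every bijection
  is counted once.\<close>

lemma card_sided_bijections:
  assumes fin: "finite V" "finite W" "finite R" "finite S" and c: "card V = card R" "card W = card S"
    and d: "V \<inter> W = {}"
  shows "card {f. bij_betw f V R \<and> bij_betw f W S \<and> f \<in> extensional (V \<union> W)} = fact (card V) * fact (card W)"
proof -
  let ?A = "{f \<in> V \<rightarrow>\<^sub>E R. inj_on f V}" and ?B = "{f \<in> W \<rightarrow>\<^sub>E S. inj_on f W}"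
  let ?C = "{f. bij_betw f V R \<and> bij_betw f W S \<and> f \<in> extensional (V \<union> W)}"
  have bijI: "bij_betw f A B" if "f \<in> A \<rightarrow>\<^sub>E B" "inj_on f A" "finite B" "card A = card B" for f :: "'a \<Rightarrow> 'b" and A B
  proof -
    have "f ` A \<subseteq> B" using that(1) by auto
    hence "f ` A = B" using that card_image[OF that(2)] by (intro card_subset_eq) auto
    thus ?thesis using that(2) by (simp add: bij_betw_def)
  qed
  have "bij_betw (\<lambda>(g, h) x. if x \<in> V then g x else h x) (?A \<times> ?B) ?C"
  proof (rule bij_betw_byWitness[where f' = "\<lambda>f. (restrict f V, restrict f W)"])
    show "\<forall>p\<in>?A \<times> ?B. (\<lambda>f. (restrict f V, restrict f W)) ((\<lambda>(g, h) x. if x \<in> V then g x else h x) p) = p"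
    proof (intro ballI)
      fix p assume p: "p \<in> ?A \<times> ?B"
      obtain g h where gh: "p = (g, h)" by (cases p)
      have e: "g \<in> extensional V" "h \<in> extensional W" using p gh by (auto simp: PiE_def)
      have "restrict (\<lambda>x. if x \<in> V then g x else h x) V = g"
        by (rule extensionalityI[of _ V]) (use e in auto)
      moreover have "restrict (\<lambda>x. if x \<in> V then g x else h x) W = h"
        by (rule extensionalityI[of _ W]) (use e d in auto)
      ultimately show "(\<lambda>f. (restrict f V, restrict f W)) ((\<lambda>(g, h) x. if x \<in> V then g x else h x) p) = p"
        by (simp add: gh)
    qed
    show "\<forall>f\<in>?C. (\<lambda>(g, h) x. if x \<in> V then g x else h x) (restrict f V, restrict f W) = f"
      by (auto simp: fun_eq_iff extensional_def)
    show "(\<lambda>(g, h) x. if x \<in> V then g x else h x) ` (?A \<times> ?B) \<subseteq> ?C"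
    proof (rule image_subsetI)
      fix p assume p: "p \<in> ?A \<times> ?B"
      obtain g h where gh: "p = (g, h)" by (cases p)
      have "bij_betw g V R" "bij_betw h W S" using p gh fin c by (auto intro!: bijI)
      moreover have "bij_betw (\<lambda>x. if x \<in> V then g x else h x) V R = bij_betw g V R"
        by (rule bij_betw_cong) simp
      moreover have "bij_betw (\<lambda>x. if x \<in> V then g x else h x) W S = bij_betw h W S"
        by (rule bij_betw_cong) (use d in auto)
      moreover have "h \<in> extensional W" using p gh by (auto simp: PiE_def)
      ultimately show "(\<lambda>(g, h) x. if x \<in> V then g x else h x) p \<in> ?C"
        by (simp add: gh extensional_def)
    qed
    show "(\<lambda>f. (restrict f V, restrict f W)) ` ?C \<subseteq> ?A \<times> ?B"
      by (auto simp: bij_betw_def inj_on_def)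
  qed
  hence "card ?C = card (?A \<times> ?B)" by (rule bij_betw_same_card[symmetric])
  also have "\<dots> = fact (card V) * fact (card W)"
    unfolding card_cartesian_product card_extensional_bijections[OF fin(1,3) c(1)]
      card_extensional_bijections[OF fin(2,4) c(2)] ..
  finally show ?thesis .
qed

text \<open>Orbit counting: the labellings of \<open>H\<close> by \<open>R\<close> and \<open>S\<close> that yield a given graph form
  a torsor under the automorphism group of \<open>H\<close>.\<close>

lemma card_isomorphic_graphs:
  fixes H :: "'w bigraph" and R S :: "'v set"
  assumes H: "bigraph H" and R: "finite R" "card R = card (lverts H)" and S: "finite S" "card S = card (rverts H)"
    and d: "R \<inter> S = {}"
  shows "card {G. lverts G = R \<and> rverts G = S \<and> (\<exists>f. bigraph_iso f H G)} * card (automorphisms H)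
    = fact (card R) * fact (card S)"
proof -
  let ?V = "verts H"
  define F where "F = {f. bij_betw f (lverts H) R \<and> bij_betw f (rverts H) S \<and> f \<in> extensional (lverts H \<union> rverts H)}"
  define X where "X = {G. lverts G = R \<and> rverts G = S \<and> (\<exists>f. bigraph_iso f H G)}"
  define fib where "fib G = {f \<in> extensional ?V. bigraph_iso f H G}" for G :: "'v bigraph"
  have cF: "card F = fact (card R) * fact (card S)"
    using card_sided_bijections[of "lverts H" "rverts H" R S] bigraphD[OF H] R S by (simp add: F_def)
  have "card F > 0" unfolding cF by simp
  hence finF: "finite F" by (rule card_ge_0_finite)
  have iso: "bigraph_iso f H (relabel f H)" "relabel f H \<in> X" if "f \<in> F" for f
  proof -
    have b: "f ` lverts H = R" "f ` rverts H = S" "inj_on f (lverts H)" "inj_on f (rverts H)"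
      using that by (auto simp: F_def bij_betw_def)
    have "inj_on f ?V" unfolding verts_def
    proof (rule inj_onI)
      fix x y assume xy: "x \<in> lverts H \<union> rverts H" "y \<in> lverts H \<union> rverts H" "f x = f y"
      have mem: "f z \<in> R \<longleftrightarrow> z \<in> lverts H" if "z \<in> lverts H \<union> rverts H" for z
      proof (cases "z \<in> lverts H")
        case True
        thus ?thesis using b(1) by auto
      next
        case False
        hence "f z \<in> S" using that b(2) by auto
        thus ?thesis using False d by auto
      qed
      have xl: "x \<in> lverts H \<longleftrightarrow> y \<in> lverts H" using mem[OF xy(1)] mem[OF xy(2)] xy(3) by simp
      show "x = y"
      proof (cases "x \<in> lverts H")
        case True
        thus ?thesis using xy(3) xl inj_onD[OF b(3)] by simp
      next
        case False
        thus ?thesis using xy xl inj_onD[OF b(4)] by simp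
      qed
    qed
    thus "bigraph_iso f H (relabel f H)" by (rule bigraph_iso_relabel)
    thus "relabel f H \<in> X" using b(1,2) unfolding X_def by (auto simp: relabel_def)
  qed
  have F_iff: "f \<in> F" if "f \<in> fib G" "G \<in> X" for f G
    using that by (auto simp: F_def X_def fib_def bigraph_iso_def verts_def)
  have "F = (\<Union>G\<in>X. fib G)"
  proof (intro equalityI subsetI)
    fix f assume f: "f \<in> F"
    have "f \<in> fib (relabel f H)" using f iso(1)[OF f] by (simp add: fib_def F_def verts_def)
    thus "f \<in> (\<Union>G\<in>X. fib G)" using iso(2)[OF f] by blast
  next
    fix f assume "f \<in> (\<Union>G\<in>X. fib G)"
    thus "f \<in> F" using F_iff by (elim UN_E)
  qed
  moreover have finX: "finite X"
  proof (rule finite_subset[OF _ finite_bigraphs_on[of R S]])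
    show "X \<subseteq> {G. lverts G = R \<and> rverts G = S \<and> bigraph G}"
      using bigraph_iso_bigraph[OF _ H] unfolding X_def by blast
  qed
  moreover have "card (\<Union>G\<in>X. fib G) = (\<Sum>G\<in>X. card (fib G))"
  proof (rule card_UN_disjoint[OF finX])
    show "\<forall>G\<in>X. finite (fib G)"
    proof
      fix G assume "G \<in> X"
      hence "fib G \<subseteq> F" using F_iff by blast
      thus "finite (fib G)" using finF by (rule finite_subset)
    qed
    show "\<forall>G\<in>X. \<forall>K\<in>X. G \<noteq> K \<longrightarrow> fib G \<inter> fib K = {}"
      using bigraph_iso_imp_relabel unfolding fib_def by blast
  qed
  ultimately have "card F = (\<Sum>G\<in>X. card (fib G))" by simp
  also have "\<dots> = (\<Sum>G\<in>X. card (automorphisms H))"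
  proof (rule sum.cong[OF refl])
    fix G assume "G \<in> X"
    then obtain f0 where f0: "bigraph_iso f0 H G" unfolding X_def by blast
    note I = bigraph_isoD[OF f0]
    let ?g = "inv_into ?V f0"
    have gi: "bigraph_iso ?g G H" by (rule bigraph_iso_inverse[OF f0 bigraph_edges_Pow[OF H]])
    have cong: "bigraph_iso f' H K" if "bigraph_iso f H K" "\<And>x. x \<in> ?V \<Longrightarrow> f x = f' x" for f f' and K :: "'u bigraph"
    proof (rule bigraph_isoI)
      note J = bigraph_isoD[OF that(1)]
      show "inj_on f' ?V" by (rule iffD1[OF inj_on_cong[OF that(2)] J(1)])
      show "lverts K = f' ` lverts H" "rverts K = f' ` rverts H"
        unfolding J by (rule image_cong[OF refl], simp add: that(2) verts_def)+
      have "(\<lambda>e. f ` e) ` edges H = (\<lambda>e. f' ` e) ` edges H"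
      proof (rule image_cong[OF refl])
        fix e assume "e \<in> edges H"
        hence "e \<subseteq> ?V" using bigraph_edges_Pow[OF H] by blast
        thus "f ` e = f' ` e" by (intro image_cong[OF refl that(2)]) blast
      qed
      thus "edges K = (\<lambda>e. f' ` e) ` edges H" unfolding J by simp
    qed
    \<comment> \<open>Composition with the fixed isomorphism \<open>f0\<close>. Off the vertex set
      the two sides are normalised differently, \<open>automorphisms\<close> by the identity and
      \<open>fib\<close> by \<open>undefined\<close>; hence \<open>restrict\<close> in one direction
      and the case distinction in the other.\<close>
    have "bij_betw (\<lambda>s. restrict (f0 \<circ> s) ?V) (automorphisms H) (fib G)"
    proof (rule bij_betw_byWitness[where f' = "\<lambda>f x. if x \<in> ?V then ?g (f x) else x"])
      have gf: "?g (f0 x) = x" if "x \<in> ?V" for x using I(1) that by (rule inv_into_f_f)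
      have fg: "f0 (?g y) = y" if "y \<in> verts G" for y using that I(4) by (simp add: f_inv_into_f)
      show "\<forall>s\<in>automorphisms H. (\<lambda>x. if x \<in> ?V then ?g (restrict (f0 \<circ> s) ?V x) else x) = s"
      proof (intro ballI ext)
        fix s x assume "s \<in> automorphisms H"
        hence s: "s permutes ?V" by (simp add: automorphisms_def)
        show "(if x \<in> ?V then ?g (restrict (f0 \<circ> s) ?V x) else x) = s x"
          using gf[of "s x"] permutes_in_image[OF s] permutes_not_in[OF s] by auto
      qed
      show "\<forall>f\<in>fib G. restrict (f0 \<circ> (\<lambda>x. if x \<in> ?V then ?g (f x) else x)) ?V = f"
      proof (intro ballI)
        fix f assume f: "f \<in> fib G"
        hence fv: "f x \<in> verts G" if "x \<in> ?V" for x using that bigraph_isoD(4)[of f H G] by (auto simp: fib_def)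
        show "restrict (f0 \<circ> (\<lambda>x. if x \<in> ?V then ?g (f x) else x)) ?V = f"
          by (rule extensionalityI[of _ ?V]) (use f fv fg in \<open>auto simp: fib_def\<close>)
      qed
      show "(\<lambda>s. restrict (f0 \<circ> s) ?V) ` automorphisms H \<subseteq> fib G"
      proof (rule image_subsetI)
        fix s assume "s \<in> automorphisms H"
        hence "bigraph_iso s H H" by (simp add: automorphisms_def)
        hence "bigraph_iso (f0 \<circ> s) H G" using f0 by (rule bigraph_iso_trans)
        hence "bigraph_iso (restrict (f0 \<circ> s) ?V) H G" by (rule cong) simp
        thus "restrict (f0 \<circ> s) ?V \<in> fib G" by (simp add: fib_def)
      qed
      show "(\<lambda>f x. if x \<in> ?V then ?g (f x) else x) ` fib G \<subseteq> automorphisms H"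
      proof (rule image_subsetI)
        fix f assume "f \<in> fib G"
        hence "bigraph_iso f H G" by (simp add: fib_def)
        hence "bigraph_iso (?g \<circ> f) H H" using gi by (rule bigraph_iso_trans)
        hence b: "bigraph_iso (\<lambda>x. if x \<in> ?V then ?g (f x) else x) H H" by (rule cong) simp
        hence "bij_betw (\<lambda>x. if x \<in> ?V then ?g (f x) else x) ?V ?V" by (simp add: bigraph_iso_def)
        hence "(\<lambda>x. if x \<in> ?V then ?g (f x) else x) permutes ?V" by (rule bij_imp_permutes) simp
        thus "(\<lambda>x. if x \<in> ?V then ?g (f x) else x) \<in> automorphisms H" using b by (simp add: automorphisms_def)
      qed
    qed
    thus "card (fib G) = card (automorphisms H)" by (rule bij_betw_same_card[symmetric])
  qed
  finally have "card F = card X * card (automorphisms H)" by simp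
  thus ?thesis using cF unfolding X_def by simp
qed

lemma card_automorphisms_pos: "bigraph H \<Longrightarrow> card (automorphisms H) > 0"
  using card_isomorphic_graphs[of H "lverts H" "rverts H"] bigraphD[of H] by (cases "card (automorphisms H)") auto

text \<open>For a core, \<open>iso_class (minimal_form G)\<close> is the basic graph, since a core
  is its own pruning.\<close>

definition cores_of :: "nat bigraph set \<Rightarrow> 'v set \<Rightarrow> 'v set \<Rightarrow> 'v bigraph set" where
  "cores_of B R S = {G. lverts G = R \<and> rverts G = S \<and> bigraph G \<and> core G \<and> iso_class (minimal_form G) = B}"

lemma finite_cores_of: "finite (cores_of B R S)"
  by (rule finite_subset[OF _ finite_bigraphs_on[of R S]]) (auto simp: cores_of_def)

lemma card_cores_of_cong:
  fixes R S :: "'v set" and R' S' :: "'w set"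
  assumes "finite R" "card R = card R'" "finite S" "card S = card S'" "finite R'" "finite S'"
    "R \<inter> S = {}" "R' \<inter> S' = {}"
  shows "card (cores_of B R S) = card (cores_of B R' S')"
  unfolding cores_of_def
proof (rule card_relabel[OF assms])
  fix f and G :: "'v bigraph" and H :: "'w bigraph"
  assume iso: "bigraph_iso f G H" and G: "bigraph G"
  have "core H \<longleftrightarrow> core G"
    using bigraph_iso_core[OF iso] bigraph_iso_core[OF bigraph_iso_inverse[OF iso bigraph_edges_Pow[OF G]]] by blast
  thus "(core G \<and> iso_class (minimal_form G) = B) \<longleftrightarrow> (core H \<and> iso_class (minimal_form H) = B)"
    using bigraph_iso_minimal_form(1)[OF iso] by auto
qed

section \<open>The weighted count of subdivisions, from both sides\<close>

section \<open>Double counting of subdivisions\<close>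

text \<open>Replaces the edges as an index set by all pairs of a left and a right vertex, which do
  not depend on the edges of the graph.\<close>

lemma sum_edges_pairs:
  assumes G: "bigraph G"
  shows "(\<Sum>p\<in>lverts G \<times> rverts G. if {fst p, snd p} \<in> edges G then h {fst p, snd p} else 0)
    = (\<Sum>e\<in>edges G. (h e :: 'a :: comm_monoid_add))"
proof -
  let ?A = "{p \<in> lverts G \<times> rverts G. {fst p, snd p} \<in> edges G}"
  have fin: "finite (lverts G \<times> rverts G)" using bigraphD[OF G] by simp
  have "bij_betw (\<lambda>p. {fst p, snd p}) ?A (edges G)"
  proof (rule bij_betwI')
    fix p q assume "p \<in> ?A" "q \<in> ?A"
    thus "({fst p, snd p} = {fst q, snd q}) = (p = q)"
      using bigraphD(3)[OF G] by (auto simp: doubleton_eq_iff prod_eq_iff)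
  next
    fix e assume e: "e \<in> edges G"
    obtain u v where "u \<in> lverts G" "v \<in> rverts G" "e = {u, v}" by (rule edgeE[OF G e], rule that)
    thus "\<exists>p\<in>?A. e = {fst p, snd p}" using e by (intro bexI[of _ "(u, v)"]) auto
  qed simp
  hence "(\<Sum>p\<in>?A. h {fst p, snd p}) = (\<Sum>e\<in>edges G. h e)" by (rule sum.reindex_bij_betw)
  thus ?thesis by (simp only: sum.inter_filter[OF fin])
qed

lemma sum_edges_threads:
  assumes G: "bigraph G"
  shows "(\<Sum>e\<in>edges G. (h e :: 'a :: comm_monoid_add)) = (\<Sum>P\<in>threads G. \<Sum>e\<in>P. h e)"
proof -
  have "(\<Sum>e\<in>\<Union>(threads G). h e) = (\<Sum>P\<in>threads G. \<Sum>e\<in>P. h e)"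
    using sum.Union_disjoint[of "threads G" h] finite_thread[OF G] threads_disjoint[of _ G]
    by (simp add: disjoint_iff) blast
  thus ?thesis by (simp add: Union_threads)
qed

text \<open>Spreads the excess of a thread evenly over its edges between two normal points, which
  number two less than its length.\<close>

definition contract_weight :: "'v bigraph \<Rightarrow> 'v set \<Rightarrow> rat" where
  "contract_weight G e = (if \<forall>x\<in>e. normal G x
     then of_nat (excess G (thread G e)) / of_nat (card (thread G e) - 2) else 0)"

text \<open>Subdividing takes length l and excess m to l + 2 and m + 1, where the contraction weight
  is (m + 1) / ((l + 2) - 2), the value taken here. Delta edges get weight 0, as subdividing one
  changes the basic graph.\<close>

definition subdivide_weight :: "'v bigraph \<Rightarrow> 'v set \<Rightarrow> rat" where
  "subdivide_weight G e = (if dthread G (thread G e) then 0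
     else of_nat (excess G (thread G e) + 1) / of_nat (card (thread G e)))"

lemma sum_contract_weight:
  assumes G: "core G"
  shows "(\<Sum>e\<in>edges G. contract_weight G e) = of_nat (total_excess G)"
proof -
  note bg = coreD(1)[OF G]
  have "(\<Sum>e\<in>P. contract_weight G e) = of_nat (excess G P)" if P: "P \<in> threads G" for P
  proof -
    have th: "thread G e = P" if "e \<in> P" for e using threads_edge[OF P that] by blast
    have "(\<Sum>e\<in>P. contract_weight G e)
        = (\<Sum>e\<in>P. if \<forall>x\<in>e. normal G x then of_nat (excess G P) / of_nat (card P - 2) else 0)"
      by (rule sum.cong[OF refl]) (simp add: contract_weight_def th)
    also have "\<dots> = (\<Sum>e\<in>{e \<in> P. \<forall>x\<in>e. normal G x}. of_nat (excess G P) / of_nat (card P - 2))"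
      by (rule sum.inter_filter[OF finite_thread[OF bg P], symmetric])
    also have "\<dots> = of_nat (card P - 2) * (of_nat (excess G P) / of_nat (card P - 2))"
      by (simp only: sum_constant card_thread_normal_edges[OF G P])
    also have "\<dots> = of_nat (excess G P)"
    proof (cases "excess G P = 0")
      \<comment> \<open>Here the length is at least 3. At excess 0 the divisor may be 0, but both
        sides vanish.\<close>
      case False
      have "base G P \<ge> 1" by (simp add: base_def)
      hence "card P - 2 > 0" using card_eq_base_excess[OF G P] False by linarith
      hence "(of_nat (card P - 2) :: rat) \<noteq> 0" by simp
      thus ?thesis by (metis nonzero_mult_div_cancel_left times_divide_eq_right)
    qed simp
    finally show ?thesis .
  qed
  thus ?thesis unfolding sum_edges_threads[OF bg] total_excess_def by simp
qed

lemma dthread_excess: "dthread G P \<Longrightarrow> excess G P = 0"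
  by (simp add: dthread_def excess_def base_def)

text \<open>The l edges of a slot of excess m have weight (m + 1) / l each, so a slot contributes
  one more than its excess. A delta edge contributes 0, which is its excess.\<close>

lemma sum_subdivide_weight:
  assumes G: "core G"
  shows "(\<Sum>e\<in>edges G. subdivide_weight G e) = of_nat (total_excess G + card (slots G))"
proof -
  note bg = coreD(1)[OF G]
  have "(\<Sum>e\<in>P. subdivide_weight G e) = of_nat (excess G P) + (if dthread G P then 0 else 1)" if P: "P \<in> threads G" for P
  proof -
    have th: "thread G e = P" if "e \<in> P" for e using threads_edge[OF P that] by blast
    have "(\<Sum>e\<in>P. subdivide_weight G e)
        = (\<Sum>e\<in>P. if dthread G P then 0 else of_nat (excess G P + 1) / of_nat (card P))"
      by (rule sum.cong[OF refl]) (simp add: subdivide_weight_def th)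
    moreover have "(of_nat (card P) :: rat) \<noteq> 0" using thread_card_pos[OF G P] by simp
    ultimately show ?thesis by (auto simp: dthread_excess)
  qed
  hence "(\<Sum>e\<in>edges G. subdivide_weight G e)
      = (\<Sum>P\<in>threads G. of_nat (excess G P) + (if dthread G P then 0 else 1))"
    unfolding sum_edges_threads[OF bg] by (rule sum.cong[OF refl])
  also have "\<dots> = of_nat (total_excess G) + (\<Sum>P\<in>threads G. if \<not> dthread G P then 1 else 0)"
    unfolding total_excess_def sum.distrib of_nat_sum by (intro arg_cong2[of _ _ _ _ "(+)"] refl sum.cong) simp_all
  also have "(\<Sum>P\<in>threads G. if \<not> dthread G P then 1 else 0) = (\<Sum>P\<in>slots G. (1::rat))"
    unfolding slots_def by (rule sum.inter_filter[OF finite_threads[OF bg], symmetric])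
  finally show ?thesis by simp
qed

text \<open>The weights make the two sides of the double count depend on the total excess only: the
  weight of contracting an edge equals the weight of the subdivision that undoes it.\<close>

lemma Inl_Inr_image_disjoint: "Inl ` A \<inter> Inr ` B = {}"
  by auto

lemma double_count:
  fixes R S :: "'v set"
  assumes fin: "finite R" "finite S" and disj: "R \<inter> S = {}"
  shows "(\<Sum>G\<in>cores_of B R S. of_nat (total_excess G)) =
    (\<Sum>p\<in>R \<times> S. \<Sum>G\<in>cores_of B (R - {fst p}) (S - {snd p}). of_nat (total_excess G + card (slots G)) :: rat)"
proof -
  define Y where "Y p = cores_of B (R - {fst p}) (S - {snd p})" for p
  define wc where "wc = (\<lambda>x :: 'v bigraph \<times> 'v \<times> 'v. let H = fst x; e = {fst (snd x), snd (snd x)} in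
    if e \<in> edges H then contract_weight H e else 0)"
  define ws where "ws = (\<lambda>x :: ('v \<times> 'v) \<times> 'v bigraph \<times> 'v \<times> 'v. let G = fst (snd x); e = {fst (snd (snd x)), snd (snd (snd x))} in
    if e \<in> edges G then subdivide_weight G e else 0)"
  define AA where "AA = Sigma (cores_of B R S) (\<lambda>_. R \<times> S)"
  define BB where "BB = Sigma (R \<times> S) (\<lambda>p. Sigma (Y p) (\<lambda>G. lverts G \<times> rverts G))"
  \<comment> \<open>Non-zero weight selects the contractible edges on one side and the edges that
    are not delta edges on the other; pairs of non-adjacent vertices have weight 0 and disappear as
    well.\<close>
  define A where "A = {x \<in> AA. wc x \<noteq> 0}"
  define A0 where "A0 = {x \<in> BB. ws x \<noteq> 0}"
  define f where "f = (\<lambda>x :: ('v \<times> 'v) \<times> 'v bigraph \<times> 'v \<times> 'v.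
    (subdivide (fst (snd x)) (fst (snd (snd x))) (snd (snd (snd x))) (fst (fst x)) (snd (fst x)), fst x))"
  have finY: "finite (Y p)" for p unfolding Y_def by (rule finite_cores_of)
  have finLR: "finite (lverts G)" "finite (rverts G)" if "G \<in> Y p" for G p
    using that fin by (auto simp: Y_def cores_of_def)
  hence finG: "finite (lverts G \<times> rverts G)" if "G \<in> Y p" for G p
    using that by blast
  have finAA: "finite AA" unfolding AA_def using fin finite_cores_of by blast
  have finBB: "finite BB" unfolding BB_def using fin finY finLR by (intro finite_SigmaI) auto
  have left: "(\<Sum>G\<in>cores_of B R S. of_nat (total_excess G)) = sum wc A"
  proof -
    have "(\<Sum>p\<in>R \<times> S. wc (G, p)) = of_nat (total_excess G)" if "G \<in> cores_of B R S" for G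
    proof -
      have G: "core G" "lverts G = R" "rverts G = S" using that by (simp_all add: cores_of_def)
      have "wc (G, p) = (if {fst p, snd p} \<in> edges G then contract_weight G {fst p, snd p} else 0)" for p
        unfolding wc_def Let_def fst_conv snd_conv ..
      thus ?thesis using sum_edges_pairs[OF coreD(1)[OF G(1)], of "contract_weight G"]
        by (simp only: G(2,3) sum_contract_weight[OF G(1)])
    qed
    hence "(\<Sum>G\<in>cores_of B R S. of_nat (total_excess G)) = (\<Sum>G\<in>cores_of B R S. \<Sum>p\<in>R \<times> S. wc (G, p))"
      by (intro sum.cong[OF refl]) simp
    also have "\<dots> = sum wc AA"
      unfolding AA_def using finite_cores_of fin by (subst sum.Sigma) (auto simp: case_prod_beta)
    also have "\<dots> = sum wc A" unfolding A_def by (rule sum.mono_neutral_right[OF finAA]) auto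
    finally show ?thesis .
  qed
  have right: "(\<Sum>p\<in>R \<times> S. \<Sum>G\<in>Y p. of_nat (total_excess G + card (slots G))) = sum ws A0"
  proof -
    have "(\<Sum>q\<in>lverts G \<times> rverts G. ws (p, G, q)) = of_nat (total_excess G + card (slots G))" if "G \<in> Y p" for p G
    proof -
      have G: "core G" using that by (simp add: Y_def cores_of_def)
      have "ws (p, G, q) = (if {fst q, snd q} \<in> edges G then subdivide_weight G {fst q, snd q} else 0)" for q
        unfolding ws_def Let_def fst_conv snd_conv ..
      thus ?thesis using sum_edges_pairs[OF coreD(1)[OF G], of "subdivide_weight G"]
        by (simp only: sum_subdivide_weight[OF G])
    qed
    hence "(\<Sum>p\<in>R \<times> S. \<Sum>G\<in>Y p. of_nat (total_excess G + card (slots G)))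
       = (\<Sum>p\<in>R \<times> S. \<Sum>G\<in>Y p. \<Sum>q\<in>lverts G \<times> rverts G. ws (p, G, q))"
      by (intro sum.cong[OF refl]) simp
    also have "\<dots> = (\<Sum>p\<in>R \<times> S. \<Sum>r\<in>Sigma (Y p) (\<lambda>G. lverts G \<times> rverts G). ws (p, r))"
      by (intro sum.cong[OF refl], subst sum.Sigma) (auto simp: case_prod_beta finY finG)
    also have "\<dots> = sum ws BB"
      unfolding BB_def using fin finY finLR by (subst sum.Sigma) (auto simp: case_prod_beta intro!: finite_SigmaI)
    also have "\<dots> = sum ws A0" unfolding A0_def by (rule sum.mono_neutral_right[OF finBB]) auto
    finally show ?thesis .
  qed
  have A0D: "subdivision G u w i j" "core G" "iso_class (minimal_form G) = B" "lverts G = R - {i}" "rverts G = S - {j}"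
      "i \<in> R" "j \<in> S" "\<not> dthread G (thread G {u, w})"
    if "((i, j), G, (u, w)) \<in> A0" for i j G u w
  proof -
    have m: "i \<in> R" "j \<in> S" "G \<in> Y (i, j)" "u \<in> lverts G" "w \<in> rverts G" "ws ((i, j), G, (u, w)) \<noteq> 0"
      using that by (auto simp: A0_def BB_def)
    have e: "{u, w} \<in> edges G" "\<not> dthread G (thread G {u, w})"
      using m(6) by (auto simp: ws_def Let_def subdivide_weight_def split: if_splits)
    have G: "lverts G = R - {i}" "rverts G = S - {j}" "core G" "iso_class (minimal_form G) = B"
      using m(3) by (simp_all add: Y_def cores_of_def)
    have n: "i \<notin> verts G" "j \<notin> verts G" "i \<noteq> j" using m(1,2) disj G(1,2) by (auto simp: verts_def)
    show "subdivision G u w i j" by unfold_locales (use coreD(1)[OF G(3)] m(4,5) e(1) n in auto)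
    show "core G" "iso_class (minimal_form G) = B" "lverts G = R - {i}" "rverts G = S - {j}"
      "i \<in> R" "j \<in> S" "\<not> dthread G (thread G {u, w})" using G m e by auto
  qed
  have image: "subdivide G u w i j \<in> cores_of B R S \<and> wc (subdivide G u w i j, (i, j)) = ws ((i, j), G, (u, w))"
    if "((i, j), G, (u, w)) \<in> A0" for i j G u w
  proof -
    note D = A0D[OF that]
    interpret subdivision G u w i j by (rule D(1))
    have H: "core H" using core_iff D(2) by simp
    have "iso_class (minimal_form H) = B"
      using homeo_iso_class[OF D(2) H homeo_subdivide[OF D(2,8)]] D(3) by simp
    moreover have "lverts H = R" "rverts H = S" using D(4-7) by (auto simp: H_simps)
    ultimately have 1: "H \<in> cores_of B R S" using H bigraph_H by (simp add: cores_of_def)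
    let ?T = "thread G {u, w}"
    have T: "?T \<in> threads G" by (rule thread_in_threads[OF uw])
    have uT: "{u, w} \<in> ?T" by (rule thread_refl)
    have ijE: "{i, j} \<in> edges H" by (simp add: H_simps)
    have "contract_weight H {i, j} = of_nat (excess H (expand ?T)) / of_nat (card (expand ?T) - 2)"
      using normal_H by (simp add: contract_weight_def thread_new)
    also have "\<dots> = of_nat (excess G ?T + 1) / of_nat (card ?T)"
      using excess_expand[OF D(2,8) T] card_expand[OF threads_subset_edges[OF T]] uT by simp
    also have "\<dots> = subdivide_weight G {u, w}" using D(8) by (simp add: subdivide_weight_def)
    finally have "wc (H, (i, j)) = ws ((i, j), G, (u, w))" using ijE uw by (simp add: wc_def ws_def)
    thus ?thesis using 1 by blast
  qed
  \<comment> \<open>Subdivision and contraction are inverse to each other: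
    \<open>subdivision_unique\<close> gives injectivity and \<open>contraction\<close>
    surjectivity.\<close>
  have "bij_betw f A0 A"
    unfolding bij_betw_def
  proof
    show "inj_on f A0"
    proof (rule inj_onI)
      fix x y assume xy: "x \<in> A0" "y \<in> A0" "f x = f y"
      obtain i j G u w where x: "x = ((i, j), G, (u, w))" by (metis prod.exhaust)
      obtain i' j' G' u' w' where y: "y = ((i', j'), G', (u', w'))" by (metis prod.exhaust)
      have e: "i' = i" "j' = j" "subdivide G u w i j = subdivide G' u' w' i j"
        using xy(3) by (auto simp: f_def x y)
      have "subdivision G u w i j" using A0D(1) xy(1) x by blast
      moreover have "subdivision G' u' w' i j" using A0D(1) xy(2) y e by blast
      ultimately show "x = y" using subdivision_unique[OF _ _ e(3)] e x y by simp
    qed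
    show "f ` A0 = A"
    proof (intro equalityI subsetI)
      fix z assume "z \<in> f ` A0"
      then obtain x where x0: "x \<in> A0" "z = f x" by blast
      obtain i j G u w where x: "x = ((i, j), G, (u, w))" by (metis prod.exhaust)
      have m: "((i, j), G, (u, w)) \<in> A0" using x0 x by simp
      have z: "z = (subdivide G u w i j, (i, j))" by (simp add: x0(2) x f_def)
      have "ws ((i, j), G, (u, w)) \<noteq> 0" using m by (simp add: A0_def)
      thus "z \<in> A" using image[OF m] A0D(6,7)[OF m] by (simp add: z A_def AA_def)
    next
      fix z assume z: "z \<in> A"
      obtain H i j where zz: "z = (H, (i, j))" by (metis prod.exhaust)
      have m: "H \<in> cores_of B R S" "i \<in> R" "j \<in> S" "wc (H, (i, j)) \<noteq> 0"
        using z by (auto simp: A_def AA_def zz)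
      have H: "core H" "lverts H = R" "rverts H = S" "iso_class (minimal_form H) = B"
        using m(1) by (simp_all add: cores_of_def)
      have e: "{i, j} \<in> edges H" "contract_weight H {i, j} \<noteq> 0"
        using m(4) by (auto simp: wc_def Let_def split: if_splits)
      have n: "normal H i" "normal H j" "excess H (thread H {i, j}) > 0"
        using e(2) by (auto simp: contract_weight_def split: if_splits)
      have ij: "i \<in> lverts H" "j \<in> rverts H" using m H by simp_all
      obtain G u w where G: "subdivision G u w i j" "H = subdivide G u w i j" "core G"
        "\<not> dthread G (thread G {u, w})" by (rule contraction[OF H(1) ij e(1) n])
      interpret subdivision G u w i j by (rule G(1))
      have lr: "lverts G = R - {i}" "rverts G = S - {j}"
        using recover(1) H(2,3) G(2) by (metis bigraph.select_convs(1), metis bigraph.select_convs(2))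
      have "iso_class (minimal_form G) = B"
        using homeo_iso_class[OF G(3) _ homeo_subdivide[OF G(3,4)]] core_iff G(2,3) H(4) by simp
      hence GY: "G \<in> Y (i, j)" using G(3) bg lr by (simp add: Y_def cores_of_def)
      have "(of_nat (card (thread G {u, w})) :: rat) \<noteq> 0"
        using thread_card_pos[OF G(3) thread_in_threads[OF uw]] by simp
      \<comment> \<open>The numerator is the excess plus one, so the weight of the recovered
        subdivision does not vanish even at excess 0.\<close>
      moreover have "1 + (of_nat (excess G (thread G {u, w})) :: rat) \<noteq> 0"
        by (metis of_nat_Suc of_nat_neq_0)
      ultimately have "ws ((i, j), G, (u, w)) \<noteq> 0" using uw G(4)
        by (simp add: ws_def Let_def subdivide_weight_def)
      hence "((i, j), G, (u, w)) \<in> A0" using GY m(2,3) uL wR by (simp add: A0_def BB_def)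
      moreover have "z = f ((i, j), G, (u, w))" by (simp add: zz f_def G(2))
      ultimately show "z \<in> f ` A0" by blast
    qed
  qed
  hence "sum wc A = (\<Sum>x\<in>A0. wc (f x))" by (rule sum.reindex_bij_betw[symmetric])
  also have "\<dots> = sum ws A0"
  proof (rule sum.cong[OF refl])
    fix x assume x0: "x \<in> A0"
    obtain i j G u w where x: "x = ((i, j), G, (u, w))" by (metis prod.exhaust)
    show "wc (f x) = ws x" using image[of i j G u w] x0 by (simp add: x f_def)
  qed
  finally show ?thesis using left right unfolding Y_def by simp
qed

section \<open>Members of an isomorphism class as models of a basic graph\<close>

section \<open>Representatives\<close>

text \<open>The bound on the vertices serves for the finiteness of the set of basic graphs.\<close>

lemma core_nat_copy:
  assumes G: "bigraph (G :: 'v bigraph)"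
  obtains f and H :: "nat bigraph" where "bigraph_iso f G H" "bigraph H" "verts H \<subseteq> {..<card (verts G)}"
proof -
  obtain f :: "'v \<Rightarrow> nat" and n where f: "f ` verts G = {i. i < n}" "inj_on f (verts G)"
    using finite_imp_inj_to_nat_seg[OF bigraphD(4)[OF G]] by metis
  have "card (f ` verts G) = card (verts G)" by (rule card_image[OF f(2)])
  hence n: "n = card (verts G)" using f(1) by simp
  have iso: "bigraph_iso f G (relabel f G)" by (rule bigraph_iso_relabel[OF f(2)])
  have "verts (relabel f G) \<subseteq> {..<card (verts G)}" using bigraph_isoD(4)[OF iso] f(1) n by auto
  thus thesis using that iso bigraph_iso_bigraph[OF iso G] by blast
qed

text \<open>The minimal form has vertices of type \<open>mvert\<close>, while its class consists of
  graphs on natural numbers. A reduced core is isomorphic to its minimal form and provides a copy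
  there.\<close>

lemma iso_class_nonempty:
  assumes G: "core G"
  shows "\<exists>H. H \<in> iso_class (minimal_form G)"
proof -
  obtain K :: "'a bigraph" where K: "core K" "total_excess K = 0" "iso_class (minimal_form K) = iso_class (minimal_form G)"
    using reduce_to_zero_excess[OF G] by blast
  obtain g where g: "bigraph_iso g (minimal_form K) K" by (rule zero_excess_iso[OF K(1,2)])
  obtain f and H :: "nat bigraph" where "bigraph_iso f K H" "bigraph H"
    by (rule core_nat_copy[OF coreD(1)[OF K(1)]])
  hence "H \<in> iso_class (minimal_form K)" using bigraph_iso_trans[OF g] by (auto simp: iso_class_def)
  thus ?thesis using K(3) by blast
qed

text \<open>\<open>H\<close> is isomorphic to every core of excess 0 over the same basic graph, in
  particular to one obtained from \<open>G\<close> by contractions, which carries the invariants of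
  \<open>G\<close>. Hence nothing depends on the member of the class that is chosen.\<close>

lemma representative:
  fixes G :: "'v bigraph" and H :: "nat bigraph"
  assumes G: "core G" and H: "H \<in> iso_class (minimal_form G)"
  shows "core H" "iso_class (minimal_form H) = iso_class (minimal_form G)"
    "card (lverts G) = card (lverts H) + total_excess G" "card (rverts G) = card (rverts H) + total_excess G"
    "card (slots G) = card (slots H)" "betti G = betti H"
    "total_excess G = 0 \<Longrightarrow> \<exists>f. bigraph_iso f H G"
proof -
  obtain K :: "'v bigraph" where K: "core K" "total_excess K = 0"
    "iso_class (minimal_form K) = iso_class (minimal_form G)" "card (slots K) = card (slots G)"
    "betti K = betti G" "card (lverts G) = card (lverts K) + total_excess G"
    "card (rverts G) = card (rverts K) + total_excess G"
    using reduce_to_zero_excess[OF G] by blast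
  have zero: "\<exists>f. bigraph_iso f L H"
    if L: "core L" "total_excess L = 0" "iso_class (minimal_form L) = iso_class (minimal_form G)" for L :: "'v bigraph"
  proof -
    obtain g where g: "bigraph_iso g (minimal_form L) L" by (rule zero_excess_iso[OF L(1,2)])
    obtain h where h: "bigraph_iso h (minimal_form L) H" using H L(3) by (auto simp: iso_class_def)
    show ?thesis
      using bigraph_iso_trans[OF bigraph_iso_inverse[OF g minimal_form_edges_Pow[OF L(1)]] h] by blast
  qed
  obtain f where f: "bigraph_iso f K H" using zero[OF K(1-3)] by blast
  note I = bigraph_iso_cards[OF f coreD(1)[OF K(1)]] and J = bigraph_iso_minimal_form[OF f K(1)]
  show "core H" by (rule bigraph_iso_core[OF f K(1)])
  show "iso_class (minimal_form H) = iso_class (minimal_form G)" using J(1) K(3) by simp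
  show "card (lverts G) = card (lverts H) + total_excess G" "card (rverts G) = card (rverts H) + total_excess G"
    using K I by simp_all
  show "card (slots G) = card (slots H)" "betti G = betti H" using K I J by simp_all
  show "\<exists>f. bigraph_iso f H G" if z: "total_excess G = 0"
    using zero[OF G z refl] bigraph_iso_inverse bigraph_edges_Pow[OF coreD(1)[OF G]] by blast
qed

section \<open>Initial value and recurrence for the numbers of labelled cores\<close>

section \<open>The number of cores with a given basic graph\<close>

definition n_cores :: "nat bigraph set \<Rightarrow> nat \<Rightarrow> nat \<Rightarrow> nat" where
  "n_cores B a b = card (cores_of B (Inl ` {..<a}) (Inr ` {..<b}) :: (nat + nat) bigraph set)"

lemma card_cores_of:
  assumes "finite R" "finite S" "R \<inter> S = {}"
  shows "card (cores_of B R S) = n_cores B (card R) (card S)"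
  unfolding n_cores_def
  by (rule card_cores_of_cong) (use assms in \<open>auto simp: card_image\<close>)

text \<open>Cores with the side sizes of \<open>H\<close> have excess 0, so they are precisely the
  graphs isomorphic to \<open>H\<close>, and orbit counting applies.\<close>

lemma n_cores_base:
  fixes G :: "'v bigraph"
  assumes G: "core G" and H: "H \<in> iso_class (minimal_form G)"
  shows "n_cores (iso_class (minimal_form G)) (card (lverts H)) (card (rverts H)) * card (automorphisms H)
    = fact (card (lverts H)) * fact (card (rverts H))"
proof -
  note R = representative[OF G H]
  let ?R = "Inl ` {..<card (lverts H)} :: (nat + nat) set" and ?S = "Inr ` {..<card (rverts H)} :: (nat + nat) set"
  have c: "card ?R = card (lverts H)" "card ?S = card (rverts H)" by (simp_all add: card_image)
  have "cores_of (iso_class (minimal_form G)) ?R ?S = {K. lverts K = ?R \<and> rverts K = ?S \<and> (\<exists>f. bigraph_iso f H K)}"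
  proof (intro equalityI subsetI)
    fix K assume "K \<in> cores_of (iso_class (minimal_form G)) ?R ?S"
    hence K: "lverts K = ?R" "rverts K = ?S" "core K" "iso_class (minimal_form K) = iso_class (minimal_form G)"
      by (simp_all add: cores_of_def)
    have HK: "H \<in> iso_class (minimal_form K)" using H K(4) by simp
    have "total_excess K = 0" using representative(3)[OF K(3) HK] K(1) c by simp
    thus "K \<in> {K. lverts K = ?R \<and> rverts K = ?S \<and> (\<exists>f. bigraph_iso f H K)}"
      using representative(7)[OF K(3) HK] K by simp
  next
    fix K assume "K \<in> {K. lverts K = ?R \<and> rverts K = ?S \<and> (\<exists>f. bigraph_iso f H K)}"
    then obtain f where K: "lverts K = ?R" "rverts K = ?S" "bigraph_iso f H K" by blast
    have "core K" by (rule bigraph_iso_core[OF K(3) R(1)])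
    moreover have "iso_class (minimal_form K) = iso_class (minimal_form G)"
      using bigraph_iso_minimal_form(1)[OF K(3) R(1)] R(2) by simp
    ultimately show "K \<in> cores_of (iso_class (minimal_form G)) ?R ?S"
      using K coreD(1) by (simp add: cores_of_def)
  qed
  moreover have "card {K. lverts K = ?R \<and> rverts K = ?S \<and> (\<exists>f. bigraph_iso f H K)} * card (automorphisms H)
     = fact (card ?R) * fact (card ?S)"
    by (rule card_isomorphic_graphs) (use coreD(1)[OF R(1)] c in auto)
  ultimately show ?thesis by (simp add: n_cores_def c)
qed

lemma n_cores_nonzero:
  fixes G :: "'v bigraph"
  assumes G: "core G" and H: "H \<in> iso_class (minimal_form G)"
    and n: "n_cores (iso_class (minimal_form G)) a b \<noteq> 0"
  shows "\<exists>m. a = card (lverts H) + m \<and> b = card (rverts H) + m"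
proof -
  let ?B = "iso_class (minimal_form G)"
  obtain K where "K \<in> (cores_of ?B (Inl ` {..<a}) (Inr ` {..<b}) :: (nat + nat) bigraph set)"
    using n unfolding n_cores_def by (metis card.empty ex_in_conv)
  hence K: "lverts K = Inl ` {..<a}" "rverts K = Inr ` {..<b}" "core K" "iso_class (minimal_form K) = ?B"
    by (simp_all add: cores_of_def)
  have HK: "H \<in> iso_class (minimal_form K)" using H K(4) by simp
  show ?thesis using representative(3,4)[OF K(3) HK] K(1,2) by (intro exI[of _ "total_excess K"]) (simp add: card_image)
qed

text \<open>The side sizes fix the excess, and the basic graph fixes the number of slots, so both
  sides of \<open>double_count\<close> are sums of constants: the excess is \<open>Suc m\<close> on
  the full vertex sets and \<open>m\<close> after removing one vertex from each side, for which
  there are \<open>a * b\<close> choices.\<close>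

lemma n_cores_step:
  fixes G :: "'v bigraph"
  assumes G: "core G" and H: "H \<in> iso_class (minimal_form G)"
    and a: "a = card (lverts H) + Suc m" and b: "b = card (rverts H) + Suc m"
  defines "B \<equiv> iso_class (minimal_form G)"
  shows "Suc m * n_cores B a b = a * b * (m + card (slots H)) * n_cores B (a - 1) (b - 1)"
proof -
  let ?R = "Inl ` {..<a} :: (nat + nat) set" and ?S = "Inr ` {..<b} :: (nat + nat) set"
  have c: "card ?R = a" "card ?S = b" by (simp_all add: card_image)
  have te: "total_excess K = card R - card (lverts H) \<and> card (slots K) = card (slots H)"
    if "K \<in> cores_of B R S" for K and R S :: "(nat + nat) set"
  proof -
    have K: "lverts K = R" "core K" "iso_class (minimal_form K) = B" using that by (simp_all add: cores_of_def)
    have HK: "H \<in> iso_class (minimal_form K)" using H K(3) by (simp add: B_def)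
    show ?thesis using representative(3,5)[OF K(2) HK] K(1) by simp
  qed
  have l: "(\<Sum>K\<in>cores_of B ?R ?S. of_nat (total_excess K)) = (of_nat (Suc m * n_cores B a b) :: rat)"
  proof -
    have "(\<Sum>K\<in>cores_of B ?R ?S. of_nat (total_excess K)) = (\<Sum>K\<in>cores_of B ?R ?S. of_nat (Suc m) :: rat)"
      by (rule sum.cong[OF refl]) (use te[of _ ?R ?S] c a in simp)
    thus ?thesis by (simp add: n_cores_def algebra_simps)
  qed
  have r: "(\<Sum>K\<in>cores_of B (?R - {fst p}) (?S - {snd p}). of_nat (total_excess K + card (slots K)))
      = (of_nat ((m + card (slots H)) * n_cores B (a - 1) (b - 1)) :: rat)" if p: "p \<in> ?R \<times> ?S" for p
  proof -
    have cc: "card (?R - {fst p}) = a - 1" "card (?S - {snd p}) = b - 1"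
      using p c by (auto simp: card_Diff_singleton)
    have "(\<Sum>K\<in>cores_of B (?R - {fst p}) (?S - {snd p}). of_nat (total_excess K + card (slots K)))
       = (\<Sum>K\<in>cores_of B (?R - {fst p}) (?S - {snd p}). of_nat (m + card (slots H)) :: rat)"
      by (rule sum.cong[OF refl]) (use te[of _ "?R - {fst p}" "?S - {snd p}"] cc a in simp)
    also have "\<dots> = of_nat ((m + card (slots H)) * card (cores_of B (?R - {fst p}) (?S - {snd p})))"
      by (simp add: mult.commute)
    also have "card (cores_of B (?R - {fst p}) (?S - {snd p})) = n_cores B (a - 1) (b - 1)"
      using card_cores_of[of "?R - {fst p}" "?S - {snd p}" B] cc by auto
    finally show ?thesis .
  qed
  have "of_nat (Suc m * n_cores B a b) = (\<Sum>p\<in>?R \<times> ?S. of_nat ((m + card (slots H)) * n_cores B (a - 1) (b - 1)) :: rat)"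
    unfolding l[symmetric] double_count[of ?R ?S B, OF _ _ Inl_Inr_image_disjoint, simplified]
    by (rule sum.cong[OF refl]) (use r in simp)
  also have "\<dots> = of_nat (a * b * (m + card (slots H)) * n_cores B (a - 1) (b - 1))"
    by (simp add: card_cartesian_product c algebra_simps)
  finally show ?thesis by (simp only: of_nat_eq_iff)
qed

section \<open>Forests with prescribed roots: union and splitting\<close>

section \<open>Forests\<close>

text \<open>\<open>forest A B R S X\<close>: the edge set \<open>X\<close> on the vertices \<open>R\<close>, \<open>S\<close> is a forest each of whose
  trees contains exactly one of the roots \<open>A\<close>, \<open>B\<close>.\<close>

inductive forest :: "'v set \<Rightarrow> 'v set \<Rightarrow> 'v set \<Rightarrow> 'v set \<Rightarrow> 'v set set \<Rightarrow> bool" for A B where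
  roots: "forest A B A B {}"
| addl: "forest A B R S X \<Longrightarrow> v \<notin> R \<union> S \<Longrightarrow> u \<in> S \<Longrightarrow> forest A B (insert v R) S (insert {v, u} X)"
| addr: "forest A B R S X \<Longrightarrow> v \<notin> R \<union> S \<Longrightarrow> u \<in> R \<Longrightarrow> forest A B R (insert v S) (insert {u, v} X)"

lemma forest_subset: "forest A B R S X \<Longrightarrow> A \<subseteq> R \<and> B \<subseteq> S"
  by (induction rule: forest.induct) auto

lemma forest_edge: "forest A B R S X \<Longrightarrow> e \<in> X \<Longrightarrow> \<exists>a b. a \<in> R \<and> b \<in> S \<and> e = {a, b}"
proof (induction rule: forest.induct)
  case (addl R S X v u)
  thus ?case by (cases "e = {v, u}") blast+
next
  case (addr R S X v u)
  thus ?case by (cases "e = {u, v}") blast+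
qed simp

lemma forest_edge_subset: "forest A B R S X \<Longrightarrow> e \<in> X \<Longrightarrow> e \<subseteq> R \<union> S"
  using forest_edge by fast

lemma forest_edge_new: "forest A B R S X \<Longrightarrow> e \<in> X \<Longrightarrow> \<not> e \<subseteq> A \<union> B"
proof (induction rule: forest.induct)
  case (addl R S X v u)
  have "v \<notin> A \<union> B" using forest_subset[OF addl(1)] addl(2) by blast
  thus ?case using addl by auto
next
  case (addr R S X v u)
  have "v \<notin> A \<union> B" using forest_subset[OF addr(1)] addr(2) by blast
  thus ?case using addr by auto
qed simp

lemma forest_reach:
  "forest A B R S X \<Longrightarrow> x \<in> R \<union> S \<Longrightarrow> \<exists>a\<in>A \<union> B. (\<lambda>p q. {p, q} \<in> X)\<^sup>*\<^sup>* a x"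
proof (induction arbitrary: x rule: forest.induct)
  case (roots x)
  thus ?case by blast
next
  case (addl R S X v u)
  have mono: "(\<lambda>p q. {p, q} \<in> X)\<^sup>*\<^sup>* a y \<Longrightarrow> (\<lambda>p q. {p, q} \<in> insert {v, u} X)\<^sup>*\<^sup>* a y" for a y
    by (erule rtranclp_mono[THEN predicate2D, rotated]) auto
  show ?case
  proof (cases "x = v")
    case True
    obtain a where "a \<in> A \<union> B" "(\<lambda>p q. {p, q} \<in> X)\<^sup>*\<^sup>* a u" using addl.IH[of u] addl.hyps by blast
    hence "(\<lambda>p q. {p, q} \<in> insert {v, u} X)\<^sup>*\<^sup>* a v"
      by (intro rtranclp.rtrancl_into_rtrancl[OF mono]) (auto simp: insert_commute)
    thus ?thesis using \<open>a \<in> A \<union> B\<close> True by blast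
  next
    case False
    then obtain a where "a \<in> A \<union> B" "(\<lambda>p q. {p, q} \<in> X)\<^sup>*\<^sup>* a x" using addl.IH[of x] addl.prems by blast
    thus ?thesis using mono by blast
  qed
next
  case (addr R S X v u)
  have mono: "(\<lambda>p q. {p, q} \<in> X)\<^sup>*\<^sup>* a y \<Longrightarrow> (\<lambda>p q. {p, q} \<in> insert {u, v} X)\<^sup>*\<^sup>* a y" for a y
    by (erule rtranclp_mono[THEN predicate2D, rotated]) auto
  show ?case
  proof (cases "x = v")
    case True
    obtain a where "a \<in> A \<union> B" "(\<lambda>p q. {p, q} \<in> X)\<^sup>*\<^sup>* a u" using addr.IH[of u] addr.hyps by blast
    hence "(\<lambda>p q. {p, q} \<in> insert {u, v} X)\<^sup>*\<^sup>* a v"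
      by (intro rtranclp.rtrancl_into_rtrancl[OF mono]) auto
    thus ?thesis using \<open>a \<in> A \<union> B\<close> True by blast
  next
    case False
    then obtain a where "a \<in> A \<union> B" "(\<lambda>p q. {p, q} \<in> X)\<^sup>*\<^sup>* a x" using addr.IH[of x] addr.prems by blast
    thus ?thesis using mono by blast
  qed
qed

lemma forest_trans:
  assumes "forest R S R' S' Y" "forest A B R S X"
  shows "forest A B R' S' (X \<union> Y)"
  using assms by (induction rule: forest.induct) (auto intro: forest.intros)

lemma forest_frame:
  "forest A B R S X \<Longrightarrow> (C \<union> D) \<inter> (R \<union> S) = {} \<Longrightarrow> forest (A \<union> C) (B \<union> D) (R \<union> C) (S \<union> D) X"
proof (induction rule: forest.induct)
  case roots
  show ?case by (rule forest.roots)
next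
  case (addl R S X v u)
  have "forest (A \<union> C) (B \<union> D) (insert v (R \<union> C)) (S \<union> D) (insert {v, u} X)"
    by (rule forest.addl) (use addl in auto)
  thus ?case by simp
next
  case (addr R S X v u)
  have "forest (A \<union> C) (B \<union> D) (R \<union> C) (insert v (S \<union> D)) (insert {u, v} X)"
    by (rule forest.addr) (use addr in auto)
  thus ?case by simp
qed

text \<open>\<open>X\<close> is grown with \<open>C\<close> and \<open>D\<close> as additional idle
  roots, and everything reached so far serves as the roots from which \<open>Y\<close> is
  grown.\<close>

lemma forest_union:
  assumes X: "forest A B R S X" and Y: "forest C D R' S' Y" and d: "(R \<union> S) \<inter> (R' \<union> S') = {}"
  shows "forest (A \<union> C) (B \<union> D) (R \<union> R') (S \<union> S') (X \<union> Y)"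
proof -
  have "forest (A \<union> C) (B \<union> D) (R \<union> C) (S \<union> D) X"
    by (rule forest_frame[OF X]) (use forest_subset[OF Y] d in blast)
  moreover have "forest (C \<union> R) (D \<union> S) (R' \<union> R) (S' \<union> S) Y"
    by (rule forest_frame[OF Y]) (use d in blast)
  hence "forest (R \<union> C) (S \<union> D) (R \<union> R') (S \<union> S') Y" by (simp only: Un_commute)
  ultimately show ?thesis by (rule forest_trans[rotated])
qed

text \<open>Each new vertex joins the part that contains its parent, so the two parts stay
  disjoint.\<close>

lemma forest_split:
  "forest A B R S X \<Longrightarrow> A = A1 \<union> A2 \<Longrightarrow> B = B1 \<union> B2 \<Longrightarrow> (A1 \<union> B1) \<inter> (A2 \<union> B2) = {} \<Longrightarrow>
    \<exists>R1 R2 S1 S2 X1 X2. forest A1 B1 R1 S1 X1 \<and> forest A2 B2 R2 S2 X2 \<and> R = R1 \<union> R2 \<and> S = S1 \<union> S2 \<and>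
      X = X1 \<union> X2 \<and> (R1 \<union> S1) \<inter> (R2 \<union> S2) = {}"
proof (induction rule: forest.induct)
  case roots
  thus ?case using forest.roots[of A1 B1] forest.roots[of A2 B2] by blast
next
  case (addl R S X v u)
  then obtain R1 R2 S1 S2 X1 X2 where F: "forest A1 B1 R1 S1 X1" "forest A2 B2 R2 S2 X2" and
    e: "R = R1 \<union> R2" "S = S1 \<union> S2" "X = X1 \<union> X2" "(R1 \<union> S1) \<inter> (R2 \<union> S2) = {}" by blast
  show ?case
  proof (cases "u \<in> S1")
    case True
    have "forest A1 B1 (insert v R1) S1 (insert {v, u} X1)"
      by (rule forest.addl[OF F(1)]) (use addl.hyps e True in auto)
    moreover have "insert v R = insert v R1 \<union> R2" "insert {v, u} X = insert {v, u} X1 \<union> X2" using e by auto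
    moreover have "(insert v R1 \<union> S1) \<inter> (R2 \<union> S2) = {}" using e addl.hyps by auto
    ultimately show ?thesis using F(2) e(2) by blast
  next
    case False
    have "forest A2 B2 (insert v R2) S2 (insert {v, u} X2)"
      by (rule forest.addl[OF F(2)]) (use addl.hyps e False in auto)
    moreover have "insert v R = R1 \<union> insert v R2" "insert {v, u} X = X1 \<union> insert {v, u} X2" using e by auto
    moreover have "(R1 \<union> S1) \<inter> (insert v R2 \<union> S2) = {}" using e addl.hyps by auto
    ultimately show ?thesis using F(1) e(2) by blast
  qed
next
  case (addr R S X v u)
  then obtain R1 R2 S1 S2 X1 X2 where F: "forest A1 B1 R1 S1 X1" "forest A2 B2 R2 S2 X2" and
    e: "R = R1 \<union> R2" "S = S1 \<union> S2" "X = X1 \<union> X2" "(R1 \<union> S1) \<inter> (R2 \<union> S2) = {}" by blast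
  show ?case
  proof (cases "u \<in> R1")
    case True
    have "forest A1 B1 R1 (insert v S1) (insert {u, v} X1)"
      by (rule forest.addr[OF F(1)]) (use addr.hyps e True in auto)
    moreover have "insert v S = insert v S1 \<union> S2" "insert {u, v} X = insert {u, v} X1 \<union> X2" using e by auto
    moreover have "(R1 \<union> insert v S1) \<inter> (R2 \<union> S2) = {}" using e addr.hyps by auto
    ultimately show ?thesis using F(2) e(1) by blast
  next
    case False
    have "forest A2 B2 R2 (insert v S2) (insert {u, v} X2)"
      by (rule forest.addr[OF F(2)]) (use addr.hyps e False in auto)
    moreover have "insert v S = S1 \<union> insert v S2" "insert {u, v} X = X1 \<union> insert {u, v} X2" using e by auto
    moreover have "(R1 \<union> S1) \<inter> (R2 \<union> insert v S2) = {}" using e addr.hyps by auto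
    ultimately show ?thesis using F(1) e(1) by blast
  qed
qed

text \<open>Hence the union of two disjoint forests determines both of them.\<close>

lemma forest_split_reach:
  assumes X: "forest A B R S X" and Y: "forest C D R' S' Y" and d: "(R \<union> S) \<inter> (R' \<union> S') = {}"
  shows "R \<union> S = {x. \<exists>a\<in>A \<union> B. (\<lambda>p q. {p, q} \<in> X \<union> Y)\<^sup>*\<^sup>* a x}" "X = {e \<in> X \<union> Y. e \<subseteq> R \<union> S}"
proof -
  \<comment> \<open>Edges of \<open>Y\<close> do not meet the vertices of the other forest, so walks
    from its roots never use them.\<close>
  have Yn: "\<not> e \<subseteq> R \<union> S" "e \<inter> (R \<union> S) = {}" if "e \<in> Y" for e
    using forest_edge[OF Y that] d by auto
  show "R \<union> S = {x. \<exists>a\<in>A \<union> B. (\<lambda>p q. {p, q} \<in> X \<union> Y)\<^sup>*\<^sup>* a x}"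
  proof (intro equalityI subsetI)
    fix x assume "x \<in> R \<union> S"
    then obtain a where "a \<in> A \<union> B" "(\<lambda>p q. {p, q} \<in> X)\<^sup>*\<^sup>* a x" using forest_reach[OF X] by blast
    moreover from this(2) have "(\<lambda>p q. {p, q} \<in> X \<union> Y)\<^sup>*\<^sup>* a x"
      by (rule rtranclp_mono[THEN predicate2D, rotated]) auto
    ultimately show "x \<in> {x. \<exists>a\<in>A \<union> B. (\<lambda>p q. {p, q} \<in> X \<union> Y)\<^sup>*\<^sup>* a x}" by blast
  next
    fix x assume "x \<in> {x. \<exists>a\<in>A \<union> B. (\<lambda>p q. {p, q} \<in> X \<union> Y)\<^sup>*\<^sup>* a x}"
    then obtain a where a: "a \<in> A \<union> B" "(\<lambda>p q. {p, q} \<in> X \<union> Y)\<^sup>*\<^sup>* a x" by blast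
    show "x \<in> R \<union> S" using a(2)
    proof induction
      case base
      show ?case using a(1) forest_subset[OF X] by blast
    next
      case (step y z)
      hence "{y, z} \<in> X" using Yn(2)[of "{y, z}"] by auto
      thus ?case using forest_edge_subset[OF X] by blast
    qed
  qed
  show "X = {e \<in> X \<union> Y. e \<subseteq> R \<union> S}"
    using forest_edge_subset[OF X] Yn(1) by blast
qed

lemma forest_image:
  assumes "forest A B R S X" "inj_on f (R \<union> S)"
  shows "forest (f ` A) (f ` B) (f ` R) (f ` S) ((\<lambda>e. f ` e) ` X)"
  using assms
proof (induction rule: forest.induct)
  case roots
  show ?case using forest.roots by simp
next
  case (addl R S X v u)
  have "inj_on f (R \<union> S)" by (rule inj_on_subset[OF addl.prems]) auto
  moreover have "f v \<notin> f ` R \<union> f ` S"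
    using addl.hyps(2) addl.prems by (auto simp: inj_on_def)
  ultimately show ?case using forest.addl[OF addl.IH, of "f v" "f u"] addl.hyps by simp
next
  case (addr R S X v u)
  have "inj_on f (R \<union> S)" by (rule inj_on_subset[OF addr.prems]) auto
  moreover have "f v \<notin> f ` R \<union> f ` S"
    using addr.hyps(2) addr.prems by (auto simp: inj_on_def)
  ultimately show ?case using forest.addr[OF addr.IH, of "f v" "f u"] addr.hyps by simp
qed

section \<open>Deletion of leaves, and uniqueness of the core\<close>

section \<open>Pruning\<close>

abbreviation prune_step :: "'v bigraph \<Rightarrow> 'v bigraph \<Rightarrow> bool" where
  "prune_step \<equiv> (\<lambda>A B. \<exists>v. leaf A v \<and> B = delete_vertex A v)"

lemma leafE:
  assumes G: "bigraph G" and l: "leaf G v"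
  obtains u where "u \<in> verts G" "u \<noteq> v" "{v, u} \<in> edges G" "{e \<in> edges G. v \<in> e} = {{v, u}}"
    "v \<in> lverts G \<longrightarrow> u \<in> rverts G" "v \<in> rverts G \<longrightarrow> u \<in> lverts G"
proof -
  have "card {e \<in> edges G. v \<in> e} = 1" using l by (simp add: leaf_def deg_def)
  then obtain e where e: "{e \<in> edges G. v \<in> e} = {e}" by (rule card_1_singletonE)
  hence "e \<in> {e \<in> edges G. v \<in> e}" by simp
  hence m: "e \<in> edges G" "v \<in> e" by simp_all
  obtain a b where ab: "a \<in> lverts G" "b \<in> rverts G" "e = {a, b}" "a \<noteq> b" by (rule edgeE[OF G m(1)])
  have dis: "lverts G \<inter> rverts G = {}" by (rule bigraphD(3)[OF G])
  show thesis
  proof (cases "v = a")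
    case True
    show thesis by (rule that[of b]) (use True ab m e dis in \<open>auto simp: verts_def\<close>)
  next
    case False
    hence "v = b" using m ab by simp
    show thesis by (rule that[of a]) (use \<open>v = b\<close> ab m e dis in \<open>auto simp: verts_def insert_commute\<close>)
  qed
qed

lemma delete_vertex_simps:
  "lverts (delete_vertex G v) = lverts G - {v}" "rverts (delete_vertex G v) = rverts G - {v}"
  "edges (delete_vertex G v) = {e \<in> edges G. v \<notin> e}" "verts (delete_vertex G v) = verts G - {v}"
  by (auto simp: delete_vertex_def verts_def)

lemma bigraph_delete_vertex:
  assumes "bigraph G"
  shows "bigraph (delete_vertex G v)"
proof -
  have "edges (delete_vertex G v) \<subseteq> {{a, b} | a b. a \<in> lverts G - {v} \<and> b \<in> rverts G - {v}}"
  proof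
    fix e assume "e \<in> edges (delete_vertex G v)"
    hence e: "e \<in> edges G" "v \<notin> e" by (simp_all add: delete_vertex_simps)
    obtain a b where "a \<in> lverts G" "b \<in> rverts G" "e = {a, b}" by (rule edgeE[OF assms e(1)])
    thus "e \<in> {{a, b} | a b. a \<in> lverts G - {v} \<and> b \<in> rverts G - {v}}" using e(2) by blast
  qed
  thus ?thesis using bigraphD[OF assms] unfolding bigraph_def delete_vertex_simps by auto
qed

lemma betti_delete_leaf:
  assumes G: "bigraph G" and l: "leaf G v"
  shows "betti (delete_vertex G v) = betti G"
proof -
  obtain u where u: "{e \<in> edges G. v \<in> e} = {{v, u}}" "{v, u} \<in> edges G" by (rule leafE[OF G l], rule that)
  have "edges (delete_vertex G v) = edges G - {e \<in> edges G. v \<in> e}" by (auto simp: delete_vertex_simps)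
  hence "edges (delete_vertex G v) = edges G - {{v, u}}" by (simp only: u(1))
  moreover have "card (edges G) > 0" "card (verts G) > 0"
    using u(2) l finite_edges[OF G] bigraphD(4)[OF G] by (auto simp: card_gt_0_iff leaf_def)
  ultimately show ?thesis using u(2) l
    by (simp add: betti_def delete_vertex_simps(4) leaf_def card_Diff_singleton)
qed

text \<open>Sending the leaf \<open>v\<close> to its only neighbour projects walks of
  \<open>G\<close> to walks that avoid \<open>v\<close>.\<close>

lemma connected_delete_leaf:
  assumes G: "bigraph G" and l: "leaf G v"
  shows "connected_bigraph (delete_vertex G v) \<longleftrightarrow> connected_bigraph G"
proof -
  obtain u where u: "u \<in> verts G" "u \<noteq> v" "{v, u} \<in> edges G" "{e \<in> edges G. v \<in> e} = {{v, u}}"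
    by (rule leafE[OF G l], rule that)
  let ?R = "\<lambda>a b. {a, b} \<in> edges G" and ?S = "\<lambda>a b. {a, b} \<in> edges (delete_vertex G v)"
  have only: "e = {v, u}" if "e \<in> edges G" "v \<in> e" for e
  proof -
    have "e \<in> {e \<in> edges G. v \<in> e}" using that by simp
    thus ?thesis unfolding u(4) by simp
  qed
  have vV: "v \<in> verts G" using l by (simp add: leaf_def)
  have mono: "?R\<^sup>*\<^sup>* a b" if "?S\<^sup>*\<^sup>* a b" for a b
    using that by (rule rtranclp_mono[THEN predicate2D, rotated]) (auto simp: delete_vertex_simps)
  define h where "h a = (if a = v then u else a)" for a
  have proj: "?S\<^sup>*\<^sup>* (h a) (h b)" if "?R\<^sup>*\<^sup>* a b" for a b
    using that
  proof induction
    case (step b c)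
    have "?S\<^sup>*\<^sup>* (h b) (h c)"
    proof (cases "b = v \<or> c = v")
      case True
      hence "{b, c} = {v, u}" using only[OF step(2)] by auto
      hence "h b = h c" by (auto simp: h_def doubleton_eq_iff)
      thus ?thesis by simp
    next
      case False
      hence "?S (h b) (h c)" using step(2) by (auto simp: h_def delete_vertex_simps)
      thus ?thesis by blast
    qed
    with step.IH show ?case by (rule rtranclp_trans)
  qed simp
  show ?thesis
  proof
    assume con: "connected_bigraph (delete_vertex G v)"
    have uv: "?R u v" "?R v u" using u(3) by (auto simp: insert_commute)
    have "?R\<^sup>*\<^sup>* a u \<and> ?R\<^sup>*\<^sup>* u a" if "a \<in> verts G" for a
    proof (cases "a = v")
      case True
      thus ?thesis using uv by blast
    next
      case False
      hence "?S\<^sup>*\<^sup>* a u" "?S\<^sup>*\<^sup>* u a"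
        using con that u(1,2) by (simp_all add: connected_bigraph_def delete_vertex_simps)
      thus ?thesis using mono by blast
    qed
    thus "connected_bigraph G"
      unfolding connected_bigraph_def using vV by (blast intro: rtranclp_trans)
  next
    assume con: "connected_bigraph G"
    have "?S\<^sup>*\<^sup>* a b" if "a \<in> verts G - {v}" "b \<in> verts G - {v}" for a b
    proof -
      have "?R\<^sup>*\<^sup>* a b" using con that by (simp add: connected_bigraph_def)
      from proj[OF this] show ?thesis using that by (simp add: h_def)
    qed
    thus "connected_bigraph (delete_vertex G v)"
      using u(1,2) unfolding connected_bigraph_def delete_vertex_simps(4) by blast
  qed
qed

lemma prune_steps_invariant:
  assumes "prune_step\<^sup>*\<^sup>* G H" "bigraph G"
  shows "bigraph H \<and> betti H = betti G \<and> (connected_bigraph H \<longleftrightarrow> connected_bigraph G)"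
  using assms
proof induction
  case (step A B)
  thus ?case using bigraph_delete_vertex betti_delete_leaf connected_delete_leaf by metis
qed simp

text \<open>A sequence of leaf deletions read backwards grows a forest rooted at the vertices of the
  remaining graph.\<close>

lemma prune_steps_forest:
  assumes "prune_step\<^sup>*\<^sup>* G H" "bigraph G"
  shows "\<exists>X. forest (lverts H) (rverts H) (lverts G) (rverts G) X \<and> edges G = edges H \<union> X"
  using assms
proof (induction rule: converse_rtranclp_induct)
  case base
  show ?case using forest.roots by blast
next
  case (step G K)
  then obtain v where v: "leaf G v" "K = delete_vertex G v" by blast
  obtain u where u: "u \<in> verts G" "u \<noteq> v" "{v, u} \<in> edges G" "{e \<in> edges G. v \<in> e} = {{v, u}}"
    "v \<in> lverts G \<longrightarrow> u \<in> rverts G" "v \<in> rverts G \<longrightarrow> u \<in> lverts G"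
    by (rule leafE[OF step(4) v(1)])
  obtain X where X: "forest (lverts H) (rverts H) (lverts K) (rverts K) X" "edges K = edges H \<union> X"
    using step(3) bigraph_delete_vertex[OF step(4)] v(2) by blast
  have "edges G = insert {v, u} (edges K)"
  proof -
    have "edges G = {e \<in> edges G. v \<in> e} \<union> edges K" unfolding v(2) delete_vertex_simps by auto
    thus ?thesis unfolding u(4) by simp
  qed
  hence E: "edges G = edges H \<union> insert {v, u} X" using X(2) by simp
  have dis: "lverts G \<inter> rverts G = {}" by (rule bigraphD(3)[OF step(4)])
  have nK: "v \<notin> lverts K \<union> rverts K" unfolding v(2) delete_vertex_simps by simp
  show ?case
  proof (cases "v \<in> lverts G")
    case True
    have lr: "lverts G = insert v (lverts K)" "rverts G = rverts K"
      using True dis unfolding v(2) delete_vertex_simps by auto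
    have "u \<in> rverts K" using u(5) True lr(2) by simp
    hence "forest (lverts H) (rverts H) (insert v (lverts K)) (rverts K) (insert {v, u} X)"
      by (rule forest.addl[OF X(1) nK])
    thus ?thesis using E unfolding lr by blast
  next
    case False
    hence vr: "v \<in> rverts G" using v(1) by (simp add: leaf_def verts_def)
    have lr: "lverts G = lverts K" "rverts G = insert v (rverts K)"
      using vr dis unfolding v(2) delete_vertex_simps by auto
    have "u \<in> lverts K" using u(6) vr lr(1) by simp
    hence "forest (lverts H) (rverts H) (lverts K) (insert v (rverts K)) (insert {u, v} X)"
      by (rule forest.addr[OF X(1) nK])
    moreover have "{u, v} = {v, u}" by (rule insert_commute)
    ultimately have "forest (lverts H) (rverts H) (lverts K) (insert v (rverts K)) (insert {v, u} X)"
      by (simp only:)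
    thus ?thesis using E unfolding lr by blast
  qed
qed

text \<open>The vertices of the forest can be deleted as leaves in the reverse order of their
  insertion; the edges of \<open>H\<close> do not interfere, as they contain no new vertex.\<close>

lemma forest_prune_steps:
  assumes "forest (lverts H) (rverts H) R S X" "bigraph H"
  shows "bigraph \<lparr>lverts = R, rverts = S, edges = edges H \<union> X\<rparr> \<and>
    prune_step\<^sup>*\<^sup>* \<lparr>lverts = R, rverts = S, edges = edges H \<union> X\<rparr> H"
  using assms
proof (induction rule: forest.induct)
  case roots
  have "\<lparr>lverts = lverts H, rverts = rverts H, edges = edges H \<union> {}\<rparr> = H" by simp
  thus ?case using roots by (simp only:) simp
next
  case (addl R S X v u)
  let ?G = "\<lparr>lverts = R, rverts = S, edges = edges H \<union> X\<rparr>"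
  let ?G' = "\<lparr>lverts = insert v R, rverts = S, edges = edges H \<union> insert {v, u} X\<rparr>"
  have G: "bigraph ?G" "prune_step\<^sup>*\<^sup>* ?G H" using addl by blast+
  have bg: "bigraph ?G'"
  proof -
    let ?K = "\<lambda>R S. {{a, b} | a b. a \<in> R \<and> b \<in> S}"
    have "edges H \<union> X \<subseteq> ?K R S" using G(1) by (simp add: bigraph_def)
    also have "\<dots> \<subseteq> ?K (insert v R) (S)" by blast
    finally have "edges H \<union> X \<subseteq> ?K (insert v R) (S)" .
    moreover have "{v, u} \<in> ?K (insert v R) (S)" using addl.hyps(3) by blast
    ultimately have "edges H \<union> insert {v, u} X \<subseteq> ?K (insert v R) (S)" by simp
    thus ?thesis using bigraphD(1-3)[OF G(1)] addl.hyps(2) by (auto simp: bigraph_def)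
  qed
  have n: "v \<notin> e" if "e \<in> edges H \<union> X" for e
    using edge_subset_verts[OF G(1), of e] that addl.hyps(2) by (auto simp: verts_def)
  have "{e \<in> edges ?G'. v \<in> e} = {{v, u}}" using n by auto
  hence "leaf ?G' v" by (simp add: leaf_def deg_def verts_def)
  moreover have "?G = delete_vertex ?G' v"
    using n addl.hyps(2) by (auto simp: delete_vertex_def)
  ultimately have "prune_step ?G' ?G" by blast
  thus ?case using bg G(2) by (blast intro: converse_rtranclp_into_rtranclp)
next
  case (addr R S X v u)
  let ?G = "\<lparr>lverts = R, rverts = S, edges = edges H \<union> X\<rparr>"
  let ?G' = "\<lparr>lverts = R, rverts = insert v S, edges = edges H \<union> insert {u, v} X\<rparr>"
  have G: "bigraph ?G" "prune_step\<^sup>*\<^sup>* ?G H" using addr by blast+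
  have bg: "bigraph ?G'"
  proof -
    let ?K = "\<lambda>R S. {{a, b} | a b. a \<in> R \<and> b \<in> S}"
    have "edges H \<union> X \<subseteq> ?K R S" using G(1) by (simp add: bigraph_def)
    also have "\<dots> \<subseteq> ?K (R) (insert v S)" by blast
    finally have "edges H \<union> X \<subseteq> ?K (R) (insert v S)" .
    moreover have "{u, v} \<in> ?K (R) (insert v S)" using addr.hyps(3) by blast
    ultimately have "edges H \<union> insert {u, v} X \<subseteq> ?K (R) (insert v S)" by simp
    thus ?thesis using bigraphD(1-3)[OF G(1)] addr.hyps(2) by (auto simp: bigraph_def)
  qed
  have n: "v \<notin> e" if "e \<in> edges H \<union> X" for e
    using edge_subset_verts[OF G(1), of e] that addr.hyps(2) by (auto simp: verts_def)
  have "{e \<in> edges ?G'. v \<in> e} = {{u, v}}" using n by auto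
  hence "leaf ?G' v" by (simp add: leaf_def deg_def verts_def)
  moreover have "?G = delete_vertex ?G' v"
    using n addr.hyps(2) by (auto simp: delete_vertex_def)
  ultimately have "prune_step ?G' ?G" by blast
  thus ?case using bg G(2) by (blast intro: converse_rtranclp_into_rtranclp)
qed

lemma connected_isolated:
  assumes con: "connected_bigraph G" and v: "v \<in> verts G" and d: "{e \<in> edges G. v \<in> e} = {}"
  shows "verts G = {v}"
proof -
  have "w = v" if w: "w \<in> verts G" for w
  proof -
    have "(\<lambda>a b. {a, b} \<in> edges G)\<^sup>*\<^sup>* v w" using con v w by (simp add: connected_bigraph_def)
    thus ?thesis by induction (use d in auto)
  qed
  thus ?thesis using v by blast
qed

lemma deg_pos_connected:
  assumes G: "bigraph G" "connected_bigraph G" and v: "v \<in> verts G" and w: "verts G \<noteq> {v}"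
  shows "deg G v > 0"
proof -
  have "{e \<in> edges G. v \<in> e} \<noteq> {}" using connected_isolated[OF G(2) v] w by blast
  thus ?thesis unfolding deg_def using finite_edges[OF G(1)] by (simp add: card_gt_0_iff)
qed

text \<open>If all degrees were 2, the degree sum would give as many edges as vertices, hence Betti
  number 1. A single vertex, which has no leaf either, has Betti number 0.\<close>

lemma leafless_core:
  assumes G: "bigraph G" "connected_bigraph G" and b: "betti G \<ge> 2" and nl: "\<nexists>v. leaf G v"
  shows "core G"
proof -
  have ne: "verts G \<noteq> {v}" for v
  proof
    assume v: "verts G = {v}"
    have "edges G = {}"
    proof (rule ccontr)
      assume "edges G \<noteq> {}"
      then obtain e where e: "e \<in> edges G" by blast
      obtain x y where "e = {x, y}" "x \<noteq> y" by (rule edgeE[OF G(1) e])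
      thus False using edge_subset_verts[OF G(1) e] v by auto
    qed
    thus False using b v by (simp add: betti_def)
  qed
  have d2: "deg G v \<ge> 2" if v: "v \<in> verts G" for v
  proof -
    have "deg G v \<noteq> 1" using nl v by (auto simp: leaf_def)
    thus ?thesis using deg_pos_connected[OF G v ne] by linarith
  qed
  have "\<exists>v. special G v"
  proof (rule ccontr)
    assume "\<not> ?thesis"
    hence "deg G v = 2" if "v \<in> verts G" for v using d2[OF that] that by (auto simp: special_def)
    hence "(\<Sum>v\<in>verts G. deg G v) = 2 * card (verts G)" by simp
    hence "card (edges G) = card (verts G)" using handshake[OF G(1)] by simp
    thus False using b by (simp add: betti_def)
  qed
  thus ?thesis using G d2 by (simp add: core_def)
qed

text \<open>The degree sum is at least twice the number of vertices plus one for every special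
  point. The bound on the number of special points is used for the finiteness of
  \<open>BG\<close>.\<close>

lemma core_special_bound:
  assumes G: "core G"
  shows "2 * (betti G - 1) \<ge> int (N_sp G)" "betti G \<ge> 2"
proof -
  note bg = coreD(1)[OF G]
  have fin: "finite (verts G)" by (rule bigraphD(4)[OF bg])
  have sub: "{v. special G v} = {v \<in> verts G. special G v}" by (auto simp: special_def)
  have "2 * card (verts G) + N_sp G = (\<Sum>v\<in>verts G. 2 + (if special G v then 1 else 0))"
  proof -
    have "(\<Sum>v\<in>verts G. if special G v then 1 else 0) = card {v \<in> verts G. special G v}"
      using fin by (simp add: sum.If_cases Int_def)
    thus ?thesis unfolding N_sp_def sub sum.distrib by simp
  qed
  also have "\<dots> \<le> (\<Sum>v\<in>verts G. deg G v)"
  proof (rule sum_mono)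
    fix v assume "v \<in> verts G"
    hence "2 \<le> deg G v" by (rule coreD(3)[OF G])
    thus "2 + (if special G v then 1 else 0) \<le> deg G v" by (simp add: special_def)
  qed
  also have "\<dots> = 2 * card (edges G)" by (rule handshake[OF bg])
  finally have le: "2 * card (verts G) + N_sp G \<le> 2 * card (edges G)" .
  thus 1: "2 * (betti G - 1) \<ge> int (N_sp G)" by (simp add: betti_def)
  obtain v where "special G v" using G by (auto simp: core_def)
  moreover have "finite {v. special G v}" unfolding sub using fin by simp
  ultimately have "N_sp G > 0" unfolding N_sp_def by (auto simp: card_gt_0_iff)
  hence "int (N_sp G) \<ge> 1" by simp
  thus "betti G \<ge> 2" using 1 by presburger
qed

lemma prune_steps_subgraph:
  assumes "prune_step\<^sup>*\<^sup>* G H" "bigraph G"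
  shows "lverts H \<subseteq> lverts G \<and> rverts H \<subseteq> rverts G \<and> edges H \<subseteq> edges G \<and>
    (\<forall>v. v \<notin> verts H \<longrightarrow> (\<forall>e\<in>edges H. v \<notin> e))"
  using assms
proof induction
  case base
  thus ?case using edge_subset_verts by blast
next
  case (step A B)
  then obtain v where "B = delete_vertex A v" by blast
  thus ?case using step.IH[OF step.prems] by (auto simp: delete_vertex_simps)
qed

text \<open>Vertices of \<open>K\<close> have degree at least 2 in every graph that contains
  \<open>K\<close>, so none of them is ever deleted as a leaf.\<close>

lemma core_survives_pruning:
  assumes K: "core K" and st: "prune_step\<^sup>*\<^sup>* G H" and G: "bigraph G"
    and sub: "verts K \<subseteq> verts G" "edges K \<subseteq> edges G"
  shows "verts K \<subseteq> verts H \<and> edges K \<subseteq> edges H"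
  using st
proof induction
  case base
  show ?case using sub by blast
next
  case (step A B)
  then obtain v where v: "leaf A v" "B = delete_vertex A v" by blast
  have bgA: "bigraph A" using prune_steps_invariant[OF step(1) G] by blast
  have vK: "v \<notin> verts K"
  proof
    assume "v \<in> verts K"
    hence "2 \<le> deg K v" by (rule coreD(3)[OF K])
    also have "deg K v \<le> deg A v" unfolding deg_def
      by (rule card_mono) (use finite_edges[OF bgA] step.IH in auto)
    finally show False using v(1) by (simp add: leaf_def)
  qed
  hence "v \<notin> e" if "e \<in> edges K" for e using edge_subset_verts[OF coreD(1)[OF K] that] by blast
  thus ?case using step.IH vK unfolding v(2) delete_vertex_simps by blast
qed

text \<open>Each of the two cores survives the pruning that leads to the other, so they contain each
  other.\<close>

lemma prune_steps_core_unique: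
  assumes G: "bigraph G" and H: "prune_step\<^sup>*\<^sup>* G H" "core H" and K: "prune_step\<^sup>*\<^sup>* G K" "core K"
  shows "H = K"
proof -
  have h: "lverts H \<subseteq> lverts G" "rverts H \<subseteq> rverts G" "edges H \<subseteq> edges G"
    using prune_steps_subgraph[OF H(1) G] by simp_all
  have k: "lverts K \<subseteq> lverts G" "rverts K \<subseteq> rverts G" "edges K \<subseteq> edges G"
    using prune_steps_subgraph[OF K(1) G] by simp_all
  have vs: "verts H \<subseteq> verts G" "verts K \<subseteq> verts G"
    unfolding verts_def by (rule Un_mono[OF h(1,2)], rule Un_mono[OF k(1,2)])
  note 1 = core_survives_pruning[OF H(2) K(1) G vs(1) h(3)]
  note 2 = core_survives_pruning[OF K(2) H(1) G vs(2) k(3)]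
  have e: "verts H = verts K" "edges H = edges K" using 1 2 by (simp_all add: subset_antisym)
  have d: "lverts G \<inter> rverts G = {}" by (rule bigraphD(3)[OF G])
  have lr: "lverts A = verts A \<inter> lverts G" "rverts A = verts A \<inter> rverts G"
    if "lverts A \<subseteq> lverts G" "rverts A \<subseteq> rverts G" for A
    using that d unfolding verts_def by blast+
  have "lverts H = lverts K" "rverts H = rverts K" using lr[OF h(1,2)] lr[OF k(1,2)] e(1) by simp_all
  thus ?thesis using e(2) by (intro bigraph.equality) auto
qed

lemma leafless_reduct:
  assumes "bigraph G"
  shows "\<exists>H. prune_step\<^sup>*\<^sup>* G H \<and> (\<nexists>v. leaf H v)"
  using assms
proof (induction "card (verts G)" arbitrary: G rule: less_induct)
  case less
  show ?case
  proof (cases "\<exists>v. leaf G v")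
    case True
    then obtain v where v: "leaf G v" by blast
    have "card (verts (delete_vertex G v)) < card (verts G)"
      using v bigraphD(4)[OF less.prems] unfolding delete_vertex_simps
      by (intro psubset_card_mono) (auto simp: leaf_def)
    then obtain H where "prune_step\<^sup>*\<^sup>* (delete_vertex G v) H" "\<nexists>v. leaf H v"
      using less.hyps bigraph_delete_vertex[OF less.prems] by blast
    moreover have "prune_step G (delete_vertex G v)" using v by blast
    ultimately show ?thesis
      using converse_rtranclp_into_rtranclp[of prune_step G "delete_vertex G v" H] by blast
  qed blast
qed

text \<open>Existence and uniqueness give meaning to the definite description in
  \<open>prune\<close>.\<close>

lemma prune_core:
  assumes G: "bigraph G" "connected_bigraph G" "betti G \<ge> 2"
  shows "prune_step\<^sup>*\<^sup>* G (prune G)" "core (prune G)"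
proof -
  let ?P = "\<lambda>H. prune_step\<^sup>*\<^sup>* G H \<and> (\<nexists>v. leaf H v)"
  have c: "core H" if "?P H" for H
    using leafless_core[of H] prune_steps_invariant[of G H] that G by metis
  obtain H where H: "?P H" using leafless_reduct[OF G(1)] by blast
  have "?P (prune G)" unfolding prune_def
  proof (rule theI[of ?P])
    show "?P H" by (rule H)
    fix K assume K: "?P K"
    show "K = H" using prune_steps_core_unique[OF G(1), of K H] K H c[OF K] c[OF H] by blast
  qed
  thus "prune_step\<^sup>*\<^sup>* G (prune G)" "core (prune G)" using c by blast+
qed

lemma prune_eq_core:
  assumes G: "bigraph G" and H: "prune_step\<^sup>*\<^sup>* G H" "core H"
  shows "prune G = H" "connected_bigraph G" "betti G = betti H"
proof -
  note i = prune_steps_invariant[OF H(1) G]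
  show con: "connected_bigraph G" and b: "betti G = betti H" using i coreD(2)[OF H(2)] by auto
  have "betti G \<ge> 2" using core_special_bound(2)[OF H(2)] b by simp
  from prune_core[OF G con this] show "prune G = H"
    using prune_steps_core_unique[OF G _ _ H] by blast
qed

lemma prune_of_core: "core G \<Longrightarrow> prune G = G"
  by (rule prune_eq_core(1)) (auto dest: coreD)

unbundle fps_syntax

section \<open>Exponential generating functions of rooted forests\<close>

section \<open>Counting forests\<close>

lemma finite_forests: "finite R \<Longrightarrow> finite S \<Longrightarrow> finite {X. forest A B R S X}"
  by (rule finite_subset[of _ "Pow (Pow (R \<union> S))"]) (auto dest: forest_edge_subset)

lemma ex_bij_betw_subset:
  assumes "finite R" "finite R'" "A \<subseteq> R" "A' \<subseteq> R'" "card A = card A'" "card R = card R'"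
  obtains g where "bij_betw g R R'" "g ` A = A'"
proof -
  have fin: "finite A" "finite A'" "finite (R - A)" "finite (R' - A')"
    using assms finite_subset by auto
  obtain g1 where g1: "bij_betw g1 A A'" using finite_same_card_bij[OF fin(1,2) assms(5)] by blast
  have "card (R - A) = card (R' - A')" using assms fin by (simp add: card_Diff_subset)
  then obtain g2 where g2: "bij_betw g2 (R - A) (R' - A')" using finite_same_card_bij[OF fin(3,4)] by blast
  let ?g = "\<lambda>x. if x \<in> A then g1 x else g2 x"
  have "bij_betw ?g (A \<union> (R - A)) (A' \<union> (R' - A'))"
    by (rule bij_betw_disjoint_Un[OF g1 g2]) auto
  moreover have "A \<union> (R - A) = R" "A' \<union> (R' - A') = R'" using assms by auto
  ultimately have "bij_betw ?g R R'" by simp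
  moreover have "?g ` A = A'" using g1 by (simp add: bij_betw_def)
  ultimately show thesis by (rule that)
qed

lemma card_forests_le:
  fixes R S :: "'v set" and R' S' :: "'w set"
  assumes fin: "finite R" "finite S" "finite R'" "finite S'" and sub: "A \<subseteq> R" "B \<subseteq> S" "A' \<subseteq> R'" "B' \<subseteq> S'"
    and d: "R \<inter> S = {}" "R' \<inter> S' = {}"
    and c: "card A = card A'" "card B = card B'" "card R = card R'" "card S = card S'"
  shows "card {X. forest A B R S X} \<le> card {X. forest A' B' R' S' X}"
proof -
  obtain g where g: "bij_betw g R R'" "g ` A = A'" by (rule ex_bij_betw_subset[OF fin(1,3) sub(1,3) c(1,3)])
  obtain h where h: "bij_betw h S S'" "h ` B = B'" by (rule ex_bij_betw_subset[OF fin(2,4) sub(2,4) c(2,4)])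
  define f where "f x = (if x \<in> R then g x else h x)" for x
  have b: "bij_betw f (R \<union> S) (R' \<union> S')"
    unfolding f_def by (rule bij_betw_disjoint_Un[OF g(1) h(1) d])
  hence inj: "inj_on f (R \<union> S)" by (simp add: bij_betw_def)
  have fR: "f ` Y = g ` Y" if "Y \<subseteq> R" for Y by (rule image_cong[OF refl]) (use that in \<open>auto simp: f_def\<close>)
  have fS: "f ` Y = h ` Y" if "Y \<subseteq> S" for Y by (rule image_cong[OF refl]) (use that d in \<open>auto simp: f_def\<close>)
  have im: "f ` A = A'" "f ` B = B'" "f ` R = R'" "f ` S = S'"
    using fR[OF sub(1)] fS[OF sub(2)] fR[of R] fS[of S] g h by (simp_all add: bij_betw_def)
  show ?thesis
  proof (rule card_inj_on_le[of "\<lambda>X. (\<lambda>e. f ` e) ` X"])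
    show "inj_on (\<lambda>X. (\<lambda>e. f ` e) ` X) {X. forest A B R S X}"
      by (rule inj_on_subset[OF inj_on_image_Pow[OF inj_on_image_Pow[OF inj]]]) (auto dest: forest_edge_subset)
    show "(\<lambda>X. (\<lambda>e. f ` e) ` X) ` {X. forest A B R S X} \<subseteq> {X. forest A' B' R' S' X}"
      using forest_image[OF _ inj, of A B] by (auto simp: im)
    show "finite {X. forest A' B' R' S' X}" by (rule finite_forests[OF fin(3,4)])
  qed
qed

text \<open>\<open>a\<close> and \<open>b\<close> count the roots on the two sides, \<open>m\<close>
  and \<open>n\<close> the further vertices. Separating the two is what makes the generating
  function multiplicative in the roots.\<close>

definition n_forests :: "nat \<Rightarrow> nat \<Rightarrow> nat \<Rightarrow> nat \<Rightarrow> nat" where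
  "n_forests a b m n = card {X :: (nat + nat) set set.
     forest (Inl ` {..<a}) (Inr ` {..<b}) (Inl ` {..<a + m}) (Inr ` {..<b + n}) X}"

lemma card_forests:
  assumes fin: "finite R" "finite S" and sub: "A \<subseteq> R" "B \<subseteq> S" and d: "R \<inter> S = {}"
    and c: "card A = a" "card B = b" "card R = a + m" "card S = b + n"
  shows "card {X. forest A B R S X} = n_forests a b m n"
  unfolding n_forests_def
  by (intro antisym card_forests_le) (use assms in \<open>auto simp: card_image\<close>)

text \<open>A forest whose roots are of two kinds splits uniquely into the parts grown from them;
  \<open>p\<close> records the non-root vertices that fall to the first kind.\<close>

lemma forests_product:
  fixes A1 :: "'v set"
  assumes fin: "finite M" "finite N" "finite A1" "finite A2" "finite B1" "finite B2"
    and d: "(A1 \<union> A2 \<union> M) \<inter> (B1 \<union> B2 \<union> N) = {}" "A1 \<inter> A2 = {}" "B1 \<inter> B2 = {}"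
      "M \<inter> (A1 \<union> A2) = {}" "N \<inter> (B1 \<union> B2) = {}"
  shows "card {X. forest (A1 \<union> A2) (B1 \<union> B2) (A1 \<union> A2 \<union> M) (B1 \<union> B2 \<union> N) X} =
    (\<Sum>p\<in>Pow M \<times> Pow N. card {X. forest A1 B1 (A1 \<union> fst p) (B1 \<union> snd p) X} *
       card {X. forest A2 B2 (A2 \<union> (M - fst p)) (B2 \<union> (N - snd p)) X})"
proof -
  define F1 where "F1 p = {X. forest A1 B1 (A1 \<union> fst p) (B1 \<union> snd p) X}" for p
  define F2 where "F2 p = {X. forest A2 B2 (A2 \<union> (M - fst p)) (B2 \<union> (N - snd p)) X}" for p
  define Z where "Z = {X. forest (A1 \<union> A2) (B1 \<union> B2) (A1 \<union> A2 \<union> M) (B1 \<union> B2 \<union> N) X}"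
  define D where "D = Sigma (Pow M \<times> Pow N) (\<lambda>p. F1 p \<times> F2 p)"
  have dj: "(A1 \<union> fst p \<union> (B1 \<union> snd p)) \<inter> (A2 \<union> (M - fst p) \<union> (B2 \<union> (N - snd p))) = {}"
    if "p \<in> Pow M \<times> Pow N" for p
  proof -
    have "fst p \<subseteq> M" "snd p \<subseteq> N" using that by auto
    thus ?thesis using d by blast
  qed
  have "bij_betw (\<lambda>x. fst (snd x) \<union> snd (snd x)) D Z"
    unfolding bij_betw_def
  proof
    show "inj_on (\<lambda>x. fst (snd x) \<union> snd (snd x)) D"
    proof (rule inj_onI)
      fix x y assume xy: "x \<in> D" "y \<in> D" "fst (snd x) \<union> snd (snd x) = fst (snd y) \<union> snd (snd y)"
      obtain p X Y where x: "x = (p, X, Y)" by (metis prod.exhaust)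
      obtain q X' Y' where y: "y = (q, X', Y')" by (metis prod.exhaust)
      have px: "p \<in> Pow M \<times> Pow N" "forest A1 B1 (A1 \<union> fst p) (B1 \<union> snd p) X"
        "forest A2 B2 (A2 \<union> (M - fst p)) (B2 \<union> (N - snd p)) Y" using xy(1) by (simp_all add: D_def F1_def F2_def x)
      have qy: "q \<in> Pow M \<times> Pow N" "forest A1 B1 (A1 \<union> fst q) (B1 \<union> snd q) X'"
        "forest A2 B2 (A2 \<union> (M - fst q)) (B2 \<union> (N - snd q)) Y'" using xy(2) by (simp_all add: D_def F1_def F2_def y)
      have eq: "X \<union> Y = X' \<union> Y'" using xy(3) by (simp add: x y)
      note ix = forest_split_reach[OF px(2,3) dj[OF px(1)]]
      note iy = forest_split_reach[OF qy(2,3) dj[OF qy(1)]]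
      have v: "A1 \<union> fst p \<union> (B1 \<union> snd p) = A1 \<union> fst q \<union> (B1 \<union> snd q)"
        using ix(1) iy(1) unfolding eq by simp
      have s: "fst p \<subseteq> M" "snd p \<subseteq> N" "fst q \<subseteq> M" "snd q \<subseteq> N" using px(1) qy(1) by auto
      \<comment> \<open>The choice of \<open>r\<close> can be read off from the vertices of the
        first part, because \<open>M\<close> and \<open>N\<close> avoid each other and all
        roots.\<close>
      have "fst r = (A1 \<union> fst r \<union> (B1 \<union> snd r)) \<inter> M" "snd r = (A1 \<union> fst r \<union> (B1 \<union> snd r)) \<inter> N"
        if "fst r \<subseteq> M" "snd r \<subseteq> N" for r using that d by blast+
      hence "fst p = fst q" "snd p = snd q" using s v by metis+
      hence pq: "p = q" by (simp add: prod_eq_iff)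
      have "X = X'" using ix(2) iy(2) unfolding eq v by simp
      have djY: "e \<inter> (A1 \<union> fst p \<union> (B1 \<union> snd p)) = {}" if "e \<in> Y \<or> e \<in> Y'" for e
        using that forest_edge_subset[OF px(3)] forest_edge_subset[OF qy(3)] dj[OF px(1)] pq by blast
      have djX: "e \<noteq> {} \<and> e \<subseteq> A1 \<union> fst p \<union> (B1 \<union> snd p)" if "e \<in> X" for e
        using forest_edge[OF px(2) that] by auto
      have "e \<notin> X" if "e \<in> Y \<or> e \<in> Y'" for e using djX[of e] djY[OF that] by blast
      hence "Y = Y'" using eq \<open>X = X'\<close> by blast
      thus "x = y" using \<open>X = X'\<close> pq by (simp add: x y)
    qed
    show "(\<lambda>x. fst (snd x) \<union> snd (snd x)) ` D = Z"
    proof (intro equalityI subsetI)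
      fix W assume "W \<in> (\<lambda>x. fst (snd x) \<union> snd (snd x)) ` D"
      then obtain x where x: "x \<in> D" "W = fst (snd x) \<union> snd (snd x)" by (rule imageE)
      obtain p X Y where xx: "x = (p, X, Y)" by (metis prod.exhaust)
      have px: "p \<in> Pow M \<times> Pow N" "forest A1 B1 (A1 \<union> fst p) (B1 \<union> snd p) X"
        "forest A2 B2 (A2 \<union> (M - fst p)) (B2 \<union> (N - snd p)) Y" using x(1) by (simp_all add: D_def F1_def F2_def xx)
      have "A1 \<union> fst p \<union> (A2 \<union> (M - fst p)) = A1 \<union> A2 \<union> M" "B1 \<union> snd p \<union> (B2 \<union> (N - snd p)) = B1 \<union> B2 \<union> N"
        using px(1) by auto
      hence "forest (A1 \<union> A2) (B1 \<union> B2) (A1 \<union> A2 \<union> M) (B1 \<union> B2 \<union> N) (X \<union> Y)"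
        using forest_union[OF px(2,3) dj[OF px(1)]] by simp
      thus "W \<in> Z" by (simp add: Z_def x(2) xx)
    next
      fix W assume "W \<in> Z"
      hence W: "forest (A1 \<union> A2) (B1 \<union> B2) (A1 \<union> A2 \<union> M) (B1 \<union> B2 \<union> N) W" by (simp add: Z_def)
      have dd: "(A1 \<union> B1) \<inter> (A2 \<union> B2) = {}" using d by blast
      obtain R1 R2 S1 S2 X1 X2 where F: "forest A1 B1 R1 S1 X1" "forest A2 B2 R2 S2 X2" and
        e: "A1 \<union> A2 \<union> M = R1 \<union> R2" "B1 \<union> B2 \<union> N = S1 \<union> S2" "W = X1 \<union> X2" "(R1 \<union> S1) \<inter> (R2 \<union> S2) = {}"
        using forest_split[OF W refl refl dd] by blast
      have s: "A1 \<subseteq> R1" "B1 \<subseteq> S1" "A2 \<subseteq> R2" "B2 \<subseteq> S2" using forest_subset F by blast+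
      have eq: "R1 = A1 \<union> (R1 \<inter> M)" "S1 = B1 \<union> (S1 \<inter> N)" "R2 = A2 \<union> (M - (R1 \<inter> M))" "S2 = B2 \<union> (N - (S1 \<inter> N))"
        using s e(1,2,4) d(2-5) by blast+
      have "((R1 \<inter> M, S1 \<inter> N), X1, X2) \<in> D"
        using F eq by (simp add: D_def F1_def F2_def)
      thus "W \<in> (\<lambda>x. fst (snd x) \<union> snd (snd x)) ` D" by (rule rev_image_eqI) (simp add: e(3))
    qed
  qed
  hence "card Z = card D" by (rule bij_betw_same_card[symmetric])
  also have "\<dots> = (\<Sum>p\<in>Pow M \<times> Pow N. card (F1 p \<times> F2 p))" unfolding D_def
  proof (rule card_SigmaI)
    show "\<forall>p\<in>Pow M \<times> Pow N. finite (F1 p \<times> F2 p)"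
      unfolding F1_def F2_def using fin by (auto intro!: finite_cartesian_product finite_forests intro: finite_subset)
  qed (use fin in auto)
  finally show ?thesis by (simp add: Z_def F1_def F2_def card_cartesian_product)
qed

lemma sum_Pow_card:
  assumes "finite M"
  shows "(\<Sum>T\<in>Pow M. g (card T)) = (\<Sum>i\<le>card M. of_nat (card M choose i) * (g i :: 'a :: comm_semiring_1))"
proof -
  have "(\<Sum>T\<in>Pow M. g (card T)) = (\<Sum>i\<le>card M. \<Sum>T\<in>{T \<in> Pow M. card T = i}. g (card T))"
    by (rule sum.group[symmetric]) (use assms in \<open>auto intro: card_mono\<close>)
  also have "\<dots> = (\<Sum>i\<le>card M. of_nat (card M choose i) * g i)"
    using n_subsets[OF assms] by (intro sum.cong refl) simp
  finally show ?thesis .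
qed

lemma sum_Pow_Pow_card:
  assumes "finite M" "finite N"
  shows "(\<Sum>p\<in>Pow M \<times> Pow N. g (card (fst p)) (card (snd p))) =
    (\<Sum>i\<le>card M. \<Sum>j\<le>card N. of_nat (card M choose i) * of_nat (card N choose j) * (g i j :: 'a :: comm_semiring_1))"
proof -
  have "(\<Sum>p\<in>Pow M \<times> Pow N. g (card (fst p)) (card (snd p))) = (\<Sum>T\<in>Pow M. \<Sum>U\<in>Pow N. g (card T) (card U))"
    by (simp add: sum.cartesian_product case_prod_beta)
  also have "\<dots> = (\<Sum>T\<in>Pow M. \<Sum>j\<le>card N. of_nat (card N choose j) * g (card T) j)"
    by (intro sum.cong refl sum_Pow_card assms(2))
  also have "\<dots> = (\<Sum>i\<le>card M. of_nat (card M choose i) * (\<Sum>j\<le>card N. of_nat (card N choose j) * g i j))"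
    by (rule sum_Pow_card[OF assms(1)])
  finally show ?thesis by (simp add: sum_distrib_left mult.assoc)
qed

lemma n_forests_product:
  "n_forests (a + a') (b + b') m n = (\<Sum>i\<le>m. \<Sum>j\<le>n. (m choose i) * (n choose j) *
     (n_forests a b i j * n_forests a' b' (m - i) (n - j)))"
proof -
  let ?A1 = "Inl ` {..<a} :: (nat + nat) set" and ?A2 = "Inl ` {a..<a + a'} :: (nat + nat) set"
  let ?B1 = "Inr ` {..<b} :: (nat + nat) set" and ?B2 = "Inr ` {b..<b + b'} :: (nat + nat) set"
  let ?M = "Inl ` {a + a'..<a + a' + m} :: (nat + nat) set" and ?N = "Inr ` {b + b'..<b + b' + n} :: (nat + nat) set"
  have c: "card ?A1 = a" "card ?A2 = a'" "card ?B1 = b" "card ?B2 = b'" "card ?M = m" "card ?N = n"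
    by (simp_all add: card_image)
  have e: "?A1 \<union> ?A2 = Inl ` {..<a + a'}" "?B1 \<union> ?B2 = Inr ` {..<b + b'}"
    "?A1 \<union> ?A2 \<union> ?M = Inl ` {..<a + a' + m}" "?B1 \<union> ?B2 \<union> ?N = Inr ` {..<b + b' + n}"
    unfolding image_Un[symmetric] by (rule arg_cong[of _ _ "image _"], force)+
  have p: "card {X. forest ?A1 ?B1 (?A1 \<union> fst p) (?B1 \<union> snd p) X} *
       card {X. forest ?A2 ?B2 (?A2 \<union> (?M - fst p)) (?B2 \<union> (?N - snd p)) X}
     = n_forests a b (card (fst p)) (card (snd p)) * n_forests a' b' (m - card (fst p)) (n - card (snd p))"
    if "p \<in> Pow ?M \<times> Pow ?N" for p
  proof -
    have s: "fst p \<subseteq> ?M" "snd p \<subseteq> ?N" using that by auto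
    have f: "finite (fst p)" "finite (snd p)" using s finite_subset by blast+
    have dc: "card (?M - fst p) = m - card (fst p)" "card (?N - snd p) = n - card (snd p)"
      using card_Diff_subset[OF f(1) s(1)] card_Diff_subset[OF f(2) s(2)] c(5,6) by simp_all
    have dd: "?A1 \<inter> fst p = {}" "?B1 \<inter> snd p = {}" "?A2 \<inter> (?M - fst p) = {}" "?B2 \<inter> (?N - snd p) = {}"
       using s by fastforce+
    have "card {X. forest ?A1 ?B1 (?A1 \<union> fst p) (?B1 \<union> snd p) X} = n_forests a b (card (fst p)) (card (snd p))"
    proof (rule card_forests)
      show "(?A1 \<union> fst p) \<inter> (?B1 \<union> snd p) = {}" using s by auto
    qed (use f c dd in \<open>auto simp: card_Un_disjoint\<close>)
    moreover have "card {X. forest ?A2 ?B2 (?A2 \<union> (?M - fst p)) (?B2 \<union> (?N - snd p)) X}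
      = n_forests a' b' (m - card (fst p)) (n - card (snd p))"
    proof (rule card_forests)
      show "card (?A2 \<union> (?M - fst p)) = a' + (m - card (fst p))" "card (?B2 \<union> (?N - snd p)) = b' + (n - card (snd p))"
        using dd(3,4) c dc by (subst card_Un_disjoint; simp)+
    qed (use c in auto)
    ultimately show ?thesis by simp
  qed
  have "n_forests (a + a') (b + b') m n
     = card {X. forest (?A1 \<union> ?A2) (?B1 \<union> ?B2) (?A1 \<union> ?A2 \<union> ?M) (?B1 \<union> ?B2 \<union> ?N) X}"
    unfolding e(3,4) unfolding e(1,2) n_forests_def ..
  also have "\<dots> = (\<Sum>p\<in>Pow ?M \<times> Pow ?N. n_forests a b (card (fst p)) (card (snd p)) *
      n_forests a' b' (m - card (fst p)) (n - card (snd p)))"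
  proof -
    have d: "(?A1 \<union> ?A2 \<union> ?M) \<inter> (?B1 \<union> ?B2 \<union> ?N) = {}" "?A1 \<inter> ?A2 = {}" "?B1 \<inter> ?B2 = {}"
      "?M \<inter> (?A1 \<union> ?A2) = {}" "?N \<inter> (?B1 \<union> ?B2) = {}" by auto
    show ?thesis
      by (subst forests_product[OF _ _ _ _ _ _ d]) (auto intro: sum.cong[OF refl p])
  qed
  also have "\<dots> = (\<Sum>i\<le>m. \<Sum>j\<le>n. (m choose i) * (n choose j) *
     (n_forests a b i j * n_forests a' b' (m - i) (n - j)))"
    using sum_Pow_Pow_card[of ?M ?N "\<lambda>i j. n_forests a b i j * n_forests a' b' (m - i) (n - j)"] c(5,6) by simp
  finally show ?thesis .
qed

definition forest_fps :: "nat \<Rightarrow> nat \<Rightarrow> rat fps fps" where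
  "forest_fps a b = Abs_fps (\<lambda>m. Abs_fps (\<lambda>n. of_nat (n_forests a b m n) / (fact m * fact n)))"

text \<open>Distributing the further vertices over the two groups of roots costs binomial
  coefficients, which the factorials of an exponential generating function absorb.\<close>

lemma forest_fps_add: "forest_fps (a + a') (b + b') = forest_fps a b * forest_fps a' b'"
proof (rule fps_ext, rule fps_ext)
  fix m n
  have "forest_fps (a + a') (b + b') $ m $ n = (\<Sum>i\<le>m. \<Sum>j\<le>n. of_nat (m choose i) * of_nat (n choose j) *
      (of_nat (n_forests a b i j) * of_nat (n_forests a' b' (m - i) (n - j)))) / (fact m * fact n)"
    by (simp add: forest_fps_def n_forests_product)
  also have "\<dots> = (\<Sum>i\<le>m. \<Sum>j\<le>n. (of_nat (n_forests a b i j) / (fact i * fact j)) *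
      (of_nat (n_forests a' b' (m - i) (n - j)) / (fact (m - i) * fact (n - j))))"
    unfolding sum_divide_distrib
    by (intro sum.cong refl) (simp add: binomial_fact field_simps)
  also have "\<dots> = (forest_fps a b * forest_fps a' b') $ m $ n"
    by (simp add: fps_mult_nth fps_sum_nth forest_fps_def atMost_atLeast0)
  finally show "forest_fps (a + a') (b + b') $ m $ n = (forest_fps a b * forest_fps a' b') $ m $ n" .
qed

lemma forest_fps_0: "forest_fps 0 0 = 1"
proof (rule fps_ext, rule fps_ext)
  fix m n
  \<comment> \<open>Every vertex is reachable from a root, so without roots only the empty forest
    exists.\<close>
  have none: "R = {} \<and> S = {} \<and> X = {}" if "forest {} {} R S X" for R S :: "(nat + nat) set" and X
    using forest_reach[OF that] forest_edge[OF that] by blast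
  have "{X :: (nat + nat) set set. forest {} {} (Inl ` {..<m}) (Inr ` {..<n}) X} = (if m = 0 \<and> n = 0 then {{}} else {})"
  proof (cases "m = 0 \<and> n = 0")
    case True
    thus ?thesis using none forest.roots[of "{}" "{}"] by auto
  next
    case False
    have "\<not> forest {} {} (Inl ` {..<m}) (Inr ` {..<n}) X" for X :: "(nat + nat) set set"
    proof
      assume "forest {} {} (Inl ` {..<m}) (Inr ` {..<n}) X"
      from none[OF this] show False using False by auto
    qed
    thus ?thesis using False by simp
  qed
  thus "forest_fps 0 0 $ m $ n = 1 $ m $ n" by (auto simp: forest_fps_def n_forests_def)
qed

lemma forest_fps_power: "forest_fps a b = forest_fps 1 0 ^ a * forest_fps 0 1 ^ b"
proof -
  have x: "forest_fps a 0 = forest_fps 1 0 ^ a" for a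
  proof (induction a)
    case (Suc a)
    show ?case using forest_fps_add[of 1 a 0 0] Suc.IH by simp
  qed (simp add: forest_fps_0)
  have y: "forest_fps 0 b = forest_fps 0 1 ^ b" for b
  proof (induction b)
    case (Suc b)
    show ?case using forest_fps_add[of 0 0 1 b] Suc.IH by simp
  qed (simp add: forest_fps_0)
  have "forest_fps a b = forest_fps a 0 * forest_fps 0 b" using forest_fps_add[of a 0 0 b] by simp
  also have "\<dots> = forest_fps 1 0 ^ a * forest_fps 0 1 ^ b" by (subst x, subst y) (rule refl)
  finally show ?thesis .
qed

section \<open>Trees as forests with one root, and the series \<open>T_x\<close> and
  \<open>T_y\<close>\<close>

section \<open>Trees\<close>

lemma N_bi_betti:
  "N_bi r s k = card {G :: (nat + nat) bigraph. lverts G = Inl ` {..<r} \<and> rverts G = Inr ` {..<s} \<and>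
     bigraph G \<and> connected_bigraph G \<and> betti G = k}"
proof -
  have "card (verts G) = r + s" if "lverts G = Inl ` {..<r}" "rverts G = Inr ` {..<s}" for G :: "(nat + nat) bigraph"
    unfolding verts_def that by (subst card_Un_disjoint) (auto simp: card_image)
  thus ?thesis unfolding N_bi_def by (intro arg_cong[of _ _ card] Collect_cong) (auto simp: betti_def)
qed

text \<open>The prescribed vertex \<open>v\<close> survives because a tree on n > 1 vertices has
  another leaf: with all other degrees at least 2 the degree sum would be at least 2n - 1, while it
  is 2n - 2.\<close>

lemma tree_prune_steps:
  assumes "bigraph G" "connected_bigraph G" "betti G = 0" "v \<in> verts G"
  shows "\<exists>H. prune_step\<^sup>*\<^sup>* G H \<and> verts H = {v}"
  using assms
proof (induction "card (verts G)" arbitrary: G rule: less_induct)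
  case less
  show ?case
  proof (cases "verts G = {v}")
    case False
    have fin: "finite (verts G)" by (rule bigraphD(4)[OF less.prems(1)])
    have "\<exists>w\<in>verts G - {v}. deg G w \<le> 1"
    proof (rule ccontr)
      assume A: "\<not> ?thesis"
      have "(\<Sum>w\<in>verts G - {v}. 2) \<le> (\<Sum>w\<in>verts G - {v}. deg G w)"
      proof (rule sum_mono)
        fix w assume "w \<in> verts G - {v}"
        hence "\<not> deg G w \<le> 1" using A by blast
        thus "2 \<le> deg G w" by linarith
      qed
      moreover have "deg G v > 0" by (rule deg_pos_connected[OF less.prems(1,2,4) False])
      moreover have "(\<Sum>w\<in>verts G. deg G w) = deg G v + (\<Sum>w\<in>verts G - {v}. deg G w)"
        by (rule sum.remove[OF fin less.prems(4)])
      moreover have "card (verts G - {v}) = card (verts G) - 1" "card (verts G) > 0"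
        using fin less.prems(4) by (auto simp: card_gt_0_iff)
      ultimately have "2 * card (verts G) \<le> (\<Sum>w\<in>verts G. deg G w) + 1" by simp
      hence "2 * card (verts G) \<le> 2 * card (edges G) + 1" using handshake[OF less.prems(1)] by simp
      thus False using less.prems(3) by (simp add: betti_def)
    qed
    then obtain w where w: "w \<in> verts G" "w \<noteq> v" "deg G w \<le> 1" by blast
    have "verts G \<noteq> {w}" using w(2) less.prems(4) by auto
    hence "deg G w > 0" by (rule deg_pos_connected[OF less.prems(1,2) w(1)])
    hence l: "leaf G w" using w by (simp add: leaf_def)
    let ?G = "delete_vertex G w"
    have "card (verts ?G) < card (verts G)" using w(1) fin unfolding delete_vertex_simps
      by (intro psubset_card_mono) auto
    moreover have "connected_bigraph ?G" using connected_delete_leaf[OF less.prems(1) l] less.prems(2) by simp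
    moreover have "betti ?G = 0" using betti_delete_leaf[OF less.prems(1) l] less.prems(3) by simp
    moreover have "v \<in> verts ?G" using w(2) less.prems(4) by (simp add: delete_vertex_simps)
    ultimately obtain H where H: "prune_step\<^sup>*\<^sup>* ?G H" "verts H = {v}"
      using less.hyps bigraph_delete_vertex[OF less.prems(1)] by blast
    have "prune_step G ?G" using l by blast
    thus ?thesis using H converse_rtranclp_into_rtranclp[of prune_step G ?G H] by blast
  qed blast
qed

text \<open>Pruning to \<open>v\<close> turns a tree into a forest with the single root
  \<open>v\<close>. The intersections with {v} place the root on its side, whichever that
  is.\<close>

lemma card_trees:
  fixes R S :: "'v set"
  assumes v: "v \<in> R \<union> S" and d: "R \<inter> S = {}"
  shows "card {G :: 'v bigraph. lverts G = R \<and> rverts G = S \<and> bigraph G \<and> connected_bigraph G \<and> betti G = 0}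
    = card {X. forest (R \<inter> {v}) (S \<inter> {v}) R S X}"
proof -
  let ?H = "\<lparr>lverts = R \<inter> {v}, rverts = S \<inter> {v}, edges = {}\<rparr>"
  have vH: "verts ?H = {v}" using v by (auto simp: verts_def)
  have H: "bigraph ?H" "connected_bigraph ?H" "betti ?H = 0"
    using d by (auto simp: bigraph_def connected_bigraph_def betti_def vH)
  have "bij_betw edges {G. lverts G = R \<and> rverts G = S \<and> bigraph G \<and> connected_bigraph G \<and> betti G = 0}
     {X. forest (R \<inter> {v}) (S \<inter> {v}) R S X}"
  proof (rule bij_betw_byWitness[where f' = "\<lambda>X. \<lparr>lverts = R, rverts = S, edges = X\<rparr>"])
    show "edges ` {G. lverts G = R \<and> rverts G = S \<and> bigraph G \<and> connected_bigraph G \<and> betti G = 0}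
      \<subseteq> {X. forest (R \<inter> {v}) (S \<inter> {v}) R S X}"
    proof (rule image_subsetI)
      fix G assume "G \<in> {G. lverts G = R \<and> rverts G = S \<and> bigraph G \<and> connected_bigraph G \<and> betti G = 0}"
      hence G: "lverts G = R" "rverts G = S" "bigraph G" "connected_bigraph G" "betti G = 0" by simp_all
      have vG: "v \<in> verts G" using v G by (simp add: verts_def)
      obtain K where K: "prune_step\<^sup>*\<^sup>* G K" "verts K = {v}" using tree_prune_steps[OF G(3-5) vG] by blast
      have bK: "bigraph K" using prune_steps_invariant[OF K(1) G(3)] by blast
      have "edges K = {}"
      proof (rule ccontr)
        assume "edges K \<noteq> {}"
        then obtain e where e: "e \<in> edges K" by blast
        obtain x y where "e = {x, y}" "x \<noteq> y" by (rule edgeE[OF bK e])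
        thus False using edge_subset_verts[OF bK e] K(2) by auto
      qed
      moreover obtain X where "forest (lverts K) (rverts K) (lverts G) (rverts G) X" "edges G = edges K \<union> X"
        using prune_steps_forest[OF K(1) G(3)] by blast
      ultimately have f: "forest (lverts K) (rverts K) R S (edges G)" using G by simp
      have "lverts K \<subseteq> R" "rverts K \<subseteq> S" using forest_subset[OF f] by blast+
      hence "lverts K = R \<inter> {v}" "rverts K = S \<inter> {v}" using K(2) d unfolding verts_def by blast+
      thus "edges G \<in> {X. forest (R \<inter> {v}) (S \<inter> {v}) R S X}" using f by simp
    qed
    show "(\<lambda>X. \<lparr>lverts = R, rverts = S, edges = X\<rparr>) ` {X. forest (R \<inter> {v}) (S \<inter> {v}) R S X}
      \<subseteq> {G. lverts G = R \<and> rverts G = S \<and> bigraph G \<and> connected_bigraph G \<and> betti G = 0}"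
    proof (rule image_subsetI)
      fix X assume "X \<in> {X. forest (R \<inter> {v}) (S \<inter> {v}) R S X}"
      hence "forest (lverts ?H) (rverts ?H) R S X" by simp
      from forest_prune_steps[OF this H(1)] have P: "bigraph \<lparr>lverts = R, rverts = S, edges = X\<rparr>"
        "prune_step\<^sup>*\<^sup>* \<lparr>lverts = R, rverts = S, edges = X\<rparr> ?H" by simp_all
      from prune_steps_invariant[OF P(2,1)] show "\<lparr>lverts = R, rverts = S, edges = X\<rparr>
        \<in> {G. lverts G = R \<and> rverts G = S \<and> bigraph G \<and> connected_bigraph G \<and> betti G = 0}"
        using H(2,3) P(1) by simp
    qed
  qed auto
  thus ?thesis by (rule bij_betw_same_card)
qed

lemma N_bi_tree_left: "N_bi (Suc r) s 0 = n_forests 1 0 r s"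
proof -
  have "N_bi (Suc r) s 0 = card {X :: (nat + nat) set set.
      forest (Inl ` {..<Suc r} \<inter> {Inl 0}) (Inr ` {..<s} \<inter> {Inl 0}) (Inl ` {..<Suc r}) (Inr ` {..<s}) X}"
    unfolding N_bi_betti by (rule card_trees) auto
  also have "\<dots> = n_forests 1 0 r s"
    by (rule card_forests) (auto simp: card_image intro!: arg_cong[of _ _ card])
  finally show ?thesis .
qed

lemma N_bi_tree_right: "N_bi r (Suc s) 0 = n_forests 0 1 r s"
proof -
  have "N_bi r (Suc s) 0 = card {X :: (nat + nat) set set.
      forest (Inl ` {..<r} \<inter> {Inr 0}) (Inr ` {..<Suc s} \<inter> {Inr 0}) (Inl ` {..<r}) (Inr ` {..<Suc s}) X}"
    unfolding N_bi_betti by (rule card_trees) auto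
  also have "\<dots> = n_forests 0 1 r s"
    by (rule card_forests) (auto simp: card_image intro!: arg_cong[of _ _ card])
  finally show ?thesis .
qed

text \<open>The factor r produced by the derivative cancels against the factorial of r and leaves
  that of r - 1, as for trees with a fixed left root and r - 1 further left vertices. The factor
  \<open>fps_X\<close> accounts for the root.\<close>

lemma T_x_forest: "T_x = fps_X * forest_fps 1 0"
proof (rule fps_ext, rule fps_ext)
  fix r s
  show "T_x $ r $ s = (fps_X * forest_fps 1 0) $ r $ s"
  proof (cases r)
    case (Suc r')
    have "(of_nat (Suc r') * f) $ s = of_nat (Suc r') * f $ s" for f :: "rat fps"
      by (simp add: fps_of_nat[symmetric])
    moreover have "of_nat (Suc r') * (x / (fact (Suc r') * fact s)) = x / (fact r' * fact s)" for x :: rat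
      by (simp del: of_nat_Suc)
    ultimately show ?thesis
      by (simp add: T_x_def T_def F_def forest_fps_def Suc N_bi_tree_left del: of_nat_Suc fact_Suc)
  qed (simp add: T_x_def)
qed

text \<open>In the nested series, \<open>fps_const fps_X\<close> is the variable y.\<close>

lemma T_y_forest: "T_y = fps_const fps_X * forest_fps 0 1"
proof (rule fps_ext, rule fps_ext)
  fix r s
  show "T_y $ r $ s = (fps_const fps_X * forest_fps 0 1) $ r $ s"
  proof (cases s)
    case (Suc s')
    have "of_nat (Suc s') * (x / (fact r * fact (Suc s'))) = x / (fact r * fact s')" for x :: rat
      by (simp del: of_nat_Suc)
    thus ?thesis
      by (simp add: T_y_def T_def F_def forest_fps_def Suc N_bi_tree_right del: of_nat_Suc fact_Suc)
  qed (simp add: T_y_def)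
qed

lemma T_power_nth:
  "(T_x ^ a * T_y ^ b) $ r $ s = (if a \<le> r \<and> b \<le> s
     then of_nat (n_forests a b (r - a) (s - b)) / (fact (r - a) * fact (s - b)) else 0)"
proof -
  have "T_x ^ a * T_y ^ b = fps_X ^ a * (fps_const (fps_X ^ b) * forest_fps a b)"
    by (simp add: T_x_forest T_y_forest power_mult_distrib forest_fps_power[of a b] fps_const_power algebra_simps)
  thus ?thesis by (simp add: fps_X_power_mult_nth forest_fps_def)
qed

section \<open>Unique decomposition of a connected graph into core and forest\<close>

section \<open>Connected graphs and their cores\<close>

definition n_cores_betti :: "int \<Rightarrow> nat \<Rightarrow> nat \<Rightarrow> nat" where
  "n_cores_betti k a b = card {G :: (nat + nat) bigraph. lverts G = Inl ` {..<a} \<and> rverts G = Inr ` {..<b} \<and>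
     bigraph G \<and> core G \<and> betti G = k}"

lemma card_cores_betti:
  fixes R S :: "'v set"
  assumes "finite R" "finite S" "R \<inter> S = {}"
  shows "card {G. lverts G = R \<and> rverts G = S \<and> bigraph G \<and> core G \<and> betti G = k} = n_cores_betti k (card R) (card S)"
  unfolding n_cores_betti_def
proof (rule card_relabel)
  fix f and G :: "'v bigraph" and H :: "(nat + nat) bigraph"
  assume iso: "bigraph_iso f G H" and G: "bigraph G"
  show "(core G \<and> betti G = k) \<longleftrightarrow> (core H \<and> betti H = k)"
    using bigraph_iso_core[OF iso] bigraph_iso_core[OF bigraph_iso_inverse[OF iso bigraph_edges_Pow[OF G]]]
      bigraph_iso_cards(5)[OF iso G] by auto
qed (use assms in \<open>auto simp: card_image\<close>)

text \<open>\<open>prune\<close> recovers the core, and the remaining edges form the forest;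
  conversely, attaching a forest to a core does not change the pruning. The binomials choose the
  vertices of the core.\<close>

lemma N_bi_cores:
  assumes k: "k \<ge> 2"
  shows "N_bi r s k = (\<Sum>a\<le>r. \<Sum>b\<le>s. (r choose a) * (s choose b) * (n_cores_betti k a b * n_forests a b (r - a) (s - b)))"
proof -
  let ?L = "Inl ` {..<r} :: (nat + nat) set" and ?R = "Inr ` {..<s} :: (nat + nat) set"
  define C where "C p = {H. lverts H = fst p \<and> rverts H = snd p \<and> bigraph H \<and> core H \<and> betti H = k}" for p :: "(nat + nat) set \<times> (nat + nat) set"
  define Fo where "Fo p = {X. forest (fst p) (snd p) ?L ?R X}" for p :: "(nat + nat) set \<times> (nat + nat) set"
  define D where "D = Sigma (Pow ?L \<times> Pow ?R) (\<lambda>p. C p \<times> Fo p)"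
  define Z where "Z = {G. lverts G = ?L \<and> rverts G = ?R \<and> bigraph G \<and> connected_bigraph G \<and> betti G = k}"
  define f where "f = (\<lambda>x :: ((nat + nat) set \<times> (nat + nat) set) \<times> (nat + nat) bigraph \<times> (nat + nat) set set.
     \<lparr>lverts = ?L, rverts = ?R, edges = edges (fst (snd x)) \<union> snd (snd x)\<rparr>)"
  have img: "f (p, H, X) \<in> Z \<and> prune (f (p, H, X)) = H \<and> X = edges (f (p, H, X)) - edges H \<and> p = (lverts H, rverts H)"
    if x: "(p, H, X) \<in> D" for p H X
  proof -
    have H: "lverts H = fst p" "rverts H = snd p" "core H" "betti H = k" and X: "forest (fst p) (snd p) ?L ?R X"
      using x by (simp_all add: D_def C_def Fo_def)
    have bH: "bigraph H" by (rule coreD(1)[OF H(3)])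
    have X': "forest (lverts H) (rverts H) ?L ?R X" using X H by simp
    note P = forest_prune_steps[OF X' bH]
    have fx: "f (p, H, X) = \<lparr>lverts = ?L, rverts = ?R, edges = edges H \<union> X\<rparr>" by (simp add: f_def)
    note Q = prune_eq_core[OF conjunct1[OF P] conjunct2[OF P] H(3)]
    have "e \<notin> edges H" if "e \<in> X" for e
      using forest_edge_new[OF X' that] edge_subset_verts[OF bH, of e] by (auto simp: verts_def)
    hence "X = edges H \<union> X - edges H" by blast
    thus ?thesis using P Q H by (simp add: fx Z_def prod_eq_iff)
  qed
  have "bij_betw f D Z"
    unfolding bij_betw_def
  proof
    show "inj_on f D"
    proof (rule inj_onI)
      fix x y assume xy: "x \<in> D" "y \<in> D" "f x = f y"
      obtain p H X where x: "x = (p, H, X)" by (metis prod.exhaust)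
      obtain q K Y where y: "y = (q, K, Y)" by (metis prod.exhaust)
      have ix: "prune (f x) = H \<and> X = edges (f x) - edges H \<and> p = (lverts H, rverts H)" using img[of p H X] xy(1) unfolding x by blast
      have iy: "prune (f y) = K \<and> Y = edges (f y) - edges K \<and> q = (lverts K, rverts K)" using img[of q K Y] xy(2) unfolding y by blast
      have HK: "H = K" using conjunct1[OF ix] conjunct1[OF iy] unfolding xy(3) by (rule trans[OF sym])
      have "X = edges (f x) - edges H" "Y = edges (f y) - edges K" using ix iy by blast+
      hence XY: "X = Y" unfolding xy(3) HK by (rule trans[OF _ sym])
      have "p = (lverts H, rverts H)" "q = (lverts K, rverts K)" using ix iy by blast+
      hence "p = q" unfolding HK by (rule trans[OF _ sym])
      thus "x = y" using HK XY by (simp only: x y)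
    qed
    show "f ` D = Z"
    proof (intro equalityI subsetI)
      fix G assume "G \<in> f ` D"
      then obtain x where x: "x \<in> D" "G = f x" by (metis imageE)
      obtain p H X where xx: "x = (p, H, X)" by (metis prod.exhaust)
      have "(p, H, X) \<in> D" using x(1) unfolding xx .
      from img[OF this] show "G \<in> Z" unfolding x(2) xx by blast
    next
      fix G assume "G \<in> Z"
      hence G: "lverts G = ?L" "rverts G = ?R" "bigraph G" "connected_bigraph G" "betti G = k" by (simp_all add: Z_def)
      have k': "betti G \<ge> 2" using G(5) k by simp
      note P = prune_core[OF G(3,4) k']
      obtain X where X: "forest (lverts (prune G)) (rverts (prune G)) ?L ?R X" "edges G = edges (prune G) \<union> X"
        using prune_steps_forest[OF P(1) G(3)] G(1,2) by auto
      have "betti (prune G) = k" using prune_steps_invariant[OF P(1) G(3)] G(5) by simp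
      hence "((lverts (prune G), rverts (prune G)), prune G, X) \<in> D"
        using P(2) coreD(1)[OF P(2)] X(1) forest_subset[OF X(1)] by (simp add: D_def C_def Fo_def)
      moreover have "G = f ((lverts (prune G), rverts (prune G)), prune G, X)"
        using G(1,2) X(2) by (simp add: f_def)
      ultimately show "G \<in> f ` D" by (rule rev_image_eqI)
    qed
  qed
  hence "card Z = card D" by (rule bij_betw_same_card[symmetric])
  also have "\<dots> = (\<Sum>p\<in>Pow ?L \<times> Pow ?R. card (C p \<times> Fo p))" unfolding D_def
  proof (rule card_SigmaI)
    have "finite (C p)" for p unfolding C_def
      by (rule finite_subset[OF _ finite_bigraphs_on[of "fst p" "snd p"]]) auto
    moreover have "finite (Fo p)" for p unfolding Fo_def by (rule finite_forests) auto
    ultimately show "\<forall>p\<in>Pow ?L \<times> Pow ?R. finite (C p \<times> Fo p)" by simp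
  qed auto
  also have "\<dots> = (\<Sum>p\<in>Pow ?L \<times> Pow ?R. n_cores_betti k (card (fst p)) (card (snd p)) *
      n_forests (card (fst p)) (card (snd p)) (r - card (fst p)) (s - card (snd p)))"
  proof (rule sum.cong[OF refl])
    fix p assume p: "p \<in> Pow ?L \<times> Pow ?R"
    have s: "fst p \<subseteq> ?L" "snd p \<subseteq> ?R" using p by auto
    have fin: "finite (fst p)" "finite (snd p)" using s finite_subset by blast+
    have le: "card (fst p) \<le> r" "card (snd p) \<le> s"
      using card_mono[OF _ s(1)] card_mono[OF _ s(2)] by (simp_all add: card_image)
    have "fst p \<inter> snd p = {}" using s by blast
    hence "card (C p) = n_cores_betti k (card (fst p)) (card (snd p))"
      unfolding C_def by (rule card_cores_betti[OF fin])
    moreover have "card (Fo p) = n_forests (card (fst p)) (card (snd p)) (r - card (fst p)) (s - card (snd p))"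
      unfolding Fo_def by (rule card_forests) (use s le in \<open>auto simp: card_image\<close>)
    ultimately show "card (C p \<times> Fo p) = n_cores_betti k (card (fst p)) (card (snd p)) *
      n_forests (card (fst p)) (card (snd p)) (r - card (fst p)) (s - card (snd p))"
      by (simp add: card_cartesian_product)
  qed
  also have "\<dots> = (\<Sum>a\<le>r. \<Sum>b\<le>s. (r choose a) * (s choose b) * (n_cores_betti k a b * n_forests a b (r - a) (s - b)))"
    using sum_Pow_Pow_card[of ?L ?R "\<lambda>a b. n_cores_betti k a b * n_forests a b (r - a) (s - b)"]
    by (simp add: card_image)
  finally show ?thesis unfolding N_bi_betti Z_def .
qed

text \<open>Factorials and binomials cancel, and the number of forests becomes a coefficient of a
  monomial in \<open>T_x\<close> and \<open>T_y\<close>. Finite ranges suffice, as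
  \<open>T_x ^ a * T_y ^ b\<close> is divisible by the a-th power of x and the b-th power of
  y.\<close>

lemma F_nth:
  assumes k: "k \<ge> 2"
  shows "F k $ r $ s = (\<Sum>a\<le>r. \<Sum>b\<le>s. of_nat (n_cores_betti k a b) / (fact a * fact b) * (T_x ^ a * T_y ^ b) $ r $ s)"
proof -
  have "F k $ r $ s = (\<Sum>a\<le>r. \<Sum>b\<le>s. of_nat (r choose a) * of_nat (s choose b) *
      (of_nat (n_cores_betti k a b) * of_nat (n_forests a b (r - a) (s - b)))) / (fact r * fact s)"
    by (simp add: F_def N_bi_cores[OF k])
  also have "\<dots> = (\<Sum>a\<le>r. \<Sum>b\<le>s. of_nat (n_cores_betti k a b) / (fact a * fact b) * (T_x ^ a * T_y ^ b) $ r $ s)"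
    unfolding sum_divide_distrib
    by (intro sum.cong refl) (simp add: T_power_nth binomial_fact field_simps)
  finally show ?thesis .
qed

section \<open>The basic graphs of given Betti number: description by cores, and finiteness\<close>

section \<open>The set of basic graphs\<close>

text \<open>\<open>BG\<close> is defined by arbitrary connected graphs on natural numbers, while the
  count concerns cores with vertices in \<open>nat + nat\<close>. Relabelling translates between the
  vertex types, and a core occurs in \<open>BG\<close> as its own pruning.\<close>

lemma BG_cores:
  "BG k = {iso_class (minimal_form C) | C :: (nat + nat) bigraph. core C \<and> betti C = k}" if k: "k \<ge> 2"
proof (intro equalityI subsetI)
  fix B assume "B \<in> BG k"
  then obtain G :: "nat bigraph" where G: "bigraph G" "connected_bigraph G" "betti G = k" "B = basic_graph G"
    by (auto simp: BG_def)
  have k2: "betti G \<ge> 2" using G(3) k by simp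
  note P = prune_core[OF G(1,2) k2]
  \<comment> \<open>Using \<open>Inl\<close> for all vertices has no bearing on the bipartition,
    which is part of the graph itself.\<close>
  let ?C = "relabel (Inl :: nat \<Rightarrow> nat + nat) (prune G)"
  have iso: "bigraph_iso Inl (prune G) ?C" by (rule bigraph_iso_relabel) simp
  have "B = iso_class (minimal_form ?C)"
    using bigraph_iso_minimal_form(1)[OF iso P(2)] by (simp add: G(4) basic_graph_def)
  moreover have "core ?C" by (rule bigraph_iso_core[OF iso P(2)])
  moreover have "betti ?C = k"
    using bigraph_iso_cards(5)[OF iso coreD(1)[OF P(2)]] prune_steps_invariant[OF P(1) G(1)] G(3) by simp
  ultimately show "B \<in> {iso_class (minimal_form C) | C :: (nat + nat) bigraph. core C \<and> betti C = k}" by blast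
next
  fix B assume "B \<in> {iso_class (minimal_form C) | C :: (nat + nat) bigraph. core C \<and> betti C = k}"
  then obtain C :: "(nat + nat) bigraph" where C: "B = iso_class (minimal_form C)" "core C" "betti C = k" by blast
  obtain f and G :: "nat bigraph" where iso: "bigraph_iso f C G" by (rule core_nat_copy[OF coreD(1)[OF C(2)]])
  have G: "core G" by (rule bigraph_iso_core[OF iso C(2)])
  have "basic_graph G = B"
    using bigraph_iso_minimal_form(1)[OF iso C(2)] by (simp add: basic_graph_def prune_of_core[OF G] C(1))
  moreover have "betti G = k" using bigraph_iso_cards(5)[OF iso coreD(1)[OF C(2)]] C(3) by simp
  ultimately show "B \<in> BG k" using coreD(1,2)[OF G] unfolding BG_def by blast
qed

text \<open>The constant is 2 + 3 * 3: for Betti number k there are at most 2 (k - 1) special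
  points, hence at most 3 (k - 1) threads, each with at most 3 normal points.\<close>

lemma card_verts_zero_excess:
  assumes G: "core G" and z: "total_excess G = 0"
  shows "int (card (verts G)) \<le> 11 * (betti G - 1)"
proof -
  have "card P - 1 \<le> 3" if P: "P \<in> threads G" for P
  proof -
    have "excess G P = 0"
      using z P finite_threads[OF coreD(1)[OF G]] by (simp add: total_excess_def)
    hence "card P = base G P" using card_eq_base_excess[OF G P] by simp
    moreover have "base G P \<le> 4" by (simp add: base_def)
    ultimately show ?thesis by linarith
  qed
  hence "(\<Sum>P\<in>threads G. card P - 1) \<le> (\<Sum>P\<in>threads G. 3)" by (rule sum_mono)
  hence "card (verts G) \<le> N_sp G + card (threads G) * 3" using card_verts_threads[OF G] by simp
  hence "int (card (verts G)) \<le> int (N_sp G) + 3 * int (card (threads G))" by linarith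
  thus ?thesis using card_threads_betti[OF G] core_special_bound(1)[OF G] by simp
qed

text \<open>Every basic graph has a model of excess 0 with vertices below a fixed bound. Finiteness
  matters because a sum over an infinite set is 0 by convention.\<close>

lemma finite_BG:
  assumes k: "k \<ge> 2"
  shows "finite (BG k)"
proof -
  let ?V = "{..<nat (11 * (k - 1))}"
  let ?A = "\<Union>R\<in>Pow ?V. \<Union>S\<in>Pow ?V. {G :: nat bigraph. lverts G = R \<and> rverts G = S \<and> bigraph G}"
  have "BG k \<subseteq> (\<lambda>G. iso_class (minimal_form G)) ` ?A"
  proof
    fix B assume "B \<in> BG k"
    then obtain C :: "(nat + nat) bigraph" where C: "B = iso_class (minimal_form C)" "core C" "betti C = k"
      unfolding BG_cores[OF k] by blast
    obtain K :: "(nat + nat) bigraph" where K: "core K" "total_excess K = 0"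
      "iso_class (minimal_form K) = iso_class (minimal_form C)" "betti K = betti C"
      using reduce_to_zero_excess[OF C(2)] by blast
    obtain f and G :: "nat bigraph" where iso: "bigraph_iso f K G" and G: "bigraph G" "verts G \<subseteq> {..<card (verts K)}"
      by (rule core_nat_copy[OF coreD(1)[OF K(1)]])
    have "card (verts K) \<le> nat (11 * (k - 1))" using card_verts_zero_excess[OF K(1,2)] K(4) C(3) by simp
    hence "verts G \<subseteq> ?V" using G(2) by (meson lessThan_subset_iff order_trans)
    hence "G \<in> ?A" using G(1) by (simp add: verts_def)
    moreover have "B = iso_class (minimal_form G)"
      using bigraph_iso_minimal_form(1)[OF iso K(1)] K(3) C(1) by simp
    ultimately show "B \<in> (\<lambda>G. iso_class (minimal_form G)) ` ?A" by blast
  qed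
  moreover have "finite ?A" by (intro finite_UN_I finite_bigraphs_on) auto
  ultimately show ?thesis by (meson finite_imageI finite_subset)
qed

text \<open>The basic graph determines the Betti number, so the cores of Betti number k are
  partitioned by their basic graphs.\<close>

lemma n_cores_betti_sum:
  assumes k: "k \<ge> 2"
  shows "n_cores_betti k a b = (\<Sum>B\<in>BG k. n_cores B a b)"
proof -
  let ?L = "Inl ` {..<a} :: (nat + nat) set" and ?R = "Inr ` {..<b} :: (nat + nat) set"
  let ?Z = "{G. lverts G = ?L \<and> rverts G = ?R \<and> bigraph G \<and> core G \<and> betti G = k}"
  have "?Z = (\<Union>B\<in>BG k. cores_of B ?L ?R)"
  proof (intro equalityI subsetI)
    fix G assume "G \<in> ?Z"
    hence G: "G \<in> cores_of (iso_class (minimal_form G)) ?L ?R" "iso_class (minimal_form G) \<in> BG k"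
      unfolding BG_cores[OF k] cores_of_def by auto
    thus "G \<in> (\<Union>B\<in>BG k. cores_of B ?L ?R)" by blast
  next
    fix G assume "G \<in> (\<Union>B\<in>BG k. cores_of B ?L ?R)"
    then obtain B where B: "B \<in> BG k" "G \<in> cores_of B ?L ?R" by blast
    then obtain C :: "(nat + nat) bigraph" where C: "B = iso_class (minimal_form C)" "core C" "betti C = k"
      unfolding BG_cores[OF k] by blast
    have G: "lverts G = ?L" "rverts G = ?R" "bigraph G" "core G" "iso_class (minimal_form G) = B"
      using B(2) by (simp_all add: cores_of_def)
    obtain H where H: "H \<in> iso_class (minimal_form C)" using iso_class_nonempty[OF C(2)] by blast
    hence "H \<in> iso_class (minimal_form G)" using G(5) C(1) by simp
    hence "betti G = k" using representative(6)[OF G(4)] representative(6)[OF C(2) H] C(3) by simp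
    thus "G \<in> ?Z" using G by simp
  qed
  hence "n_cores_betti k a b = card (\<Union>B\<in>BG k. cores_of B ?L ?R)" by (simp add: n_cores_betti_def)
  also have "\<dots> = (\<Sum>B\<in>BG k. card (cores_of B ?L ?R))"
  proof (rule card_UN_disjoint[OF finite_BG[OF k]])
    show "\<forall>B\<in>BG k. \<forall>B'\<in>BG k. B \<noteq> B' \<longrightarrow> cores_of B ?L ?R \<inter> cores_of B' ?L ?R = {}"
      unfolding cores_of_def by blast
  qed (simp add: finite_cores_of)
  finally show ?thesis by (simp add: n_cores_def)
qed

section \<open>From the recurrence to a negative power of 1 - T_x T_y\<close>

section \<open>Generating functions\<close>

text \<open>The recurrence is the differential equation (1 - X) U' = n U, which says that (1 - X) ^
  n U has derivative 0.\<close>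

lemma fps_neg_binomial_recurrence:
  fixes U :: "'a :: {idom, semiring_char_0} fps"
  assumes "\<And>m. of_nat (Suc m) * U $ Suc m = of_nat (m + n) * U $ m"
  shows "(1 - fps_X) ^ n * U = fps_const (U $ 0)"
proof -
  let ?W = "(1 - fps_X) ^ n * U"
  have d: "(1 - fps_X) * fps_deriv U = of_nat n * U"
  proof (rule fps_ext)
    fix m
    have "((1 - fps_X) * fps_deriv U) $ m = of_nat (Suc m) * U $ Suc m - of_nat m * U $ m"
      by (cases m) (simp_all add: left_diff_distrib)
    also have "\<dots> = of_nat n * U $ m" unfolding assms by (simp add: algebra_simps)
    also have "\<dots> = (of_nat n * U) $ m" by (simp add: fps_of_nat[symmetric])
    finally show "((1 - fps_X) * fps_deriv U) $ m = (of_nat n * U) $ m" .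
  qed
  \<comment> \<open>Multiplied by one more factor 1 - X, the derivative keeps the exponent n, and
    the identity also holds for n = 0.\<close>
  have p: "(1 - fps_X) * fps_deriv ((1 - fps_X) ^ n) = - of_nat n * (1 - fps_X :: 'a fps) ^ n"
  proof (cases n)
    case (Suc m)
    have "fps_deriv ((1 - fps_X) ^ n) = - (of_nat n * (1 - fps_X :: 'a fps) ^ m)"
      unfolding fps_deriv_power' by (simp add: Suc del: of_nat_Suc)
    thus ?thesis by (simp add: Suc mult_ac del: of_nat_Suc)
  qed simp
  have "(1 - fps_X) * fps_deriv ?W
    = ((1 - fps_X) * fps_deriv ((1 - fps_X) ^ n)) * U + (1 - fps_X) ^ n * ((1 - fps_X) * fps_deriv U)"
    by (simp add: algebra_simps)
  also have "\<dots> = 0" unfolding d p by (simp add: algebra_simps)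
  finally have "(1 - fps_X) * fps_deriv ?W = 0" .
  moreover have "(1 - fps_X :: 'a fps) \<noteq> 0"
  proof
    assume "(1 - fps_X :: 'a fps) = 0"
    hence "(1 - fps_X :: 'a fps) $ 0 = 0" by simp
    thus False by simp
  qed
  ultimately have "fps_deriv ?W = 0" by simp
  hence "?W = fps_const (?W $ 0)" by (simp only: fps_deriv_eq_0_iff)
  also have "?W $ 0 = U $ 0" by (simp add: fps_power_zeroth)
  finally show ?thesis .
qed

text \<open>Since \<open>z\<close> has no constant term, \<open>z ^ m\<close> contributes nothing
  below degree m, which cuts the composition down to a finite sum.\<close>

lemma fps_mult_compose_nth:
  fixes A U z :: "'a :: idom fps"
  assumes "z $ 0 = 0"
  shows "(A * (U oo z)) $ n = (\<Sum>m\<le>n. U $ m * (A * z ^ m) $ n)"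
proof -
  have c: "(U oo z) $ j = (\<Sum>m\<le>n. U $ m * z ^ m $ j)" if "j \<le> n" for j
    unfolding fps_compose_nth
    by (rule sum.mono_neutral_left) (use that startsby_zero_power_prefix[OF assms] in auto)
  have "(A * (U oo z)) $ n = (\<Sum>i=0..n. A $ i * (\<Sum>m\<le>n. U $ m * z ^ m $ (n - i)))"
    unfolding fps_mult_nth by (intro sum.cong refl) (simp add: c)
  also have "\<dots> = (\<Sum>m\<le>n. \<Sum>i=0..n. A $ i * (U $ m * z ^ m $ (n - i)))"
    unfolding sum_distrib_left by (rule sum.swap)
  also have "\<dots> = (\<Sum>m\<le>n. U $ m * (A * z ^ m) $ n)"
    unfolding fps_mult_nth sum_distrib_left by (intro sum.cong refl) (simp add: algebra_simps)
  finally show ?thesis .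
qed

text \<open>The coefficients are series in y and do not form a field. The inverse is built from the
  inverse of the constant coefficient, which is a unit because its own constant term does not
  vanish.\<close>

lemma fps_fps_divide_eq:
  fixes A D V :: "rat fps fps"
  assumes "D * V = 1" "D $ 0 $ 0 \<noteq> 0"
  shows "A / D = A * V"
proof -
  have "D $ 0 * inverse (D $ 0) = 1" by (rule inverse_mult_eq_1') (rule assms(2))
  hence "D * inverse D = 1" unfolding fps_inverse_def by (rule fps_right_inverse)
  hence "inverse D * D = 1" by (simp only: mult.commute)
  have "inverse D = inverse D * (D * V)" by (simp only: assms(1) mult_1_right)
  also have "\<dots> = V" unfolding mult.assoc[symmetric] \<open>inverse D * D = 1\<close> by (rule mult_1)
  finally have "inverse D = V" .
  moreover have "subdegree D = 0" using assms(2) by (intro subdegree_eq_0) auto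
  ultimately show ?thesis by (simp add: fps_divide_unit')
qed

text \<open>Brings \<open>J\<close> into the shape of \<open>F_nth\<close>, with
  \<open>n_cores B\<close> in place of \<open>n_cores_betti k\<close>, so that the theorem reduces
  to an identity of coefficients.\<close>

lemma J_nth:
  assumes k: "k \<ge> 2" and B: "B \<in> BG k"
  shows "J k B $ r $ s = (\<Sum>a\<le>r. \<Sum>b\<le>s. of_nat (n_cores B a b) / (fact a * fact b) * (T_x ^ a * T_y ^ b) $ r $ s)"
proof -
  obtain C :: "(nat + nat) bigraph" where C: "B = iso_class (minimal_form C)" "core C" "betti C = k"
    using B unfolding BG_cores[OF k] by blast
  define H where "H = (SOME G. G \<in> B)"
  have H: "H \<in> iso_class (minimal_form C)"
    unfolding H_def C(1) using iso_class_nonempty[OF C(2)] by (rule someI_ex)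
  define a0 where "a0 = card (lverts H)"
  define b0 where "b0 = card (rverts H)"
  define n where "n = card (slots H)"
  define g where "g = card (automorphisms H)"
  \<comment> \<open>Coefficients of the exponential generating function of the cores over
    \<open>B\<close>, indexed by the excess. The initial value is 1 / g, and the recurrence is that
    of negative binomial coefficients.\<close>
  define p :: "nat \<Rightarrow> rat" where "p m = of_nat (n_cores B (a0 + m) (b0 + m)) / (fact (a0 + m) * fact (b0 + m))" for m
  have cH: "core H" by (rule representative(1)[OF C(2) H])
  have bH: "betti H = k" using representative(6)[OF C(2) H] C(3) by simp
  have g0: "g > 0" unfolding g_def by (rule card_automorphisms_pos[OF coreD(1)[OF cH]])
  have p0: "of_nat g * p 0 = 1"
  proof -
    have "n_cores B a0 b0 * g = fact a0 * fact b0"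
      using n_cores_base[OF C(2) H] by (simp add: C(1) a0_def b0_def g_def)
    hence "(of_nat (n_cores B a0 b0 * g) :: rat) = of_nat (fact a0 * fact b0)" by simp
    thus ?thesis by (simp add: p_def field_simps)
  qed
  have step: "of_nat (Suc m) * p (Suc m) = of_nat (m + n) * p m" for m
  proof -
    have "Suc m * n_cores B (Suc (a0 + m)) (Suc (b0 + m)) = Suc (a0 + m) * Suc (b0 + m) * (m + n) * n_cores B (a0 + m) (b0 + m)"
      using n_cores_step[OF C(2) H, of "Suc (a0 + m)" m "Suc (b0 + m)"] by (simp add: C(1) a0_def b0_def n_def)
    hence "(of_nat (Suc m * n_cores B (Suc (a0 + m)) (Suc (b0 + m))) :: rat)
      = of_nat (Suc (a0 + m) * Suc (b0 + m) * (m + n) * n_cores B (a0 + m) (b0 + m))" by (simp only:)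
    hence e: "of_nat (Suc m) * of_nat (n_cores B (Suc (a0 + m)) (Suc (b0 + m)))
      = of_nat (Suc (a0 + m)) * of_nat (Suc (b0 + m)) * of_nat (m + n) * (of_nat (n_cores B (a0 + m) (b0 + m)) :: rat)"
      by (simp only: of_nat_mult)
    have "of_nat (Suc m) * p (Suc m) = of_nat (Suc m) * of_nat (n_cores B (Suc (a0 + m)) (Suc (b0 + m))) /
       (of_nat (Suc (a0 + m)) * of_nat (Suc (b0 + m)) * (fact (a0 + m) * fact (b0 + m)))"
      by (simp add: p_def del: of_nat_Suc)
    also have "\<dots> = of_nat (m + n) * p m" unfolding e
      by (simp add: p_def del: of_nat_Suc of_nat_add)
    finally show ?thesis .
  qed
  \<comment> \<open>A series in one auxiliary variable, for which \<open>T_x * T_y\<close> is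
    substituted. Its coefficients are constants, placed in \<open>rat fps\<close> so that the
    substitution stays inside \<open>rat fps fps\<close>.\<close>
  define U :: "rat fps fps" where "U = Abs_fps (\<lambda>m. fps_const (p m))"
  let ?z = "T_x * T_y"
  let ?D = "of_nat g * (1 - ?z) ^ n"
  have z0: "?z $ 0 = 0" by (simp add: T_x_def)
  have "(1 - fps_X) ^ n * U = fps_const (U $ 0)"
  proof (rule fps_neg_binomial_recurrence)
    fix m
    have "fps_const (of_nat (Suc m) * p (Suc m)) = fps_const (of_nat (m + n) * p m)" by (simp only: step)
    thus "of_nat (Suc m) * U $ Suc m = of_nat (m + n) * U $ m"
      by (simp only: U_def fps_nth_Abs_fps fps_of_nat[symmetric] fps_const_mult)
  qed
  hence "((1 - fps_X) ^ n * U) oo ?z = fps_const (fps_const (p 0)) oo ?z" by (simp add: U_def)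
  hence "(1 - ?z) ^ n * (U oo ?z) = fps_const (fps_const (p 0))"
    by (simp add: fps_compose_mult_distrib[OF z0] fps_compose_power[OF z0, symmetric] fps_compose_sub_distrib
        fps_X_fps_compose_startby0[OF z0])
  moreover have "of_nat g * fps_const (fps_const (p 0)) = (1 :: rat fps fps)"
    using p0 by (simp add: fps_of_nat[symmetric])
  ultimately have DV: "?D * (U oo ?z) = 1" by (simp add: mult.assoc)
  have D0: "?D $ 0 $ 0 \<noteq> 0"
  proof -
    have "(1 - ?z) ^ n $ 0 = 1" by (simp add: fps_power_zeroth T_x_def)
    thus ?thesis using g0 by (simp add: fps_of_nat[symmetric])
  qed
  \<comment> \<open>The exponent of \<open>powi\<close> is thus a natural number, the number of
    slots, and the power an ordinary one.\<close>
  have "int (N_sp H) + k - 1 - int (n_delta_edges H) = int n"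
    using card_slots[OF cH] bH by (simp add: n_def)
  hence "J k B = T_x ^ a0 * T_y ^ b0 / ?D"
    by (simp add: J_def J_graph_def H_def[symmetric] a0_def b0_def g_def)
  also have "\<dots> = T_x ^ a0 * T_y ^ b0 * (U oo ?z)" by (rule fps_fps_divide_eq[OF DV D0])
  finally have "J k B $ r = (\<Sum>m\<le>r. U $ m * (T_x ^ a0 * T_y ^ b0 * ?z ^ m) $ r)"
    by (simp only: fps_mult_compose_nth[OF z0])
  hence "J k B $ r $ s = (\<Sum>m\<le>r. p m * (T_x ^ (a0 + m) * T_y ^ (b0 + m)) $ r $ s)"
    by (simp add: fps_sum_nth U_def power_mult_distrib power_add algebra_simps)
  \<comment> \<open>Terms whose exponents exceed r or s have coefficient 0; without them the pairs
    of exponents lie in the rectangle over which the claim sums.\<close>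
  also have "\<dots> = (\<Sum>m\<in>{m. a0 + m \<le> r \<and> b0 + m \<le> s}. p m * (T_x ^ (a0 + m) * T_y ^ (b0 + m)) $ r $ s)"
    by (rule sum.mono_neutral_right) (auto simp: T_power_nth)
  also have "\<dots> = (\<Sum>q\<in>(\<lambda>m. (a0 + m, b0 + m)) ` {m. a0 + m \<le> r \<and> b0 + m \<le> s}.
      of_nat (n_cores B (fst q) (snd q)) / (fact (fst q) * fact (snd q)) * (T_x ^ fst q * T_y ^ snd q) $ r $ s)"
    by (subst sum.reindex) (auto simp: inj_on_def p_def)
  \<comment> \<open>All other pairs of side sizes contribute 0, since a core over \<open>B\<close>
    exceeds \<open>H\<close> by the same number of vertices on both sides.\<close>
  also have "\<dots> = (\<Sum>q\<in>{..r} \<times> {..s}.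
      of_nat (n_cores B (fst q) (snd q)) / (fact (fst q) * fact (snd q)) * (T_x ^ fst q * T_y ^ snd q) $ r $ s)"
  proof (rule sum.mono_neutral_left)
    show "\<forall>q\<in>{..r} \<times> {..s} - (\<lambda>m. (a0 + m, b0 + m)) ` {m. a0 + m \<le> r \<and> b0 + m \<le> s}.
      of_nat (n_cores B (fst q) (snd q)) / (fact (fst q) * fact (snd q)) * (T_x ^ fst q * T_y ^ snd q) $ r $ s = 0"
    proof
      fix q assume q: "q \<in> {..r} \<times> {..s} - (\<lambda>m. (a0 + m, b0 + m)) ` {m. a0 + m \<le> r \<and> b0 + m \<le> s}"
      have "n_cores B (fst q) (snd q) = 0"
      proof (rule ccontr)
        assume "n_cores B (fst q) (snd q) \<noteq> 0"
        then obtain m where "fst q = a0 + m" "snd q = b0 + m"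
          using n_cores_nonzero[OF C(2) H] by (auto simp: C(1) a0_def b0_def)
        hence "q = (a0 + m, b0 + m)" "a0 + m \<le> r" "b0 + m \<le> s" using q by (auto simp: prod_eq_iff)
        thus False using q by blast
      qed
      thus "of_nat (n_cores B (fst q) (snd q)) / (fact (fst q) * fact (snd q)) * (T_x ^ fst q * T_y ^ snd q) $ r $ s = 0"
        by simp
    qed
  qed auto
  finally show ?thesis by (simp add: sum.cartesian_product case_prod_beta)
qed

theorem theorem1p6:
  fixes k :: int
  assumes "k \<ge> 2"
  shows "F k = (\<Sum>B\<in>BG k. J k B)"
proof (rule fps_ext, rule fps_ext)
  fix r s
  let ?t = "\<lambda>a b. (T_x ^ a * T_y ^ b) $ r $ s"
  have "F k $ r $ s = (\<Sum>a\<le>r. \<Sum>b\<le>s. \<Sum>B\<in>BG k. of_nat (n_cores B a b) / (fact a * fact b) * ?t a b)"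
    unfolding F_nth[OF assms] n_cores_betti_sum[OF assms]
    by (simp add: sum_divide_distrib sum_distrib_right)
  also have "\<dots> = (\<Sum>a\<le>r. \<Sum>B\<in>BG k. \<Sum>b\<le>s. of_nat (n_cores B a b) / (fact a * fact b) * ?t a b)"
    by (intro sum.cong refl sum.swap)
  also have "\<dots> = (\<Sum>B\<in>BG k. \<Sum>a\<le>r. \<Sum>b\<le>s. of_nat (n_cores B a b) / (fact a * fact b) * ?t a b)"
    by (rule sum.swap)
  also have "\<dots> = (\<Sum>B\<in>BG k. J k B $ r $ s)" by (intro sum.cong refl J_nth[symmetric] assms)
  finally show "F k $ r $ s = (\<Sum>B\<in>BG k. J k B) $ r $ s" by (simp add: fps_sum_nth)
qed

end
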